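(* Let $\mathcal{C}$ be an abelian category and let $(\mathcal{T},\mathcal{F})$ be a torsion pair in $\mathcal{C}$ such that $\mathrm{Hom}_{\mathcal{C}}(F,T)=0$ for all $F\in\mathcal{F}$ and $T\in\mathcal{T}$. Set $$M\colon\mathcal{F}^{\mathrm{op}}\times\mathcal{T}\longrightarrow\mathbf{Ab},\qquad M(F,T):=\mathrm{Ext}^1_{\mathcal{C}}(F,T).$$ Then there is an equivalence of abelian categories $\mathcal{C}\simeq\mathcal{F}\times_M\mathcal{T}$.
   Context: A torsion pair in an abelian category $\mathcal{C}$ is a pair $(\mathcal{T},\mathcal{F})$ of full subcategories such that $\mathrm{Hom}_{\mathcal{C}}(T,F)=0$ for all $T\in\mathcal{T}$, $F\in\mathcal{F}$, and every object $E\in\mathcal{C}$ fits in a short exact sequence $0\to T\to E\to F\to 0$ with $T\in\mathcal{T}$, $F\in\mathcal{F}$. $\mathrm{Ext}^1_{\mathcal{C}}$ is the Yoneda Ext group, with its functoriality by pullback and pushout of extensions. Given additive categories $\mathcal{F},\mathcal{T}$ and a biadditive bifunctor $M\colon\mathcal{F}^{\mathrm{op}}\times\mathcal{T}\to\mathbf{Ab}$, the glued category $\mathcal{F}\times_M\mathcal{T}$ has as objects triples $(F,T,\mu)$ with $F\in\mathcal{F}$, $T\in\mathcal{T}$, $\mu\in M(F,T)$; a morphism $(F,T,\mu)\to(F',T',\mu')$ is a pair $(f,g)$ with $f\colon F\to F'$ in $\mathcal{F}$, $g\colon T\to T'$ in $\mathcal{T}$ such that $M(\mathrm{id}_F,g)(\mu)=M(f,\mathrm{id}_{T'})(\mu')$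 in $M(F,T')$. Composition is componentwise. *)

theory Defs
  imports "HOL-Algebra.Group"
begin

section \<open>Categories\<close>

text \<open>
  Categories have an arbitrary set of objects and an arbitrary set of arrows.  The
  expression \<open>g \<cdot> f\<close> means "first \<open>f\<close>, then \<open>g\<close>" and is only meaningful if
  \<open>Cod f = Dom g\<close>.
\<close>

record ('o, 'm) category =
  Obj :: "'o set"
  Arr :: "'m set"
  Dom :: "'m \<Rightarrow> 'o"
  Cod :: "'m \<Rightarrow> 'o"
  Ident :: "'o \<Rightarrow> 'm"
  Comp :: "'m \<Rightarrow> 'm \<Rightarrow> 'm" (infixr "\<cdot>\<index>" 75)

definition Hom :: "('o, 'm, 'z) category_scheme \<Rightarrow> 'o \<Rightarrow> 'o \<Rightarrow> 'm set" where
  "Hom C X Y = {f \<in> Arr C. Dom C f = X \<and> Cod C f = Y}"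

locale category =
  fixes C :: "('o, 'm, 'z) category_scheme" (structure)
  assumes Dom_Obj: "f \<in> Arr C \<Longrightarrow> Dom C f \<in> Obj C"
    and Cod_Obj: "f \<in> Arr C \<Longrightarrow> Cod C f \<in> Obj C"
    and Ident_Hom: "X \<in> Obj C \<Longrightarrow> Ident C X \<in> Hom C X X"
    and Comp_Hom: "\<lbrakk>f \<in> Hom C X Y; g \<in> Hom C Y Z\<rbrakk> \<Longrightarrow> g \<cdot> f \<in> Hom C X Z"
    and Comp_assoc:
      "\<lbrakk>f \<in> Hom C W X; g \<in> Hom C X Y; h \<in> Hom C Y Z\<rbrakk> \<Longrightarrow> (h \<cdot> g) \<cdot> f = h \<cdot> (g \<cdot> f)"
    and Comp_Ident_right: "f \<in> Hom C X Y \<Longrightarrow> f \<cdot> Ident C X = f"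
    and Comp_Ident_left: "f \<in> Hom C X Y \<Longrightarrow> Ident C Y \<cdot> f = f"

definition is_mono :: "('o, 'm, 'z) category_scheme \<Rightarrow> 'm \<Rightarrow> bool" where
  "is_mono C f \<longleftrightarrow> f \<in> Arr C \<and>
     (\<forall>u\<in>Arr C. \<forall>v\<in>Arr C. Dom C u = Dom C v \<and> Cod C u = Dom C f \<and> Cod C v = Dom C f \<and>
        f \<cdot>\<^bsub>C\<^esub> u = f \<cdot>\<^bsub>C\<^esub> v \<longrightarrow> u = v)"

definition is_epi :: "('o, 'm, 'z) category_scheme \<Rightarrow> 'm \<Rightarrow> bool" where
  "is_epi C f \<longleftrightarrow> f \<in> Arr C \<and>
     (\<forall>u\<in>Arr C. \<forall>v\<in>Arr C. Cod C u = Cod C v \<and> Dom C u = Cod C f \<and> Dom C v = Cod C f \<and>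
        u \<cdot>\<^bsub>C\<^esub> f = v \<cdot>\<^bsub>C\<^esub> f \<longrightarrow> u = v)"

definition is_iso :: "('o, 'm, 'z) category_scheme \<Rightarrow> 'm \<Rightarrow> bool" where
  "is_iso C f \<longleftrightarrow> f \<in> Arr C \<and>
     (\<exists>g\<in>Hom C (Cod C f) (Dom C f).
        g \<cdot>\<^bsub>C\<^esub> f = Ident C (Dom C f) \<and> f \<cdot>\<^bsub>C\<^esub> g = Ident C (Cod C f))"

definition is_zero_object :: "('o, 'm, 'z) category_scheme \<Rightarrow> 'o \<Rightarrow> bool" where
  "is_zero_object C Z \<longleftrightarrow> Z \<in> Obj C \<and>
     (\<forall>X\<in>Obj C. (\<exists>!f. f \<in> Hom C X Z) \<and> (\<exists>!f. f \<in> Hom C Z X))"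

text \<open>
  The commutative square \<open>a \<cdot> a' = b \<cdot> b'\<close>, with \<open>a'\<close> and \<open>b'\<close> starting at the fibre product.
\<close>

definition is_pullback :: "('o, 'm, 'z) category_scheme \<Rightarrow> 'm \<Rightarrow> 'm \<Rightarrow> 'm \<Rightarrow> 'm \<Rightarrow> bool" where
  "is_pullback C a b a' b' \<longleftrightarrow>
     a \<in> Arr C \<and> b \<in> Arr C \<and> a' \<in> Arr C \<and> b' \<in> Arr C \<and>
     Cod C a = Cod C b \<and> Dom C a' = Dom C b' \<and> Cod C a' = Dom C a \<and> Cod C b' = Dom C b \<and>
     a \<cdot>\<^bsub>C\<^esub> a' = b \<cdot>\<^bsub>C\<^esub> b' \<and>
     (\<forall>W\<in>Obj C. \<forall>u\<in>Hom C W (Dom C a). \<forall>v\<in>Hom C W (Dom C b). a \<cdot>\<^bsub>C\<^esub> u = b \<cdot>\<^bsub>C\<^esub> v \<longrightarrow>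
        (\<exists>!w. w \<in> Hom C W (Dom C a') \<and> a' \<cdot>\<^bsub>C\<^esub> w = u \<and> b' \<cdot>\<^bsub>C\<^esub> w = v))"

text \<open>
  The commutative square \<open>a' \<cdot> a = b' \<cdot> b\<close>, with \<open>a'\<close> and \<open>b'\<close> ending at the amalgamated sum.
\<close>

definition is_pushout :: "('o, 'm, 'z) category_scheme \<Rightarrow> 'm \<Rightarrow> 'm \<Rightarrow> 'm \<Rightarrow> 'm \<Rightarrow> bool" where
  "is_pushout C a b a' b' \<longleftrightarrow>
     a \<in> Arr C \<and> b \<in> Arr C \<and> a' \<in> Arr C \<and> b' \<in> Arr C \<and>
     Dom C a = Dom C b \<and> Cod C a' = Cod C b' \<and> Dom C a' = Cod C a \<and> Dom C b' = Cod C b \<and>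
     a' \<cdot>\<^bsub>C\<^esub> a = b' \<cdot>\<^bsub>C\<^esub> b \<and>
     (\<forall>W\<in>Obj C. \<forall>u\<in>Hom C (Cod C a) W. \<forall>v\<in>Hom C (Cod C b) W. u \<cdot>\<^bsub>C\<^esub> a = v \<cdot>\<^bsub>C\<^esub> b \<longrightarrow>
        (\<exists>!w. w \<in> Hom C (Cod C a') W \<and> w \<cdot>\<^bsub>C\<^esub> a' = u \<and> w \<cdot>\<^bsub>C\<^esub> b' = v))"

section \<open>Additive and abelian categories\<close>

record ('o, 'm) preadditive = "('o, 'm) category" +
  Add :: "'m \<Rightarrow> 'm \<Rightarrow> 'm" (infixl "\<boxplus>\<index>" 65)
  Zero :: "'o \<Rightarrow> 'o \<Rightarrow> 'm"

definition Hom_group :: "('o, 'm, 'z) preadditive_scheme \<Rightarrow> 'o \<Rightarrow> 'o \<Rightarrow> 'm monoid" where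
  "Hom_group C X Y = \<lparr>carrier = Hom C X Y, monoid.mult = Add C, one = Zero C X Y\<rparr>"

locale preadditive_category = category C
  for C :: "('o, 'm, 'z) preadditive_scheme" (structure) +
  assumes Hom_comm_group: "\<lbrakk>X \<in> Obj C; Y \<in> Obj C\<rbrakk> \<Longrightarrow> comm_group (Hom_group C X Y)"
    and Comp_Add_left:
      "\<lbrakk>f \<in> Hom C X Y; g \<in> Hom C Y Z; g' \<in> Hom C Y Z\<rbrakk> \<Longrightarrow> (g \<boxplus> g') \<cdot> f = g \<cdot> f \<boxplus> g' \<cdot> f"
    and Comp_Add_right:
      "\<lbrakk>f \<in> Hom C X Y; f' \<in> Hom C X Y; g \<in> Hom C Y Z\<rbrakk> \<Longrightarrow> g \<cdot> (f \<boxplus> f') = g \<cdot> f \<boxplus> g \<cdot> f'"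

text \<open>A biproduct \<open>B\<close> of \<open>X\<close> and \<open>Y\<close> with injections \<open>j\<^sub>1, j\<^sub>2\<close> and projections \<open>q\<^sub>1, q\<^sub>2\<close>.\<close>

definition is_biproduct ::
  "('o, 'm, 'z) preadditive_scheme \<Rightarrow> 'o \<Rightarrow> 'o \<Rightarrow> 'o \<times> 'm \<times> 'm \<times> 'm \<times> 'm \<Rightarrow> bool" where
  "is_biproduct C X Y = (\<lambda>(B, j\<^sub>1, j\<^sub>2, q\<^sub>1, q\<^sub>2).
     B \<in> Obj C \<and>
     j\<^sub>1 \<in> Hom C X B \<and> j\<^sub>2 \<in> Hom C Y B \<and> q\<^sub>1 \<in> Hom C B X \<and> q\<^sub>2 \<in> Hom C B Y \<and>
     q\<^sub>1 \<cdot>\<^bsub>C\<^esub> j\<^sub>1 = Ident C X \<and> q\<^sub>2 \<cdot>\<^bsub>C\<^esub> j\<^sub>2 = Ident C Y \<and>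
     q\<^sub>2 \<cdot>\<^bsub>C\<^esub> j\<^sub>1 = Zero C X Y \<and> q\<^sub>1 \<cdot>\<^bsub>C\<^esub> j\<^sub>2 = Zero C Y X \<and>
     j\<^sub>1 \<cdot>\<^bsub>C\<^esub> q\<^sub>1 \<boxplus>\<^bsub>C\<^esub> j\<^sub>2 \<cdot>\<^bsub>C\<^esub> q\<^sub>2 = Ident C B)"

locale additive_category = preadditive_category C
  for C :: "('o, 'm, 'z) preadditive_scheme" (structure) +
  assumes ex_zero_object: "\<exists>Z. is_zero_object C Z"
    and ex_biproduct: "\<lbrakk>X \<in> Obj C; Y \<in> Obj C\<rbrakk> \<Longrightarrow> \<exists>b. is_biproduct C X Y b"

definition is_kernel :: "('o, 'm, 'z) preadditive_scheme \<Rightarrow> 'm \<Rightarrow> 'm \<Rightarrow> bool" where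
  "is_kernel C f k \<longleftrightarrow> f \<in> Arr C \<and> k \<in> Arr C \<and> Cod C k = Dom C f \<and>
     f \<cdot>\<^bsub>C\<^esub> k = Zero C (Dom C k) (Cod C f) \<and>
     (\<forall>W\<in>Obj C. \<forall>h\<in>Hom C W (Dom C f). f \<cdot>\<^bsub>C\<^esub> h = Zero C W (Cod C f) \<longrightarrow>
        (\<exists>!u. u \<in> Hom C W (Dom C k) \<and> k \<cdot>\<^bsub>C\<^esub> u = h))"

definition is_cokernel :: "('o, 'm, 'z) preadditive_scheme \<Rightarrow> 'm \<Rightarrow> 'm \<Rightarrow> bool" where
  "is_cokernel C f c \<longleftrightarrow> f \<in> Arr C \<and> c \<in> Arr C \<and> Dom C c = Cod C f \<and>
     c \<cdot>\<^bsub>C\<^esub> f = Zero C (Dom C f) (Cod C c) \<and>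
     (\<forall>W\<in>Obj C. \<forall>h\<in>Hom C (Cod C f) W. h \<cdot>\<^bsub>C\<^esub> f = Zero C (Dom C f) W \<longrightarrow>
        (\<exists>!u. u \<in> Hom C (Cod C c) W \<and> u \<cdot>\<^bsub>C\<^esub> c = h))"

locale abelian_category = additive_category C
  for C :: "('o, 'm, 'z) preadditive_scheme" (structure) +
  assumes ex_kernel: "f \<in> Arr C \<Longrightarrow> \<exists>k. is_kernel C f k"
    and ex_cokernel: "f \<in> Arr C \<Longrightarrow> \<exists>c. is_cokernel C f c"
    and mono_is_kernel: "is_mono C f \<Longrightarrow> \<exists>g. is_kernel C g f"
    and epi_is_cokernel: "is_epi C f \<Longrightarrow> \<exists>g. is_cokernel C g f"

text \<open>\<open>0 \<rightarrow> Dom i \<rightarrow> Cod i = Dom p \<rightarrow> Cod p \<rightarrow> 0\<close>, with arrows \<open>i\<close> and \<open>p\<close>, is exact.\<close>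

definition short_exact :: "('o, 'm, 'z) preadditive_scheme \<Rightarrow> 'm \<Rightarrow> 'm \<Rightarrow> bool" where
  "short_exact C i p \<longleftrightarrow> is_kernel C p i \<and> is_cokernel C i p"

definition full_subcategory ::
  "('o, 'm, 'z) preadditive_scheme \<Rightarrow> 'o set \<Rightarrow> ('o, 'm, 'z) preadditive_scheme" where
  "full_subcategory C S = C\<lparr>Obj := S, Arr := {f \<in> Arr C. Dom C f \<in> S \<and> Cod C f \<in> S}\<rparr>"

text \<open>Full subcategories are given by their sets of objects.\<close>

definition torsion_pair :: "('o, 'm, 'z) preadditive_scheme \<Rightarrow> 'o set \<Rightarrow> 'o set \<Rightarrow> bool" where
  "torsion_pair C \<T> \<F> \<longleftrightarrow> \<T> \<subseteq> Obj C \<and> \<F> \<subseteq> Obj C \<and>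
     (\<forall>T\<in>\<T>. \<forall>F\<in>\<F>. Hom C T F = {Zero C T F}) \<and>
     (\<forall>E\<in>Obj C. \<exists>i p. short_exact C i p \<and> Cod C i = E \<and> Dom C i \<in> \<T> \<and> Cod C p \<in> \<F>)"

section \<open>Bifunctors to abelian groups and glued categories\<close>

text \<open>
  A bifunctor contravariant in the first and covariant in the second argument:
  \<open>Act M f g\<close> maps \<open>Val M X Y\<close> to \<open>Val M X' Y'\<close> for \<open>f : X' \<rightarrow> X\<close> and \<open>g : Y \<rightarrow> Y'\<close>.
\<close>

record ('o\<^sub>1, 'm\<^sub>1, 'o\<^sub>2, 'm\<^sub>2, 'e) bifunctor =
  Val :: "'o\<^sub>1 \<Rightarrow> 'o\<^sub>2 \<Rightarrow> 'e monoid"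
  Act :: "'m\<^sub>1 \<Rightarrow> 'm\<^sub>2 \<Rightarrow> 'e \<Rightarrow> 'e"

locale biadditive_bifunctor = F: additive_category F + T: additive_category T
  for F :: "('o\<^sub>1, 'm\<^sub>1, 'y) preadditive_scheme"
    and T :: "('o\<^sub>2, 'm\<^sub>2, 'z) preadditive_scheme" +
  fixes M :: "('o\<^sub>1, 'm\<^sub>1, 'o\<^sub>2, 'm\<^sub>2, 'e) bifunctor"
  assumes Val_comm_group: "\<lbrakk>X \<in> Obj F; Y \<in> Obj T\<rbrakk> \<Longrightarrow> comm_group (Val M X Y)"
    and Act_hom:
      "\<lbrakk>f \<in> Hom F X' X; g \<in> Hom T Y Y'\<rbrakk> \<Longrightarrow> Act M f g \<in> hom (Val M X Y) (Val M X' Y')"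
    and Act_Ident:
      "\<lbrakk>X \<in> Obj F; Y \<in> Obj T; \<mu> \<in> carrier (Val M X Y)\<rbrakk> \<Longrightarrow>
        Act M (Ident F X) (Ident T Y) \<mu> = \<mu>"
    and Act_Comp:
      "\<lbrakk>f \<in> Hom F X' X; f' \<in> Hom F X'' X'; g \<in> Hom T Y Y'; g' \<in> Hom T Y' Y'';
        \<mu> \<in> carrier (Val M X Y)\<rbrakk> \<Longrightarrow>
        Act M (f \<cdot>\<^bsub>F\<^esub> f') (g' \<cdot>\<^bsub>T\<^esub> g) \<mu> = Act M f' g' (Act M f g \<mu>)"
    and Act_Add_left:
      "\<lbrakk>f \<in> Hom F X' X; f' \<in> Hom F X' X; g \<in> Hom T Y Y'; \<mu> \<in> carrier (Val M X Y)\<rbrakk> \<Longrightarrow>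
        Act M (f \<boxplus>\<^bsub>F\<^esub> f') g \<mu> = Act M f g \<mu> \<otimes>\<^bsub>Val M X' Y'\<^esub> Act M f' g \<mu>"
    and Act_Add_right:
      "\<lbrakk>f \<in> Hom F X' X; g \<in> Hom T Y Y'; g' \<in> Hom T Y Y'; \<mu> \<in> carrier (Val M X Y)\<rbrakk> \<Longrightarrow>
        Act M f (g \<boxplus>\<^bsub>T\<^esub> g') \<mu> = Act M f g \<mu> \<otimes>\<^bsub>Val M X' Y'\<^esub> Act M f g' \<mu>"

text \<open>
  The glued category \<open>F \<times>\<^sub>M T\<close>.  An arrow is stored as \<open>(A, f, g, B)\<close>, because the pair
  \<open>(f, g)\<close> does not determine the third components of its source \<open>A\<close> and target \<open>B\<close>.
\<close>

definition glued ::
  "('o\<^sub>1, 'm\<^sub>1, 'y) preadditive_scheme \<Rightarrow> ('o\<^sub>2, 'm\<^sub>2, 'z) preadditive_scheme \<Rightarrow>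
   ('o\<^sub>1, 'm\<^sub>1, 'o\<^sub>2, 'm\<^sub>2, 'e) bifunctor \<Rightarrow>
   ('o\<^sub>1 \<times> 'o\<^sub>2 \<times> 'e, ('o\<^sub>1 \<times> 'o\<^sub>2 \<times> 'e) \<times> 'm\<^sub>1 \<times> 'm\<^sub>2 \<times> ('o\<^sub>1 \<times> 'o\<^sub>2 \<times> 'e)) preadditive" where
  "glued F T M =
    (let Ob = {(X, Y, \<mu>). X \<in> Obj F \<and> Y \<in> Obj T \<and> \<mu> \<in> carrier (Val M X Y)} in
     \<lparr>Obj = Ob,
      Arr = {((X, Y, \<mu>), f, g, (X', Y', \<mu>')) | X Y \<mu> f g X' Y' \<mu>'.
               (X, Y, \<mu>) \<in> Ob \<and> (X', Y', \<mu>') \<in> Ob \<and> f \<in> Hom F X X' \<and> g \<in> Hom T Y Y' \<and>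
               Act M (Ident F X) g \<mu> = Act M f (Ident T Y') \<mu>'},
      Dom = (\<lambda>(A, f, g, B). A),
      Cod = (\<lambda>(A, f, g, B). B),
      Ident = (\<lambda>(X, Y, \<mu>). ((X, Y, \<mu>), Ident F X, Ident T Y, (X, Y, \<mu>))),
      Comp = (\<lambda>(A', f', g', B') (A, f, g, B). (A, f' \<cdot>\<^bsub>F\<^esub> f, g' \<cdot>\<^bsub>T\<^esub> g, B')),
      Add = (\<lambda>(A, f, g, B) (A', f', g', B'). (A, f \<boxplus>\<^bsub>F\<^esub> f', g \<boxplus>\<^bsub>T\<^esub> g', B)),
      Zero = (\<lambda>(X, Y, \<mu>) (X', Y', \<mu>').
                ((X, Y, \<mu>), Zero F X X', Zero T Y Y', (X', Y', \<mu>')))\<rparr>)"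

section \<open>The Yoneda Ext group\<close>

text \<open>The pair \<open>(i, p)\<close> stands for the extension \<open>0 \<rightarrow> Y \<rightarrow> E \<rightarrow> X \<rightarrow> 0\<close> with arrows \<open>i\<close> and \<open>p\<close>.\<close>

definition extensions :: "('o, 'm, 'z) preadditive_scheme \<Rightarrow> 'o \<Rightarrow> 'o \<Rightarrow> ('m \<times> 'm) set" where
  "extensions C X Y = {(i, p). short_exact C i p \<and> Dom C i = Y \<and> Cod C p = X}"

definition ext_equiv ::
  "('o, 'm, 'z) preadditive_scheme \<Rightarrow> 'o \<Rightarrow> 'o \<Rightarrow> (('m \<times> 'm) \<times> ('m \<times> 'm)) set" where
  "ext_equiv C X Y = {((i, p), (i', p')).
     (i, p) \<in> extensions C X Y \<and> (i', p') \<in> extensions C X Y \<and>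
     (\<exists>h\<in>Hom C (Cod C i) (Cod C i'). is_iso C h \<and> h \<cdot>\<^bsub>C\<^esub> i = i' \<and> p' \<cdot>\<^bsub>C\<^esub> h = p)}"

text \<open>
  \<open>ext_pullback C f \<mu>\<close> collects all pullbacks along \<open>f : X' \<rightarrow> X\<close> of representatives of the class
  \<open>\<mu>\<close>; these form one class, so no pullback has to be chosen.  The same applies to
  \<open>ext_pushout\<close>.
\<close>

definition ext_pullback ::
  "('o, 'm, 'z) preadditive_scheme \<Rightarrow> 'm \<Rightarrow> ('m \<times> 'm) set \<Rightarrow> ('m \<times> 'm) set" where
  "ext_pullback C f \<mu> = {(i', p'). short_exact C i' p' \<and>
     (\<exists>(i, p)\<in>\<mu>. \<exists>h\<in>Hom C (Cod C i') (Cod C i). h \<cdot>\<^bsub>C\<^esub> i' = i \<and> is_pullback C p f h p')}"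

definition ext_pushout ::
  "('o, 'm, 'z) preadditive_scheme \<Rightarrow> 'm \<Rightarrow> ('m \<times> 'm) set \<Rightarrow> ('m \<times> 'm) set" where
  "ext_pushout C g \<mu> = {(i', p'). short_exact C i' p' \<and>
     (\<exists>(i, p)\<in>\<mu>. \<exists>h\<in>Hom C (Cod C i) (Cod C i'). p' \<cdot>\<^bsub>C\<^esub> h = p \<and> is_pushout C i g h i')}"

definition ext_map ::
  "('o, 'm, 'z) preadditive_scheme \<Rightarrow> 'm \<Rightarrow> 'm \<Rightarrow> ('m \<times> 'm) set \<Rightarrow> ('m \<times> 'm) set" where
  "ext_map C f g \<mu> = ext_pushout C g (ext_pullback C f \<mu>)"

definition biproduct ::
  "('o, 'm, 'z) preadditive_scheme \<Rightarrow> 'o \<Rightarrow> 'o \<Rightarrow> 'o \<times> 'm \<times> 'm \<times> 'm \<times> 'm" where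
  "biproduct C X Y = (SOME b. is_biproduct C X Y b)"

definition biproduct_obj :: "('o, 'm, 'z) preadditive_scheme \<Rightarrow> 'o \<Rightarrow> 'o \<Rightarrow> 'o" where
  "biproduct_obj C X Y = fst (biproduct C X Y)"

definition diagonal :: "('o, 'm, 'z) preadditive_scheme \<Rightarrow> 'o \<Rightarrow> 'm" where
  "diagonal C X = (case biproduct C X X of (B, j\<^sub>1, j\<^sub>2, q\<^sub>1, q\<^sub>2) \<Rightarrow> j\<^sub>1 \<boxplus>\<^bsub>C\<^esub> j\<^sub>2)"

definition codiagonal :: "('o, 'm, 'z) preadditive_scheme \<Rightarrow> 'o \<Rightarrow> 'm" where
  "codiagonal C X = (case biproduct C X X of (B, j\<^sub>1, j\<^sub>2, q\<^sub>1, q\<^sub>2) \<Rightarrow> q\<^sub>1 \<boxplus>\<^bsub>C\<^esub> q\<^sub>2)"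

definition direct_sum :: "('o, 'm, 'z) preadditive_scheme \<Rightarrow> 'm \<Rightarrow> 'm \<Rightarrow> 'm" where
  "direct_sum C f\<^sub>1 f\<^sub>2 =
    (case biproduct C (Dom C f\<^sub>1) (Dom C f\<^sub>2) of (B, j\<^sub>1, j\<^sub>2, q\<^sub>1, q\<^sub>2) \<Rightarrow>
     case biproduct C (Cod C f\<^sub>1) (Cod C f\<^sub>2) of (B', j\<^sub>1', j\<^sub>2', q\<^sub>1', q\<^sub>2') \<Rightarrow>
       j\<^sub>1' \<cdot>\<^bsub>C\<^esub> f\<^sub>1 \<cdot>\<^bsub>C\<^esub> q\<^sub>1 \<boxplus>\<^bsub>C\<^esub> j\<^sub>2' \<cdot>\<^bsub>C\<^esub> f\<^sub>2 \<cdot>\<^bsub>C\<^esub> q\<^sub>2)"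

definition ext_direct_sum ::
  "('o, 'm, 'z) preadditive_scheme \<Rightarrow> 'o \<Rightarrow> 'o \<Rightarrow>
   ('m \<times> 'm) set \<Rightarrow> ('m \<times> 'm) set \<Rightarrow> ('m \<times> 'm) set" where
  "ext_direct_sum C X Y \<mu> \<nu> = (\<Union>(i, p)\<in>\<mu>. \<Union>(i', p')\<in>\<nu>.
     ext_equiv C (biproduct_obj C X X) (biproduct_obj C Y Y) ``
       {(direct_sum C i i', direct_sum C p p')})"

definition baer_sum ::
  "('o, 'm, 'z) preadditive_scheme \<Rightarrow> 'o \<Rightarrow> 'o \<Rightarrow>
   ('m \<times> 'm) set \<Rightarrow> ('m \<times> 'm) set \<Rightarrow> ('m \<times> 'm) set" where
  "baer_sum C X Y \<mu> \<nu> = ext_map C (diagonal C X) (codiagonal C Y) (ext_direct_sum C X Y \<mu> \<nu>)"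

text \<open>The class of \<open>0 \<rightarrow> Y \<rightarrow> Y \<oplus> X \<rightarrow> X \<rightarrow> 0\<close>.\<close>

definition split_extension_class ::
  "('o, 'm, 'z) preadditive_scheme \<Rightarrow> 'o \<Rightarrow> 'o \<Rightarrow> ('m \<times> 'm) set" where
  "split_extension_class C X Y =
    (case biproduct C Y X of (B, j\<^sub>1, j\<^sub>2, q\<^sub>1, q\<^sub>2) \<Rightarrow> ext_equiv C X Y `` {(j\<^sub>1, q\<^sub>2)})"

definition Ext_group ::
  "('o, 'm, 'z) preadditive_scheme \<Rightarrow> 'o \<Rightarrow> 'o \<Rightarrow> ('m \<times> 'm) set monoid" where
  "Ext_group C X Y =
    \<lparr>carrier = extensions C X Y // ext_equiv C X Y,
     monoid.mult = baer_sum C X Y,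
     one = split_extension_class C X Y\<rparr>"

definition Ext_bifunctor ::
  "('o, 'm, 'z) preadditive_scheme \<Rightarrow> ('o, 'm, 'o, 'm, ('m \<times> 'm) set) bifunctor" where
  "Ext_bifunctor C = \<lparr>Val = Ext_group C, Act = ext_map C\<rparr>"

section \<open>Equivalences\<close>

locale additive_functor = C: preadditive_category C + D: preadditive_category D
  for C :: "('o\<^sub>1, 'm\<^sub>1, 'y) preadditive_scheme"
    and D :: "('o\<^sub>2, 'm\<^sub>2, 'z) preadditive_scheme" +
  fixes \<Phi>\<^sub>o :: "'o\<^sub>1 \<Rightarrow> 'o\<^sub>2" and \<Phi> :: "'m\<^sub>1 \<Rightarrow> 'm\<^sub>2"
  assumes map_Obj: "X \<in> Obj C \<Longrightarrow> \<Phi>\<^sub>o X \<in> Obj D"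
    and map_Hom: "f \<in> Hom C X Y \<Longrightarrow> \<Phi> f \<in> Hom D (\<Phi>\<^sub>o X) (\<Phi>\<^sub>o Y)"
    and map_Ident: "X \<in> Obj C \<Longrightarrow> \<Phi> (Ident C X) = Ident D (\<Phi>\<^sub>o X)"
    and map_Comp:
      "\<lbrakk>f \<in> Hom C X Y; g \<in> Hom C Y Z\<rbrakk> \<Longrightarrow> \<Phi> (g \<cdot>\<^bsub>C\<^esub> f) = \<Phi> g \<cdot>\<^bsub>D\<^esub> \<Phi> f"
    and map_Add:
      "\<lbrakk>f \<in> Hom C X Y; f' \<in> Hom C X Y\<rbrakk> \<Longrightarrow> \<Phi> (f \<boxplus>\<^bsub>C\<^esub> f') = \<Phi> f \<boxplus>\<^bsub>D\<^esub> \<Phi> f'"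

definition natural_iso_to_identity ::
  "('o, 'm, 'z) category_scheme \<Rightarrow> ('o \<Rightarrow> 'o) \<Rightarrow> ('m \<Rightarrow> 'm) \<Rightarrow> ('o \<Rightarrow> 'm) \<Rightarrow> bool" where
  "natural_iso_to_identity C \<Theta>\<^sub>o \<Theta> \<eta> \<longleftrightarrow>
     (\<forall>X\<in>Obj C. \<eta> X \<in> Hom C (\<Theta>\<^sub>o X) X \<and> is_iso C (\<eta> X)) \<and>
     (\<forall>f\<in>Arr C. f \<cdot>\<^bsub>C\<^esub> \<eta> (Dom C f) = \<eta> (Cod C f) \<cdot>\<^bsub>C\<^esub> \<Theta> f)"

text \<open>
  Exactness of the two functors is not demanded separately: equivalences preserve kernels and
  cokernels.
\<close>

definition equivalent_abelian_categories ::
  "('o\<^sub>1, 'm\<^sub>1, 'y) preadditive_scheme \<Rightarrow> ('o\<^sub>2, 'm\<^sub>2, 'z) preadditive_scheme \<Rightarrow> bool" where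
  "equivalent_abelian_categories C D \<longleftrightarrow>
     abelian_category C \<and> abelian_category D \<and>
     (\<exists>\<Phi>\<^sub>o \<Phi> \<Psi>\<^sub>o \<Psi> \<eta> \<epsilon>.
        additive_functor C D \<Phi>\<^sub>o \<Phi> \<and> additive_functor D C \<Psi>\<^sub>o \<Psi> \<and>
        natural_iso_to_identity C (\<Psi>\<^sub>o \<circ> \<Phi>\<^sub>o) (\<Psi> \<circ> \<Phi>) \<eta> \<and>
        natural_iso_to_identity D (\<Phi>\<^sub>o \<circ> \<Psi>\<^sub>o) (\<Phi> \<circ> \<Psi>) \<epsilon>)"

end

(* The Ext groups are handled through morphisms of short exact sequences
   (g, f) : (0 -> Y -> E -> X -> 0) -> (0 -> Y' -> E' -> X' -> 0), given by g on the subobjects and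
   f on the quotients.  A pair (g, f) extends to such a morphism iff the pushout along g of the first
   class equals the pullback along f of the second, which is exactly the condition defining the
   arrows of the glued category.  Any two extensions of X are pushouts of one extension d of X, and
   g1_* d + g2_* d = (g1 + g2)_* d; since morphisms of extensions can be added, the group laws and
   biadditivity all follow from this.

   For a torsion pair with Hom(F, T) = 0, an arrow between the middle objects of two extensions of
   torsion-free by torsion objects induces a unique pair (g, f) because Hom(T, F) = 0, and is
   determined by it because Hom(F, T) = 0.  So sending a triple (X, Y, mu) to the middle object of a
   representative of mu is fully faithful, and the torsion sequences make it essentially surjective.
   Being abelian is then transported along this equivalence. *)

theory Submission
  imports Defs
begin

text \<open>A torsion pair is given by two sets of objects that are assumed neither additive nor
  closed under isomorphism. Zero objects and biproducts inside \<open>\<F>\<close> are therefore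
  torsion-free quotients of those of \<open>C\<close>, and dually torsion subobjects for
  \<open>\<T>\<close>. The equivalence is built from the glued category towards \<open>C\<close>,
  because in that direction a functor needs only a representative of each class; since the glued
  category is not known to be abelian beforehand, its kernels are obtained by reflecting kernels of
  \<open>C\<close>. The common extension \<open>d\<close> of two extensions is the pullback of their
  direct sum along the diagonal. Isomorphisms between different pullbacks are hardly ever mentioned:
  morphisms of extensions factor through pullbacks and pushouts, and this cancellation does the
  work. Most facts about pushouts, cokernels and epis are those about pullbacks, kernels and monos
  read in \<open>opposite C\<close>, where \<open>\<T>\<close> and \<open>\<F>\<close> change
  roles.\<close>

section \<open>Calculation with arrows in categories and preadditive categories\<close>

lemma in_Hom [simp]: "f \<in> Hom C X Y \<longleftrightarrow> f \<in> Arr C \<and> Dom C f = X \<and> Cod C f = Y"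
  by (simp add: Hom_def)

context category
begin

lemma Ident_simps [simp]:
  assumes "X \<in> Obj C"
  shows "Ident C X \<in> Arr C" "Dom C (Ident C X) = X" "Cod C (Ident C X) = X"
  using Ident_Hom [OF assms] by auto

lemma Comp_simps [simp]:
  assumes "f \<in> Arr C" "g \<in> Arr C" "Dom C g = Cod C f"
  shows "g \<cdot> f \<in> Arr C" "Dom C (g \<cdot> f) = Dom C f" "Cod C (g \<cdot> f) = Cod C g"
  using Comp_Hom [of f "Dom C f" "Cod C f" g "Cod C g"] assms by auto

lemma Comp_Ident [simp]:
  "\<lbrakk>f \<in> Arr C; Dom C f = X\<rbrakk> \<Longrightarrow> f \<cdot> Ident C X = f"
  "\<lbrakk>f \<in> Arr C; Cod C f = Y\<rbrakk> \<Longrightarrow> Ident C Y \<cdot> f = f"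
  using Comp_Ident_right Comp_Ident_left by auto

lemma Comp_assoc' [simp]:
  "\<lbrakk>f \<in> Arr C; g \<in> Arr C; h \<in> Arr C; Dom C g = Cod C f; Dom C h = Cod C g\<rbrakk> \<Longrightarrow>
    (h \<cdot> g) \<cdot> f = h \<cdot> (g \<cdot> f)"
  using Comp_assoc by auto

declare Dom_Obj [simp] Cod_Obj [simp]

text \<open>\<open>Comp_assoc'\<close> associates composites to the right, which hides a known
  composite \<open>g \<cdot> f\<close> as soon as another arrow is precomposed; this form finds it
  inside \<open>g \<cdot> (f \<cdot> x)\<close>.\<close>

lemma Comp_rewrite:
  "\<lbrakk>g \<cdot> f = k; f \<in> Arr C; g \<in> Arr C; x \<in> Arr C; Dom C g = Cod C f; Dom C f = Cod C x\<rbrakk> \<Longrightarrow>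
    g \<cdot> (f \<cdot> x) = k \<cdot> x"
  by (metis Comp_assoc')

lemma is_isoI:
  assumes "f \<in> Hom C X Y" "g \<in> Hom C Y X" "g \<cdot> f = Ident C X" "f \<cdot> g = Ident C Y"
  shows "is_iso C f"
  using assms by (auto simp: is_iso_def)

lemma is_isoE:
  assumes "is_iso C f" "f \<in> Hom C X Y"
  obtains g where "g \<in> Hom C Y X" "g \<cdot> f = Ident C X" "f \<cdot> g = Ident C Y"
  using assms by (auto simp: is_iso_def)

end

text \<open>The record has no negation field, so the inverse is taken in the hom group. Source and
  target are read off the arrow, so that no objects have to be passed.\<close>

definition Neg :: "('o, 'm, 'z) preadditive_scheme \<Rightarrow> 'm \<Rightarrow> 'm" where
  "Neg C f = m_inv (Hom_group C (Dom C f) (Cod C f)) f"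

context preadditive_category
begin

lemma Add_simps [simp]:
  assumes "f \<in> Arr C" "g \<in> Arr C" "Dom C f = Dom C g" "Cod C f = Cod C g"
  shows "f \<boxplus> g \<in> Arr C" "Dom C (f \<boxplus> g) = Dom C g" "Cod C (f \<boxplus> g) = Cod C g"
proof -
  interpret comm_group "Hom_group C (Dom C g) (Cod C g)"
    using assms by (intro Hom_comm_group) auto
  show "f \<boxplus> g \<in> Arr C" "Dom C (f \<boxplus> g) = Dom C g" "Cod C (f \<boxplus> g) = Cod C g"
    using m_closed [of f g] assms by (auto simp: Hom_group_def)
qed

lemma Zero_simps [simp]:
  assumes "X \<in> Obj C" "Y \<in> Obj C"
  shows "Zero C X Y \<in> Arr C" "Dom C (Zero C X Y) = X" "Cod C (Zero C X Y) = Y"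
proof -
  interpret comm_group "Hom_group C X Y"
    using assms by (rule Hom_comm_group)
  show "Zero C X Y \<in> Arr C" "Dom C (Zero C X Y) = X" "Cod C (Zero C X Y) = Y"
    using one_closed by (auto simp: Hom_group_def)
qed

lemma Neg_simps [simp]:
  assumes "f \<in> Arr C"
  shows "Neg C f \<in> Arr C" "Dom C (Neg C f) = Dom C f" "Cod C (Neg C f) = Cod C f"
proof -
  interpret comm_group "Hom_group C (Dom C f) (Cod C f)"
    using assms by (intro Hom_comm_group) auto
  show "Neg C f \<in> Arr C" "Dom C (Neg C f) = Dom C f" "Cod C (Neg C f) = Cod C f"
    using inv_closed [of f] assms unfolding Neg_def by (auto simp: Hom_group_def)
qed

lemma Add_assoc:
  assumes "f \<in> Arr C" "g \<in> Arr C" "h \<in> Arr C" "Dom C g = Dom C f" "Cod C g = Cod C f"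
    "Dom C h = Dom C f" "Cod C h = Cod C f"
  shows "(f \<boxplus> g) \<boxplus> h = f \<boxplus> (g \<boxplus> h)"
proof -
  interpret comm_group "Hom_group C (Dom C f) (Cod C f)"
    using assms by (intro Hom_comm_group) auto
  show ?thesis using m_assoc [of f g h] assms by (auto simp: Hom_group_def)
qed

lemma Add_commute:
  assumes "f \<in> Arr C" "g \<in> Arr C" "Dom C g = Dom C f" "Cod C g = Cod C f"
  shows "f \<boxplus> g = g \<boxplus> f"
proof -
  interpret comm_group "Hom_group C (Dom C f) (Cod C f)"
    using assms by (intro Hom_comm_group) auto
  show ?thesis using m_comm [of f g] assms by (auto simp: Hom_group_def)
qed

lemma Add_Zero [simp]:
  assumes "f \<in> Arr C" "Dom C f = X" "Cod C f = Y"
  shows "f \<boxplus> Zero C X Y = f" "Zero C X Y \<boxplus> f = f"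
proof -
  interpret comm_group "Hom_group C (Dom C f) (Cod C f)"
    using assms by (intro Hom_comm_group) auto
  show "f \<boxplus> Zero C X Y = f" "Zero C X Y \<boxplus> f = f"
    using l_one [of f] r_one [of f] assms by (auto simp: Hom_group_def)
qed

lemma Add_Neg [simp]:
  assumes "f \<in> Arr C"
  shows "f \<boxplus> Neg C f = Zero C (Dom C f) (Cod C f)" "Neg C f \<boxplus> f = Zero C (Dom C f) (Cod C f)"
proof -
  interpret comm_group "Hom_group C (Dom C f) (Cod C f)"
    using assms by (intro Hom_comm_group) auto
  show "f \<boxplus> Neg C f = Zero C (Dom C f) (Cod C f)" "Neg C f \<boxplus> f = Zero C (Dom C f) (Cod C f)"
    using l_inv [of f] r_inv [of f] assms unfolding Neg_def by (auto simp: Hom_group_def)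
qed

text \<open>This is how composites with zero arrows, and images of zero arrows under additive
  functors, are recognised as zero.\<close>

lemma Add_eq_self_imp_Zero:
  assumes "f \<in> Hom C X Y" "f \<boxplus> f = f"
  shows "f = Zero C X Y"
proof -
  have "f = f \<boxplus> (f \<boxplus> Neg C f)" using assms by (subst Add_Neg) auto
  also have "\<dots> = (f \<boxplus> f) \<boxplus> Neg C f" using assms by (subst Add_assoc) auto
  finally show ?thesis using assms by simp
qed

lemma Neg_unique:
  assumes "f \<in> Hom C X Y" "g \<in> Hom C X Y" "f \<boxplus> g = Zero C X Y"
  shows "g = Neg C f"
proof -
  have "g = (Neg C f \<boxplus> f) \<boxplus> g" using assms by (subst Add_Neg) auto
  also have "\<dots> = Neg C f \<boxplus> (f \<boxplus> g)" using assms by (subst Add_assoc) auto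
  finally show ?thesis using assms by simp
qed

lemma eq_iff_diff_Zero:
  assumes "f \<in> Hom C X Y" "g \<in> Hom C X Y"
  shows "f = g \<longleftrightarrow> f \<boxplus> Neg C g = Zero C X Y"
proof
  assume "f \<boxplus> Neg C g = Zero C X Y"
  then have "Neg C g \<boxplus> f = Zero C X Y" using assms by (subst Add_commute) auto
  moreover have "Neg C g \<boxplus> g = Zero C X Y" using assms by simp
  ultimately show "f = g"
    using Neg_unique [of "Neg C g" X Y f] Neg_unique [of "Neg C g" X Y g] assms by auto
qed (use assms in auto)

lemma Comp_Add [simp]:
  "\<lbrakk>f \<in> Arr C; g \<in> Arr C; g' \<in> Arr C; Dom C g = Cod C f; Dom C g' = Cod C f; Cod C g = Cod C g'\<rbrakk>
    \<Longrightarrow> (g \<boxplus> g') \<cdot> f = g \<cdot> f \<boxplus> g' \<cdot> f"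
  "\<lbrakk>f \<in> Arr C; f' \<in> Arr C; g \<in> Arr C; Dom C g = Cod C f; Cod C f' = Cod C f; Dom C f' = Dom C f\<rbrakk>
    \<Longrightarrow> g \<cdot> (f \<boxplus> f') = g \<cdot> f \<boxplus> g \<cdot> f'"
  using Comp_Add_left Comp_Add_right by auto

lemma Comp_Zero [simp]:
  assumes "f \<in> Arr C" "Z \<in> Obj C"
  shows "Cod C f = Y \<Longrightarrow> Zero C Y Z \<cdot> f = Zero C (Dom C f) Z"
    and "Dom C f = Y \<Longrightarrow> f \<cdot> Zero C Z Y = Zero C Z (Cod C f)"
proof -
  assume Y: "Cod C f = Y"
  with assms have "(Zero C Y Z \<boxplus> Zero C Y Z) \<cdot> f = Zero C Y Z \<cdot> f \<boxplus> Zero C Y Z \<cdot> f"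
    by (subst Comp_Add) auto
  with assms Y show "Zero C Y Z \<cdot> f = Zero C (Dom C f) Z"
    by (intro Add_eq_self_imp_Zero) auto
next
  assume Y: "Dom C f = Y"
  with assms have "f \<cdot> (Zero C Z Y \<boxplus> Zero C Z Y) = f \<cdot> Zero C Z Y \<boxplus> f \<cdot> Zero C Z Y"
    by (subst Comp_Add) auto
  with assms Y show "f \<cdot> Zero C Z Y = Zero C Z (Cod C f)"
    by (intro Add_eq_self_imp_Zero) auto
qed

lemma Comp_Neg [simp]:
  assumes "f \<in> Arr C" "g \<in> Arr C" "Dom C g = Cod C f"
  shows "Neg C g \<cdot> f = Neg C (g \<cdot> f)" "g \<cdot> Neg C f = Neg C (g \<cdot> f)"
proof -
  have "g \<cdot> f \<boxplus> Neg C g \<cdot> f = (g \<boxplus> Neg C g) \<cdot> f" using assms by (subst Comp_Add) auto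
  then show "Neg C g \<cdot> f = Neg C (g \<cdot> f)" using assms by (intro Neg_unique) auto
  have "g \<cdot> f \<boxplus> g \<cdot> Neg C f = g \<cdot> (f \<boxplus> Neg C f)" using assms by (subst Comp_Add) auto
  then show "g \<cdot> Neg C f = Neg C (g \<cdot> f)" using assms by (intro Neg_unique) auto
qed

lemma Neg_Zero [simp]:
  assumes "X \<in> Obj C" "Y \<in> Obj C"
  shows "Neg C (Zero C X Y) = Zero C X Y"
  using Neg_unique [of "Zero C X Y" X Y "Zero C X Y"] assms by simp

text \<open>If \<open>f\<close> does not distinguish \<open>u\<close> and \<open>v\<close>, it kills
  \<open>u \<boxplus> Neg C v\<close>; hence arrows killed by \<open>f\<close> are a sufficient
  test.\<close>

lemma is_monoI:
  assumes "f \<in> Arr C"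
    and "\<And>u. \<lbrakk>u \<in> Arr C; Cod C u = Dom C f; f \<cdot> u = Zero C (Dom C u) (Cod C f)\<rbrakk> \<Longrightarrow>
      u = Zero C (Dom C u) (Dom C f)"
  shows "is_mono C f"
  unfolding is_mono_def
proof (intro conjI ballI impI)
  fix u v assume uv: "u \<in> Arr C" "v \<in> Arr C"
    "Dom C u = Dom C v \<and> Cod C u = Dom C f \<and> Cod C v = Dom C f \<and> f \<cdot> u = f \<cdot> v"
  then have "u \<boxplus> Neg C v = Zero C (Dom C v) (Dom C f)"
    using assms(1) assms(2) [of "u \<boxplus> Neg C v"] by simp
  then show "u = v" using eq_iff_diff_Zero uv by auto
qed (fact assms(1))

end

lemma is_monoD:
  "\<lbrakk>is_mono C f; u \<in> Arr C; v \<in> Arr C; Dom C u = Dom C v; Cod C u = Dom C f; Cod C v = Dom C f;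
    f \<cdot>\<^bsub>C\<^esub> u = f \<cdot>\<^bsub>C\<^esub> v\<rbrakk> \<Longrightarrow> u = v"
  unfolding is_mono_def by blast

lemma is_epiD:
  "\<lbrakk>is_epi C f; u \<in> Arr C; v \<in> Arr C; Cod C u = Cod C v; Dom C u = Cod C f; Dom C v = Cod C f;
    u \<cdot>\<^bsub>C\<^esub> f = v \<cdot>\<^bsub>C\<^esub> f\<rbrakk> \<Longrightarrow> u = v"
  unfolding is_epi_def by blast

section \<open>Duality\<close>

text \<open>\<open>Zero\<close> is transposed because it carries source and target as arguments;
  \<open>Add\<close> and \<open>Ident\<close> stay. The type does not change, so lemmas of a locale
  can be instantiated at \<open>opposite C\<close> and read back through the simp rules
  below.\<close>

definition opposite :: "('o, 'm, 'z) preadditive_scheme \<Rightarrow> ('o, 'm, 'z) preadditive_scheme" where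
  "opposite C = C\<lparr>Dom := Cod C, Cod := Dom C, Comp := \<lambda>g f. f \<cdot>\<^bsub>C\<^esub> g, Zero := \<lambda>X Y. Zero C Y X\<rparr>"

lemma opposite_simps [simp]:
  "Obj (opposite C) = Obj C" "Arr (opposite C) = Arr C" "Dom (opposite C) = Cod C"
  "Cod (opposite C) = Dom C" "Ident (opposite C) = Ident C" "Add (opposite C) = Add C"
  "g \<cdot>\<^bsub>opposite C\<^esub> f = f \<cdot>\<^bsub>C\<^esub> g" "Zero (opposite C) X Y = Zero C Y X"
  by (simp_all add: opposite_def)

lemma Hom_opposite: "Hom (opposite C) X Y = Hom C Y X"
  by (auto simp: Hom_def)

lemma is_mono_opposite [simp]: "is_mono (opposite C) f = is_epi C f"
  unfolding is_mono_def is_epi_def Hom_opposite opposite_simps by blast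

lemma is_epi_opposite [simp]: "is_epi (opposite C) f = is_mono C f"
  unfolding is_mono_def is_epi_def Hom_opposite opposite_simps by blast

lemma is_kernel_opposite [simp]: "is_kernel (opposite C) f k = is_cokernel C f k"
  unfolding is_kernel_def is_cokernel_def Hom_opposite opposite_simps by simp

lemma is_cokernel_opposite [simp]: "is_cokernel (opposite C) f k = is_kernel C f k"
  unfolding is_kernel_def is_cokernel_def Hom_opposite opposite_simps by simp

lemma is_zero_object_opposite [simp]: "is_zero_object (opposite C) Z = is_zero_object C Z"
  unfolding is_zero_object_def Hom_opposite opposite_simps by blast

lemma is_iso_opposite [simp]: "is_iso (opposite C) f = is_iso C f"
  unfolding is_iso_def Hom_opposite opposite_simps by blast

lemma is_pullback_opposite [simp]: "is_pullback (opposite C) a b a' b' = is_pushout C a b a' b'"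
  unfolding is_pullback_def is_pushout_def Hom_opposite opposite_simps by simp

lemma short_exact_opposite [simp]: "short_exact (opposite C) p i = short_exact C i p"
  by (auto simp: short_exact_def)

lemma preadditive_category_opposite:
  assumes "preadditive_category C"
  shows "preadditive_category (opposite C)"
proof -
  interpret preadditive_category C by fact
  have "Hom_group (opposite C) X Y = Hom_group C Y X" for X Y
    by (simp add: Hom_group_def Hom_opposite)
  then show ?thesis
    by (intro preadditive_category.intro category.intro preadditive_category_axioms.intro)
      (auto intro: Hom_comm_group)
qed

lemma is_biproduct_opposite:
  assumes "preadditive_category C"
  shows "is_biproduct (opposite C) X Y (B, j\<^sub>1, j\<^sub>2, q\<^sub>1, q\<^sub>2) = is_biproduct C X Y (B, q\<^sub>1, q\<^sub>2, j\<^sub>1, j\<^sub>2)"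
  by (auto simp: is_biproduct_def)

lemma abelian_category_opposite:
  assumes "abelian_category C"
  shows "abelian_category (opposite C)"
proof -
  interpret abelian_category C by fact
  interpret op: preadditive_category "opposite C"
    by (intro preadditive_category_opposite preadditive_category_axioms)
  show ?thesis
  proof unfold_locales
    fix X Y assume "X \<in> Obj (opposite C)" "Y \<in> Obj (opposite C)"
    then obtain B j\<^sub>1 j\<^sub>2 q\<^sub>1 q\<^sub>2 where "is_biproduct C X Y (B, j\<^sub>1, j\<^sub>2, q\<^sub>1, q\<^sub>2)"
      using ex_biproduct [of X Y] by auto
    then show "\<exists>b. is_biproduct (opposite C) X Y b"
      using is_biproduct_opposite [OF preadditive_category_axioms] by blast
  qed (use ex_zero_object ex_kernel ex_cokernel mono_is_kernel epi_is_cokernel in auto)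
qed

section \<open>Short exact sequences\<close>

lemma is_kernel_lift:
  assumes "is_kernel C f k" "h \<in> Arr C" "Dom C h \<in> Obj C" "Cod C h = Dom C f"
    "f \<cdot>\<^bsub>C\<^esub> h = Zero C (Dom C h) (Cod C f)"
  obtains u where "u \<in> Arr C" "Dom C u = Dom C h" "Cod C u = Dom C k" "k \<cdot>\<^bsub>C\<^esub> u = h"
proof -
  have "h \<in> Hom C (Dom C h) (Dom C f)" using assms by simp
  with assms(1,3,5) have "\<exists>!u. u \<in> Hom C (Dom C h) (Dom C k) \<and> k \<cdot>\<^bsub>C\<^esub> u = h"
    unfolding is_kernel_def by blast
  then show thesis using that by auto
qed

lemma is_cokernel_lift:
  assumes "is_cokernel C f k" "h \<in> Arr C" "Cod C h \<in> Obj C" "Dom C h = Cod C f"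
    "h \<cdot>\<^bsub>C\<^esub> f = Zero C (Dom C f) (Cod C h)"
  obtains u where "u \<in> Arr C" "Dom C u = Cod C k" "Cod C u = Cod C h" "u \<cdot>\<^bsub>C\<^esub> k = h"
  using assms is_kernel_lift [of "opposite C" f k h] by auto

lemma is_kernelD:
  assumes "is_kernel C f k"
  shows "f \<in> Arr C" "k \<in> Arr C" "Cod C k = Dom C f" "f \<cdot>\<^bsub>C\<^esub> k = Zero C (Dom C k) (Cod C f)"
  using assms by (auto simp: is_kernel_def)

lemma is_cokernelD:
  assumes "is_cokernel C f k"
  shows "f \<in> Arr C" "k \<in> Arr C" "Dom C k = Cod C f" "k \<cdot>\<^bsub>C\<^esub> f = Zero C (Dom C f) (Cod C k)"
  using assms by (auto simp: is_cokernel_def)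

lemma short_exactD:
  assumes "short_exact C i p"
  shows "i \<in> Arr C" "p \<in> Arr C" "Dom C p = Cod C i" "p \<cdot>\<^bsub>C\<^esub> i = Zero C (Dom C i) (Cod C p)"
  using assms is_kernelD [of C p i] by (auto simp: short_exact_def)

context preadditive_category
begin

text \<open>Two factorisations through a mono agree, so only the existence of factorisations remains
  as a premise.\<close>

lemma is_kernelI:
  assumes "is_mono C k" "f \<in> Arr C" "Cod C k = Dom C f" "f \<cdot> k = Zero C (Dom C k) (Cod C f)"
    and "\<And>h. \<lbrakk>h \<in> Arr C; Cod C h = Dom C f; f \<cdot> h = Zero C (Dom C h) (Cod C f)\<rbrakk> \<Longrightarrow>
      \<exists>u. u \<in> Hom C (Dom C h) (Dom C k) \<and> k \<cdot> u = h"
  shows "is_kernel C f k"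
  unfolding is_kernel_def
proof (intro conjI ballI impI)
  show "k \<in> Arr C" using assms(1) by (simp add: is_mono_def)
  fix W h
  assume "W \<in> Obj C" "h \<in> Hom C W (Dom C f)" "f \<cdot> h = Zero C W (Cod C f)"
  then obtain u where u: "u \<in> Hom C W (Dom C k) \<and> k \<cdot> u = h"
    using assms(5) [of h] by auto
  show "\<exists>!u. u \<in> Hom C W (Dom C k) \<and> k \<cdot> u = h"
  proof (intro ex1I [of _ u] u)
    fix v assume v: "v \<in> Hom C W (Dom C k) \<and> k \<cdot> v = h"
    with u assms(3) have "k \<cdot> v = k \<cdot> u" by simp
    with u v show "v = u" by - (rule is_monoD [OF assms(1)]; auto)
  qed
qed (use assms in auto)

text \<open>If \<open>k \<cdot> u = k \<cdot> v\<close>, then \<open>u\<close> and \<open>v\<close>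
  are both factorisations of the one arrow \<open>k \<cdot> v\<close> through the kernel.\<close>

lemma is_kernel_imp_mono:
  assumes "is_kernel C f k"
  shows "is_mono C k"
  unfolding is_mono_def
proof (intro conjI ballI impI)
  note k = is_kernelD [OF assms]
  show "k \<in> Arr C" by (fact k)
  fix u v assume uv: "u \<in> Arr C" "v \<in> Arr C"
    "Dom C u = Dom C v \<and> Cod C u = Dom C k \<and> Cod C v = Dom C k \<and> k \<cdot> u = k \<cdot> v"
  have "k \<cdot> v \<in> Hom C (Dom C v) (Dom C f)" using uv k by simp
  moreover have "f \<cdot> (k \<cdot> v) = Zero C (Dom C v) (Cod C f)"
    using uv k by (subst Comp_rewrite [OF k(4)]) auto
  ultimately have "\<exists>!u. u \<in> Hom C (Dom C v) (Dom C k) \<and> k \<cdot> u = k \<cdot> v"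
    using assms uv Dom_Obj [of v] unfolding is_kernel_def by blast
  then show "u = v" using uv by auto
qed

lemma short_exact_mono: "short_exact C i p \<Longrightarrow> is_mono C i"
  using is_kernel_imp_mono by (auto simp: short_exact_def)

lemma is_cokernel_imp_epi: "is_cokernel C f k \<Longrightarrow> is_epi C k"
  using preadditive_category.is_kernel_imp_mono
    [OF preadditive_category_opposite [OF preadditive_category_axioms], of f k] by simp

lemma short_exact_epi: "short_exact C i p \<Longrightarrow> is_epi C p"
  using is_cokernel_imp_epi by (auto simp: short_exact_def)

end

section \<open>Exactness in abelian categories: the short five lemma and pullbacks of
  extensions\<close>

context abelian_category
begin

text \<open>The epi \<open>p\<close> is a cokernel of some \<open>g\<close>, and \<open>g\<close>
  factors through the kernel \<open>i\<close> of \<open>p\<close>. Whatever kills \<open>i\<close>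
  therefore kills \<open>g\<close> and factors through \<open>p\<close>.\<close>

lemma short_exactI:
  assumes "is_kernel C p i" "is_epi C p"
  shows "short_exact C i p"
proof -
  obtain g where g: "is_cokernel C g p" using epi_is_cokernel [OF assms(2)] by blast
  note g' = is_cokernelD [OF g] and i = is_kernelD [OF assms(1)]
  obtain w where w: "w \<in> Arr C" "Dom C w = Dom C g" "Cod C w = Dom C i" "i \<cdot> w = g"
    using is_kernel_lift [OF assms(1), of g] g' by (metis Dom_Obj)
  have "is_cokernel C i p"
    unfolding is_cokernel_def
  proof (intro conjI ballI impI)
    fix W h assume W: "W \<in> Obj C" and h: "h \<in> Hom C (Cod C i) W" "h \<cdot> i = Zero C (Dom C i) W"
    have "h \<cdot> g = Zero C (Dom C g) W"
      using w h i W by (subst w(4) [symmetric], subst Comp_rewrite [OF h(2)]) auto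
    then obtain u where u: "u \<in> Arr C" "Dom C u = Cod C p" "Cod C u = Cod C h" "u \<cdot> p = h"
      using is_cokernel_lift [OF g, of h] h W g' i by auto
    show "\<exists>!u. u \<in> Hom C (Cod C p) W \<and> u \<cdot> p = h"
      by (rule ex1I [of _ u], use u h in simp, rule is_epiD [OF assms(2)]) (use u h in auto)
  qed (use i in auto)
  with assms show ?thesis by (simp add: short_exact_def)
qed

text \<open>Write \<open>f\<close> as a kernel of \<open>g\<close>. Since \<open>f\<close> is epi,
  \<open>g\<close> is zero, so the identity factors through \<open>f\<close>; the section obtained
  is an inverse because \<open>f\<close> can be cancelled.\<close>

lemma mono_epi_imp_iso:
  assumes "is_mono C f" "is_epi C f"
  shows "is_iso C f"
proof -
  obtain g where g: "is_kernel C g f" using mono_is_kernel [OF assms(1)] by blast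
  note f = is_kernelD [OF g]
  have "g = Zero C (Dom C g) (Cod C g)"
    by (rule is_epiD [OF assms(2)]) (use f in \<open>auto\<close>)
  then have "g \<cdot> Ident C (Dom C g) = Zero C (Dom C g) (Cod C g)" using f by simp
  then obtain s where s: "s \<in> Arr C" "Dom C s = Dom C g" "Cod C s = Dom C f"
    "f \<cdot> s = Ident C (Dom C g)"
    using is_kernel_lift [OF g, of "Ident C (Dom C g)"] f by auto
  have "s \<cdot> f = Ident C (Dom C f)"
    by (rule is_monoD [OF assms(1)]) (use s f in \<open>(auto simp: Comp_rewrite [OF s(4)])\<close>)
  with s f show ?thesis by (intro is_isoI [of f _ _ s]) auto
qed

text \<open>An arrow \<open>u\<close> killed by \<open>h\<close> is killed by
  \<open>p = p' \<cdot> h\<close>, hence equals \<open>i \<cdot> w\<close>; then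
  \<open>i' \<cdot> w = h \<cdot> u\<close> is zero, and \<open>i'\<close> is mono.\<close>

lemma short_five_mono:
  assumes e: "short_exact C i p" "short_exact C i' p'" and Y: "Dom C i' = Dom C i"
    and X: "Cod C p' = Cod C p"
    and h: "h \<in> Hom C (Cod C i) (Cod C i')" "h \<cdot> i = i'" "p' \<cdot> h = p"
  shows "is_mono C h"
proof (rule is_monoI)
  note D = short_exactD [OF e(1)] short_exactD [OF e(2)]
  fix u assume u: "u \<in> Arr C" "Cod C u = Dom C h" "h \<cdot> u = Zero C (Dom C u) (Cod C h)"
  have "p \<cdot> u = p' \<cdot> (h \<cdot> u)"
    using u h(1) D by (subst Comp_rewrite [OF h(3)]) auto
  also have "\<dots> = Zero C (Dom C u) (Cod C p)" using u h(1) D X by simp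
  finally obtain w where w: "w \<in> Arr C" "Dom C w = Dom C u" "Cod C w = Dom C i" "i \<cdot> w = u"
    using is_kernel_lift [of C p i u] e(1) u h D unfolding short_exact_def by auto
  have "i' \<cdot> w = h \<cdot> u"
    using w h(1) D by (subst w(4) [symmetric], subst Comp_rewrite [OF h(2)]) auto
  with w u h(1) D Y have "w = Zero C (Dom C w) (Dom C i)"
    by - (rule is_monoD [OF short_exact_mono [OF e(2)]]; auto)
  then have "i \<cdot> w = i \<cdot> Zero C (Dom C u) (Dom C i)" using w by simp
  then have "u = i \<cdot> Zero C (Dom C u) (Dom C i)" unfolding w(4) .
  then show "u = Zero C (Dom C u) (Dom C h)"
    using u(1) D h(1) by simp
qed (use h in simp)

end

context abelian_category
begin

interpretation op: abelian_category "opposite C"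
  by (intro abelian_category_opposite abelian_category_axioms)

text \<open>The epi half is the mono half in the opposite category, where the two sequences exchange
  their roles.\<close>

lemma short_five:
  assumes e: "short_exact C i p" "short_exact C i' p'" and Y: "Dom C i' = Dom C i"
    and X: "Cod C p' = Cod C p"
    and h: "h \<in> Hom C (Cod C i) (Cod C i')" "h \<cdot> i = i'" "p' \<cdot> h = p"
  shows "is_iso C h"
proof (rule mono_epi_imp_iso)
  show "is_mono C h" using short_five_mono assms by metis
  show "is_epi C h"
    using op.short_five_mono [of p' i' p i h] assms
      short_exactD [OF e(1)] short_exactD [OF e(2)] by simp
qed

text \<open>The fibre product of \<open>p\<close> and \<open>f\<close> is realised as a kernel on a
  biproduct. The harder half is that the projection \<open>p'\<close> is again epi; this uses that
  the kernel in question belongs to an epi and so has that epi as its cokernel.\<close>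

lemma pullback_of_short_exact:
  assumes e: "short_exact C i p" and f: "f \<in> Hom C X' (Cod C p)"
  obtains i' p' h where "short_exact C i' p'" "is_pullback C p f h p'" "h \<in> Hom C (Cod C i') (Cod C i)"
    "h \<cdot> i' = i" "Dom C i' = Dom C i" "Cod C p' = X'"
proof -
  note D = short_exactD [OF e]
  note epi_p = short_exact_epi [OF e]
  have X': "X' \<in> Obj C" using f Dom_Obj by auto
  have EX': "Cod C i \<in> Obj C" using D by simp
  obtain B j\<^sub>1 j\<^sub>2 q\<^sub>1 q\<^sub>2 where "is_biproduct C (Cod C i) X' (B, j\<^sub>1, j\<^sub>2, q\<^sub>1, q\<^sub>2)"
    using ex_biproduct [OF EX' X'] by auto
  then have b: "B \<in> Obj C" "j\<^sub>1 \<in> Hom C (Cod C i) B" "j\<^sub>2 \<in> Hom C X' B" "q\<^sub>1 \<in> Hom C B (Cod C i)"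
    "q\<^sub>2 \<in> Hom C B X'" "q\<^sub>1 \<cdot> j\<^sub>1 = Ident C (Cod C i)" "q\<^sub>2 \<cdot> j\<^sub>2 = Ident C X'"
    "q\<^sub>2 \<cdot> j\<^sub>1 = Zero C (Cod C i) X'" "q\<^sub>1 \<cdot> j\<^sub>2 = Zero C X' (Cod C i)"
    "j\<^sub>1 \<cdot> q\<^sub>1 \<boxplus> j\<^sub>2 \<cdot> q\<^sub>2 = Ident C B"
    by (auto simp: is_biproduct_def)
  \<comment> \<open>The difference of the two maps to \<open>Cod C p\<close>: a pair of arrows into
    the summands is equalised by \<open>p\<close> and \<open>f\<close> exactly when \<open>d\<close>
    kills it.\<close>
  define d where "d = p \<cdot> q\<^sub>1 \<boxplus> Neg C (f \<cdot> q\<^sub>2)"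
  have d: "d \<in> Arr C" "Dom C d = B" "Cod C d = Cod C p"
    using D b f by (auto simp: d_def)
  have dj: "d \<cdot> j\<^sub>1 = p"
    using D b f X' by (simp add: d_def)
  obtain k where k: "is_kernel C d k" using ex_kernel d by blast
  note K = is_kernelD [OF k] and mono_k = is_kernel_imp_mono [OF k]
  define P where "P = Dom C k"
  have P: "P \<in> Obj C" "Dom C k = P" using K by (auto simp: P_def)
  have comp_d: "d \<cdot> w = p \<cdot> (q\<^sub>1 \<cdot> w) \<boxplus> Neg C (f \<cdot> (q\<^sub>2 \<cdot> w))" if "w \<in> Arr C" "Cod C w = B" for w
    using that D b f by (simp add: d_def)
  have d0: "d \<cdot> w = Zero C (Dom C w) (Cod C p) \<longleftrightarrow> p \<cdot> (q\<^sub>1 \<cdot> w) = f \<cdot> (q\<^sub>2 \<cdot> w)"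
    if "w \<in> Arr C" "Cod C w = B" for w
    using that D b f eq_iff_diff_Zero [of "p \<cdot> (q\<^sub>1 \<cdot> w)" "Dom C w" "Cod C p" "f \<cdot> (q\<^sub>2 \<cdot> w)"]
    by (simp add: comp_d)
  have pair: "j\<^sub>1 \<cdot> (q\<^sub>1 \<cdot> w) \<boxplus> j\<^sub>2 \<cdot> (q\<^sub>2 \<cdot> w) = w" if "w \<in> Arr C" "Cod C w = B" for w
  proof -
    have "j\<^sub>1 \<cdot> (q\<^sub>1 \<cdot> w) \<boxplus> j\<^sub>2 \<cdot> (q\<^sub>2 \<cdot> w) = (j\<^sub>1 \<cdot> q\<^sub>1 \<boxplus> j\<^sub>2 \<cdot> q\<^sub>2) \<cdot> w"
      using that b by (subst Comp_Add(1)) auto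
    with b(10) that show ?thesis by simp
  qed
  define h where "h = q\<^sub>1 \<cdot> k"
  define p' where "p' = q\<^sub>2 \<cdot> k"
  have h: "h \<in> Hom C P (Cod C i)" and p': "p' \<in> Hom C P X'"
    using K P b d by (auto simp: h_def p'_def)
  have sq: "p \<cdot> h = f \<cdot> p'"
    using d0 [of k] K P b d by (simp add: h_def p'_def)
  \<comment> \<open>The arrows \<open>h\<close> and \<open>p'\<close> are the coordinates of the
    mono \<open>k\<close>, which gives the uniqueness half of the universal property.\<close>
  have jointly: "u = v" if uv: "u \<in> Arr C" "v \<in> Arr C" "Dom C u = Dom C v" "Cod C u = P" "Cod C v = P"
    "h \<cdot> u = h \<cdot> v" "p' \<cdot> u = p' \<cdot> v" for u v
  proof -
    have "k \<cdot> w = j\<^sub>1 \<cdot> (h \<cdot> w) \<boxplus> j\<^sub>2 \<cdot> (p' \<cdot> w)" if "w \<in> Arr C" "Cod C w = P" for w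
      using pair [of "k \<cdot> w"] that K(1-3) P d(2) b(4,5) by (simp add: h_def p'_def)
    from this [of u] this [of v] uv have "k \<cdot> u = k \<cdot> v" by simp
    then show ?thesis
      by (rule is_monoD [OF mono_k, rotated -1]) (use uv P(2) in \<open>simp_all\<close>)
  qed
  have lift: "\<exists>w. w \<in> Hom C W P \<and> h \<cdot> w = u \<and> p' \<cdot> w = v"
    if uv: "u \<in> Hom C W (Cod C i)" "v \<in> Hom C W X'" "p \<cdot> u = f \<cdot> v" for u v W
  proof -
    define x where "x = j\<^sub>1 \<cdot> u \<boxplus> j\<^sub>2 \<cdot> v"
    have W: "W \<in> Obj C" using uv by auto
    have x: "x \<in> Arr C" "Dom C x = W" "Cod C x = B" using uv b by (auto simp: x_def)
    have "q\<^sub>1 \<cdot> x = q\<^sub>1 \<cdot> (j\<^sub>1 \<cdot> u) \<boxplus> q\<^sub>1 \<cdot> (j\<^sub>2 \<cdot> v)" using uv b by (simp add: x_def)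
    then have qx1: "q\<^sub>1 \<cdot> x = u"
      using uv b X' EX' W by (simp add: Comp_rewrite [OF b(6)] Comp_rewrite [OF b(9)])
    have "q\<^sub>2 \<cdot> x = q\<^sub>2 \<cdot> (j\<^sub>1 \<cdot> u) \<boxplus> q\<^sub>2 \<cdot> (j\<^sub>2 \<cdot> v)" using uv b by (simp add: x_def)
    then have qx2: "q\<^sub>2 \<cdot> x = v"
      using uv b X' EX' W by (simp add: Comp_rewrite [OF b(7)] Comp_rewrite [OF b(8)])
    have "d \<cdot> x = Zero C W (Cod C d)" using d0 [of x] x qx1 qx2 uv d by simp
    then obtain w where w: "w \<in> Arr C" "Dom C w = W" "Cod C w = P" "k \<cdot> w = x"
      using is_kernel_lift [OF k, of x] x W d P by auto
    have "h \<cdot> w = u" "p' \<cdot> w = v"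
      using w qx1 qx2 K P b d by (auto simp: h_def p'_def)
    with w show ?thesis by auto
  qed
  have pb: "is_pullback C p f h p'"
    unfolding is_pullback_def
  proof (intro conjI ballI impI)
    fix W u v assume "W \<in> Obj C" "u \<in> Hom C W (Dom C p)" "v \<in> Hom C W (Dom C f)" "p \<cdot> u = f \<cdot> v"
    then obtain w where w: "w \<in> Hom C W P \<and> h \<cdot> w = u \<and> p' \<cdot> w = v"
      using lift [of u W v] D f by auto
    have P': "Dom C h = P" using h by simp
    show "\<exists>!w. w \<in> Hom C W (Dom C h) \<and> h \<cdot> w = u \<and> p' \<cdot> w = v"
      unfolding P'
    proof (intro ex1I [of _ w] w)
      fix w' assume "w' \<in> Hom C W P \<and> h \<cdot> w' = u \<and> p' \<cdot> w' = v"
      with w show "w' = w" by - (rule jointly; simp)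
    qed
  qed (use D f h p' sq in auto)
  \<comment> \<open>On the first summand \<open>d\<close> restricts to the epi \<open>p\<close>, so
    \<open>d\<close> is epi as well.\<close>
  have epi_d: "is_epi C d"
    unfolding is_epi_def
  proof (intro conjI ballI impI)
    fix u v assume uv: "u \<in> Arr C" "v \<in> Arr C"
      "Cod C u = Cod C v \<and> Dom C u = Cod C d \<and> Dom C v = Cod C d \<and> u \<cdot> d = v \<cdot> d"
    have "u \<cdot> (d \<cdot> j\<^sub>1) = (u \<cdot> d) \<cdot> j\<^sub>1" using uv d b by (subst Comp_assoc') auto
    also have "\<dots> = (v \<cdot> d) \<cdot> j\<^sub>1" using uv by (elim conjE) (simp only:)
    also have "\<dots> = v \<cdot> (d \<cdot> j\<^sub>1)" using uv d b by (subst Comp_assoc') auto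
    finally have "u \<cdot> (d \<cdot> j\<^sub>1) = v \<cdot> (d \<cdot> j\<^sub>1)" .
    with uv d show "u = v" unfolding dj
      by - (rule is_epiD [OF epi_p]; auto)
  qed (use d in auto)
  have se_d: "short_exact C k d" using k epi_d by (rule short_exactI)
  text \<open>Since \<open>d\<close> is a cokernel of \<open>k\<close>, an arrow \<open>u \<cdot> q\<^sub>2\<close> killing \<open>k\<close> factors as \<open>v \<cdot> d\<close>,
    and restricting to the first summand gives \<open>v \<cdot> p = 0\<close>.\<close>
  have "is_mono (opposite C) p'"
  proof (rule op.is_monoI)
    fix u assume "u \<in> Arr (opposite C)" "Cod (opposite C) u = Dom (opposite C) p'"
      "p' \<cdot>\<^bsub>opposite C\<^esub> u = Zero (opposite C) (Dom (opposite C) u) (Cod (opposite C) p')"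
    then have u: "u \<in> Arr C" "Dom C u = X'" "u \<cdot> p' = Zero C P (Cod C u)"
      using p' by auto
    have "(u \<cdot> q\<^sub>2) \<cdot> k = Zero C P (Cod C (u \<cdot> q\<^sub>2))"
      using u b K P d by (simp add: p'_def)
    then obtain v where v: "v \<in> Arr C" "Dom C v = Cod C d" "Cod C v = Cod C u" "v \<cdot> d = u \<cdot> q\<^sub>2"
      using is_cokernel_lift [of C k d "u \<cdot> q\<^sub>2"] se_d u b K P d
      unfolding short_exact_def by auto
    have "v \<cdot> p = (v \<cdot> d) \<cdot> j\<^sub>1" unfolding dj [symmetric] using v b d by (subst Comp_assoc') auto
    also have "\<dots> = u \<cdot> (q\<^sub>2 \<cdot> j\<^sub>1)" unfolding v(4) using u b by (subst Comp_assoc') auto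
    finally have vp: "v \<cdot> p = u \<cdot> (q\<^sub>2 \<cdot> j\<^sub>1)" .
    have "v = Zero C (Dom C v) (Cod C v)"
      by (rule is_epiD [OF epi_p]) (use vp u v b d D EX' X' in \<open>auto\<close>)
    then have "u \<cdot> q\<^sub>2 = Zero C B (Cod C u)" using v d u
      by (subst v(4) [symmetric], subst \<open>v = _\<close>) simp
    then have "(u \<cdot> q\<^sub>2) \<cdot> j\<^sub>2 = Zero C X' (Cod C u)" using u b by simp
    then show "u = Zero (opposite C) (Dom (opposite C) u) (Dom (opposite C) p')"
      using u b p' by simp
  qed (use p' in auto)
  then have epi_p': "is_epi C p'" by simp
  have Y: "Dom C i \<in> Obj C" using D by simp
  \<comment> \<open>The subobject does not change: \<open>i'\<close> is the arrow with coordinates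
    \<open>i\<close> and zero.\<close>
  obtain i' where i': "i' \<in> Hom C (Dom C i) P" "h \<cdot> i' = i" "p' \<cdot> i' = Zero C (Dom C i) X'"
    using lift [of i "Dom C i" "Zero C (Dom C i) X'"] D X' Y f by auto
  have "is_kernel C p' i'"
  proof (rule is_kernelI)
    show "is_mono C i'"
    proof (rule is_monoI)
      fix u assume u: "u \<in> Arr C" "Cod C u = Dom C i'" "i' \<cdot> u = Zero C (Dom C u) (Cod C i')"
      have "i \<cdot> u = h \<cdot> (i' \<cdot> u)" using u i' h by (subst Comp_rewrite [OF i'(2)]) auto
      also have "\<dots> = Zero C (Dom C u) (Cod C i)" using u i' h by simp
      finally have iu: "i \<cdot> u = Zero C (Dom C u) (Cod C i)" .
      show "u = Zero C (Dom C u) (Dom C i')"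
        by (rule is_monoD [OF short_exact_mono [OF e]]) (use iu u i' D Y in \<open>auto\<close>)
    qed (use i' in simp)
  next
    fix x assume x: "x \<in> Arr C" "Cod C x = Dom C p'" "p' \<cdot> x = Zero C (Dom C x) (Cod C p')"
    \<comment> \<open>If \<open>p'\<close> kills \<open>x\<close>, then \<open>p\<close> kills
      \<open>h \<cdot> x\<close>, which lifts through \<open>i\<close>. The same lift works for
      \<open>i'\<close>, because both coordinates agree.\<close>
    have "p \<cdot> (h \<cdot> x) = f \<cdot> (p' \<cdot> x)"
      using x h p' D f by (subst Comp_rewrite [OF sq]) auto
    also have "\<dots> = Zero C (Dom C x) (Cod C p)" using x f p' X' by simp
    finally obtain u where u: "u \<in> Arr C" "Dom C u = Dom C x" "Cod C u = Dom C i" "i \<cdot> u = h \<cdot> x"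
      using is_kernel_lift [of C p i "h \<cdot> x"] e x h p' D unfolding short_exact_def by auto
    have "i' \<cdot> u = x"
    proof (rule jointly)
      show "h \<cdot> (i' \<cdot> u) = h \<cdot> x" using u i' h by (subst Comp_rewrite [OF i'(2)]) auto
      show "p' \<cdot> (i' \<cdot> u) = p' \<cdot> x"
        using u i' p' x X' by (subst Comp_rewrite [OF i'(3)]) auto
    qed (use u i' x p' in auto)
    with u i' show "\<exists>u. u \<in> Hom C (Dom C x) (Dom C i') \<and> i' \<cdot> u = x" by auto
  qed (use i' p' in auto)
  then have "short_exact C i' p'" using epi_p' by (rule short_exactI)
  then show thesis using that pb h i' p' by auto
qed

end

section \<open>Morphisms of extensions\<close>

text \<open>The middle arrow is only required to exist, which is all that classes in Ext depend on.
  Exactness of both rows is included, so the typing of all arrows can be recovered from this single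
  fact.\<close>

definition ext_mor ::
  "('o, 'm, 'z) preadditive_scheme \<Rightarrow> 'm \<times> 'm \<Rightarrow> 'm \<times> 'm \<Rightarrow> 'm \<Rightarrow> 'm \<Rightarrow> bool" where
  "ext_mor C e e' g f \<longleftrightarrow>
     short_exact C (fst e) (snd e) \<and> short_exact C (fst e') (snd e') \<and>
     g \<in> Hom C (Dom C (fst e)) (Dom C (fst e')) \<and> f \<in> Hom C (Cod C (snd e)) (Cod C (snd e')) \<and>
     (\<exists>h\<in>Hom C (Cod C (fst e)) (Cod C (fst e')).
        h \<cdot>\<^bsub>C\<^esub> fst e = fst e' \<cdot>\<^bsub>C\<^esub> g \<and> snd e' \<cdot>\<^bsub>C\<^esub> h = f \<cdot>\<^bsub>C\<^esub> snd e)"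

text \<open>Duality for extensions: the morphism reverses, sub and quotient arrows change places,
  and \<open>prod.swap\<close> exchanges inclusion and projection. Exactness identifies the two ways
  of naming the middle object.\<close>

lemma ext_mor_opposite:
  "ext_mor (opposite C) (prod.swap e') (prod.swap e) f g \<longleftrightarrow> ext_mor C e e' g f"
proof -
  have "Dom C (snd e) = Cod C (fst e)" if "short_exact C (fst e) (snd e)" for e
    using short_exactD [OF that] by simp
  then show ?thesis
    unfolding ext_mor_def by (auto simp: Hom_opposite)
qed

context category
begin

text \<open>The construction of pullbacks yields a square of its own, while the square of a given
  extension is wanted; the universal property is carried along the comparison isomorphism
  \<open>w\<close>.\<close>

lemma is_pullback_iso:
  assumes "is_pullback C a b a' b'" "is_iso C w" "Cod C w = Dom C a'"
  shows "is_pullback C a b (a' \<cdot> w) (b' \<cdot> w)"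
proof -
  obtain v where v: "v \<in> Arr C" "Dom C v = Cod C w" "Cod C v = Dom C w"
    "v \<cdot> w = Ident C (Dom C w)" "w \<cdot> v = Ident C (Cod C w)"
    using assms(2) by (auto simp: is_iso_def)
  have w: "w \<in> Arr C" using assms(2) by (simp add: is_iso_def)
  have pb: "a \<in> Arr C" "b \<in> Arr C" "a' \<in> Arr C" "b' \<in> Arr C" "Cod C a = Cod C b"
    "Dom C a' = Dom C b'" "Cod C a' = Dom C a" "Cod C b' = Dom C b" "a \<cdot> a' = b \<cdot> b'"
    using assms(1) by (auto simp: is_pullback_def)
  show ?thesis
    unfolding is_pullback_def
  proof (intro conjI ballI impI)
    show "a \<cdot> (a' \<cdot> w) = b \<cdot> (b' \<cdot> w)"
      using pb w assms(3) by (subst Comp_rewrite [OF pb(9)]) auto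
    fix W x y assume xy: "W \<in> Obj C" "x \<in> Hom C W (Dom C a)" "y \<in> Hom C W (Dom C b)" "a \<cdot> x = b \<cdot> y"
    with assms(1) have ex1: "\<exists>!z. z \<in> Hom C W (Dom C a') \<and> a' \<cdot> z = x \<and> b' \<cdot> z = y"
      unfolding is_pullback_def by blast
    then obtain z where z: "z \<in> Hom C W (Dom C a')" "a' \<cdot> z = x" "b' \<cdot> z = y" by blast
    show "\<exists>!z. z \<in> Hom C W (Dom C (a' \<cdot> w)) \<and> (a' \<cdot> w) \<cdot> z = x \<and> (b' \<cdot> w) \<cdot> z = y"
    proof (rule ex1I [of _ "v \<cdot> z"])
      show "v \<cdot> z \<in> Hom C W (Dom C (a' \<cdot> w)) \<and> (a' \<cdot> w) \<cdot> (v \<cdot> z) = x \<and> (b' \<cdot> w) \<cdot> (v \<cdot> z) = y"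
        using z v w pb assms(3) xy(1) by (simp add: Comp_rewrite [OF v(5)])
      fix z' assume z': "z' \<in> Hom C W (Dom C (a' \<cdot> w)) \<and> (a' \<cdot> w) \<cdot> z' = x \<and> (b' \<cdot> w) \<cdot> z' = y"
      then have "w \<cdot> z' \<in> Hom C W (Dom C a')" "a' \<cdot> (w \<cdot> z') = x" "b' \<cdot> (w \<cdot> z') = y"
        using w pb assms(3) by auto
      with ex1 z have "w \<cdot> z' = z" by blast
      then have "v \<cdot> z = v \<cdot> (w \<cdot> z')" by simp
      also have "\<dots> = z'" using z' v w pb assms(3) by (simp add: Comp_rewrite [OF v(4)])
      finally show "z' = v \<cdot> z" by simp
    qed
  qed (use pb w assms(3) in auto)
qed

end

context preadditive_category
begin

lemma ext_mor_Ident: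
  assumes "short_exact C (fst e) (snd e)"
  shows "ext_mor C e e (Ident C (Dom C (fst e))) (Ident C (Cod C (snd e)))"
  unfolding ext_mor_def
  using assms short_exactD [OF assms] by (auto intro!: bexI [of _ "Ident C (Cod C (fst e))"])

lemma ext_mor_Comp:
  assumes "ext_mor C e e' g f" "ext_mor C e' e'' g' f'"
  shows "ext_mor C e e'' (g' \<cdot> g) (f' \<cdot> f)"
proof -
  obtain h where h: "h \<in> Hom C (Cod C (fst e)) (Cod C (fst e'))"
    "h \<cdot> fst e = fst e' \<cdot> g" "snd e' \<cdot> h = f \<cdot> snd e"
    using assms(1) unfolding ext_mor_def by blast
  obtain h' where h': "h' \<in> Hom C (Cod C (fst e')) (Cod C (fst e''))"
    "h' \<cdot> fst e' = fst e'' \<cdot> g'" "snd e'' \<cdot> h' = f' \<cdot> snd e'"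
    using assms(2) unfolding ext_mor_def by blast
  have se: "short_exact C (fst e) (snd e)" "short_exact C (fst e') (snd e')"
    "short_exact C (fst e'') (snd e'')" using assms by (auto simp: ext_mor_def)
  note D = short_exactD [OF se(1)] short_exactD [OF se(2)] short_exactD [OF se(3)]
  have gf: "g \<in> Hom C (Dom C (fst e)) (Dom C (fst e'))" "f \<in> Hom C (Cod C (snd e)) (Cod C (snd e'))"
    "g' \<in> Hom C (Dom C (fst e')) (Dom C (fst e''))" "f' \<in> Hom C (Cod C (snd e')) (Cod C (snd e''))"
    using assms by (auto simp: ext_mor_def)
  have "h' \<cdot> (h \<cdot> fst e) = fst e'' \<cdot> (g' \<cdot> g)"
    unfolding h(2) using D h' gf by (subst Comp_rewrite [OF h'(2)]) auto
  moreover have "snd e'' \<cdot> (h' \<cdot> h) = f' \<cdot> (f \<cdot> snd e)"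
    unfolding h(3) [symmetric] using D h h' gf by (subst Comp_rewrite [OF h'(3)]) auto
  ultimately show ?thesis
    unfolding ext_mor_def using se gf h(1) h'(1) D by (auto intro!: bexI [of _ "h' \<cdot> h"])
qed

text \<open>The conditions on the three arrows are linear, so the middle arrows can be added too.
  Additivity of Ext in both variables and the description of Baer sums rest on this.\<close>

lemma ext_mor_Add:
  assumes "ext_mor C e e' g f" "ext_mor C e e' g' f'"
  shows "ext_mor C e e' (g \<boxplus> g') (f \<boxplus> f')"
proof -
  obtain h where h: "h \<in> Hom C (Cod C (fst e)) (Cod C (fst e'))"
    "h \<cdot> fst e = fst e' \<cdot> g" "snd e' \<cdot> h = f \<cdot> snd e"
    using assms(1) unfolding ext_mor_def by blast
  obtain h' where h': "h' \<in> Hom C (Cod C (fst e)) (Cod C (fst e'))"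
    "h' \<cdot> fst e = fst e' \<cdot> g'" "snd e' \<cdot> h' = f' \<cdot> snd e"
    using assms(2) unfolding ext_mor_def by blast
  have se: "short_exact C (fst e) (snd e)" "short_exact C (fst e') (snd e')"
    using assms by (auto simp: ext_mor_def)
  note D = short_exactD [OF se(1)] short_exactD [OF se(2)]
  have gf: "g \<in> Hom C (Dom C (fst e)) (Dom C (fst e'))" "f \<in> Hom C (Cod C (snd e)) (Cod C (snd e'))"
    "g' \<in> Hom C (Dom C (fst e)) (Dom C (fst e'))" "f' \<in> Hom C (Cod C (snd e)) (Cod C (snd e'))"
    using assms by (auto simp: ext_mor_def)
  show ?thesis
    unfolding ext_mor_def using se gf h h' D by (auto intro!: bexI [of _ "h \<boxplus> h'"])
qed

text \<open>The middle arrow is \<open>s \<cdot> snd e\<close>: it kills \<open>fst e\<close> and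
  lifts \<open>snd e\<close> along the section \<open>s\<close>. Hence a split extension is the
  pushout along zero of any extension with the same quotient object.\<close>

lemma ext_mor_to_split:
  assumes "short_exact C (fst e) (snd e)" "g \<in> Hom C (Dom C (fst e)) Y"
    and split: "short_exact C j q" "Dom C j = Y" "Cod C q = Cod C (snd e)"
    and s: "s \<in> Hom C (Cod C q) (Cod C j)" "q \<cdot> s = Ident C (Cod C q)"
  shows "ext_mor C e (j, q) (Zero C (Dom C (fst e)) Y) (Ident C (Cod C (snd e)))"
proof -
  note D = short_exactD [OF assms(1)] short_exactD [OF split(1)]
  have Y: "Y \<in> Obj C" using assms(2) by auto
  have "(s \<cdot> snd e) \<cdot> fst e = j \<cdot> Zero C (Dom C (fst e)) Y"
    using D s split Y by (simp del: Comp_assoc' add: Comp_assoc')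
  moreover have "q \<cdot> (s \<cdot> snd e) = snd e"
    using D s split by (subst Comp_rewrite [OF s(2)]) auto
  ultimately show ?thesis
    unfolding ext_mor_def using assms D s Y by (auto intro!: bexI [of _ "s \<cdot> snd e"])
qed

end

section \<open>Factorisation of morphisms through pullbacks of extensions\<close>

context abelian_category
begin

lemma ext_mor_pullback_exists:
  assumes "short_exact C (fst e) (snd e)" "f \<in> Hom C X' (Cod C (snd e))"
  obtains e' where "ext_mor C e' e (Ident C (Dom C (fst e))) f" "Cod C (snd e') = X'"
    "Dom C (fst e') = Dom C (fst e)"
proof -
  obtain i' p' h where *: "short_exact C i' p'" "is_pullback C (snd e) f h p'"
    "h \<in> Hom C (Cod C i') (Cod C (fst e))" "h \<cdot> i' = fst e" "Dom C i' = Dom C (fst e)" "Cod C p' = X'"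
    using pullback_of_short_exact [OF assms] by metis
  note D = short_exactD [OF assms(1)] short_exactD [OF *(1)]
  have "snd e \<cdot> h = f \<cdot> p'" using *(2) by (simp add: is_pullback_def)
  then have "ext_mor C (i', p') e (Ident C (Dom C (fst e))) f"
    unfolding ext_mor_def using * assms D by (auto intro!: bexI [of _ h])
  then show thesis using that * by auto
qed

text \<open>A morphism that is the identity on subobjects is automatically cartesian: its comparison
  with a constructed pullback is the identity on both ends, hence an isomorphism by the short five
  lemma.\<close>

lemma ext_mor_imp_pullback:
  assumes "ext_mor C e' e (Ident C (Dom C (fst e))) f"
  obtains h where "h \<in> Hom C (Cod C (fst e')) (Cod C (fst e))" "h \<cdot> fst e' = fst e"
    "is_pullback C (snd e) f h (snd e')"
proof -
  have se: "short_exact C (fst e) (snd e)" "short_exact C (fst e') (snd e')"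
    and f: "f \<in> Hom C (Cod C (snd e')) (Cod C (snd e))"
    using assms by (auto simp: ext_mor_def)
  note D = short_exactD [OF se(1)] short_exactD [OF se(2)]
  have Y: "Dom C (fst e') = Dom C (fst e)" using assms D by (auto simp: ext_mor_def)
  obtain h where h: "h \<in> Hom C (Cod C (fst e')) (Cod C (fst e))" "h \<cdot> fst e' = fst e"
    "snd e \<cdot> h = f \<cdot> snd e'"
    using assms D unfolding ext_mor_def by auto
  obtain i\<^sub>0 p\<^sub>0 h\<^sub>0 where *: "short_exact C i\<^sub>0 p\<^sub>0" "is_pullback C (snd e) f h\<^sub>0 p\<^sub>0"
    "h\<^sub>0 \<in> Hom C (Cod C i\<^sub>0) (Cod C (fst e))" "h\<^sub>0 \<cdot> i\<^sub>0 = fst e" "Dom C i\<^sub>0 = Dom C (fst e)"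
    "Cod C p\<^sub>0 = Cod C (snd e')"
    using pullback_of_short_exact [OF se(1) f] by metis
  note D' = D short_exactD [OF *(1)]
  have univ: "\<exists>!w. w \<in> Hom C W (Cod C i\<^sub>0) \<and> h\<^sub>0 \<cdot> w = u \<and> p\<^sub>0 \<cdot> w = v"
    if "W \<in> Obj C" "u \<in> Hom C W (Cod C (fst e))" "v \<in> Hom C W (Cod C (snd e'))" "snd e \<cdot> u = f \<cdot> v"
    for W u v
  proof -
    have "Dom C h\<^sub>0 = Cod C i\<^sub>0" "Dom C (snd e) = Cod C (fst e)" "Dom C f = Cod C (snd e')"
      using * D f by auto
    then show ?thesis using *(2) that unfolding is_pullback_def by metis
  qed
  obtain w where w: "w \<in> Hom C (Cod C (fst e')) (Cod C i\<^sub>0)" "h\<^sub>0 \<cdot> w = h" "p\<^sub>0 \<cdot> w = snd e'"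
    using univ [of "Cod C (fst e')" h "snd e'"] h D by auto
  \<comment> \<open>The arrows \<open>w \<cdot> fst e'\<close> and \<open>i\<^sub>0\<close> both
    have coordinates \<open>fst e\<close> and zero; uniqueness in the fibre product identifies
    them.\<close>
  have "\<exists>!w. w \<in> Hom C (Dom C (fst e)) (Cod C i\<^sub>0) \<and> h\<^sub>0 \<cdot> w = fst e \<and>
      p\<^sub>0 \<cdot> w = Zero C (Dom C (fst e)) (Cod C (snd e'))"
    using D f by (intro univ) auto
  moreover have "h\<^sub>0 \<cdot> (w \<cdot> fst e') = fst e"
    using w D' *(3) h(2) by (subst Comp_rewrite [OF w(2)]) auto
  moreover have "p\<^sub>0 \<cdot> (w \<cdot> fst e') = Zero C (Dom C (fst e)) (Cod C (snd e'))"
    using w D' Y by (subst Comp_rewrite [OF w(3)]) auto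
  moreover have "w \<cdot> fst e' \<in> Hom C (Dom C (fst e)) (Cod C i\<^sub>0)" using w D Y by auto
  moreover have "i\<^sub>0 \<in> Hom C (Dom C (fst e)) (Cod C i\<^sub>0)"
    "p\<^sub>0 \<cdot> i\<^sub>0 = Zero C (Dom C (fst e)) (Cod C (snd e'))"
    using * D' by auto
  ultimately have wi: "w \<cdot> fst e' = i\<^sub>0" using *(4) by blast
  have "is_iso C w"
    by (rule short_five [OF se(2) *(1)]) (use * Y w wi in auto)
  then have "is_pullback C (snd e) f (h\<^sub>0 \<cdot> w) (p\<^sub>0 \<cdot> w)"
    by (rule is_pullback_iso [OF *(2)]) (use * w in auto)
  then show thesis using that h w by auto
qed

text \<open>The middle arrow comes from the universal property of the fibre product, applied to the
  middle arrow of the given morphism and to \<open>k \<cdot> snd e''\<close>. Comparisons of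
  different pullbacks later reduce to this cancellation.\<close>

lemma ext_mor_factor_pullback:
  assumes e'': "ext_mor C e'' e g (f \<cdot> k)" and e': "ext_mor C e' e (Ident C (Dom C (fst e))) f"
    and k: "k \<in> Hom C (Cod C (snd e'')) (Cod C (snd e'))"
  shows "ext_mor C e'' e' g k"
proof -
  obtain h where h: "h \<in> Hom C (Cod C (fst e')) (Cod C (fst e))" "h \<cdot> fst e' = fst e"
    "is_pullback C (snd e) f h (snd e')"
    using ext_mor_imp_pullback [OF e'] by blast
  have se: "short_exact C (fst e) (snd e)" "short_exact C (fst e') (snd e')"
    "short_exact C (fst e'') (snd e'')" using e' e'' by (auto simp: ext_mor_def)
  note D = short_exactD [OF se(1)] short_exactD [OF se(2)] short_exactD [OF se(3)]
  have f: "f \<in> Hom C (Cod C (snd e')) (Cod C (snd e))" using e' by (simp add: ext_mor_def)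
  have Y: "Dom C (fst e') = Dom C (fst e)" using e' D by (auto simp: ext_mor_def)
  have g: "g \<in> Hom C (Dom C (fst e'')) (Dom C (fst e))" using e'' by (simp add: ext_mor_def)
  obtain h'' where h'': "h'' \<in> Hom C (Cod C (fst e'')) (Cod C (fst e))"
    "h'' \<cdot> fst e'' = fst e \<cdot> g" "snd e \<cdot> h'' = (f \<cdot> k) \<cdot> snd e''"
    using e'' unfolding ext_mor_def by blast
  have univ: "\<exists>!w. w \<in> Hom C W (Cod C (fst e')) \<and> h \<cdot> w = u \<and> snd e' \<cdot> w = v"
    if "W \<in> Obj C" "u \<in> Hom C W (Cod C (fst e))" "v \<in> Hom C W (Cod C (snd e'))" "snd e \<cdot> u = f \<cdot> v"
    for W u v
  proof -
    have "Dom C h = Cod C (fst e')" "Dom C (snd e) = Cod C (fst e)" "Dom C f = Cod C (snd e')"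
      using h D f by auto
    then show ?thesis using h(3) that unfolding is_pullback_def by metis
  qed
  obtain w where w: "w \<in> Hom C (Cod C (fst e'')) (Cod C (fst e'))" "h \<cdot> w = h''"
    "snd e' \<cdot> w = k \<cdot> snd e''"
    using univ [of "Cod C (fst e'')" h'' "k \<cdot> snd e''"] h'' k f D by auto
  \<comment> \<open>The two candidates on the subobject solve the same lifting problem, with
    coordinates \<open>fst e \<cdot> g\<close> and zero, and therefore coincide.\<close>
  have "\<exists>!w. w \<in> Hom C (Dom C (fst e'')) (Cod C (fst e')) \<and> h \<cdot> w = fst e \<cdot> g \<and>
      snd e' \<cdot> w = Zero C (Dom C (fst e'')) (Cod C (snd e'))"
    using D f g by (intro univ) (auto simp: Comp_rewrite [OF D(4)])
  moreover have "h \<cdot> (w \<cdot> fst e'') = fst e \<cdot> g"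
    using w D h(1) h''(2) by (subst Comp_rewrite [OF w(2)]) auto
  moreover have "snd e' \<cdot> (w \<cdot> fst e'') = Zero C (Dom C (fst e'')) (Cod C (snd e'))"
    using w D k by (subst Comp_rewrite [OF w(3)]) auto
  moreover have "w \<cdot> fst e'' \<in> Hom C (Dom C (fst e'')) (Cod C (fst e'))" using w D by auto
  moreover have "h \<cdot> (fst e' \<cdot> g) = fst e \<cdot> g"
    using h(1) g D Y by (subst Comp_rewrite [OF h(2)]) auto
  moreover have "fst e' \<cdot> g \<in> Hom C (Dom C (fst e'')) (Cod C (fst e'))"
    "snd e' \<cdot> (fst e' \<cdot> g) = Zero C (Dom C (fst e'')) (Cod C (snd e'))"
    using D g Y by (auto simp: Comp_rewrite [OF D(8)])
  ultimately have "w \<cdot> fst e'' = fst e' \<cdot> g" by blast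
  then show ?thesis
    unfolding ext_mor_def using se g k Y w by auto
qed

end

section \<open>Factorisation of morphisms through pushouts of extensions, by duality\<close>

context abelian_category
begin

interpretation op: abelian_category "opposite C"
  by (intro abelian_category_opposite abelian_category_axioms)

lemma ext_mor_pushout_exists:
  assumes "short_exact C (fst e) (snd e)" "g \<in> Hom C (Dom C (fst e)) Y'"
  obtains e' where "ext_mor C e e' g (Ident C (Cod C (snd e)))" "Dom C (fst e') = Y'"
    "Cod C (snd e') = Cod C (snd e)"
proof -
  obtain e' where "ext_mor (opposite C) e' (prod.swap e) (Ident C (Cod C (snd e))) g"
    "Dom C (snd e') = Y'" "Cod C (fst e') = Cod C (snd e)"
    using op.ext_mor_pullback_exists [of "prod.swap e" g Y'] assms by auto
  then show thesis
    using that [of "prod.swap e'"] ext_mor_opposite [of C "prod.swap e'" e] by simp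
qed

lemma ext_mor_imp_pushout:
  assumes "ext_mor C e e' g (Ident C (Cod C (snd e)))"
  obtains h where "h \<in> Hom C (Cod C (fst e)) (Cod C (fst e'))" "snd e' \<cdot> h = snd e"
    "is_pushout C (fst e) g h (fst e')"
proof -
  have "short_exact C (fst e) (snd e)" "short_exact C (fst e') (snd e')"
    using assms by (auto simp: ext_mor_def)
  then have "Dom C (snd e) = Cod C (fst e)" "Dom C (snd e') = Cod C (fst e')"
    by (auto simp: short_exactD)
  moreover have "ext_mor (opposite C) (prod.swap e') (prod.swap e) (Ident C (Cod C (snd e))) g"
    using assms by (simp add: ext_mor_opposite)
  ultimately show thesis
    using that op.ext_mor_imp_pullback [of "prod.swap e'" "prod.swap e" g] by auto
qed

lemma ext_mor_factor_pushout:
  assumes "ext_mor C e e'' (k \<cdot> g) f" "ext_mor C e e' g (Ident C (Cod C (snd e)))"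
    "k \<in> Hom C (Dom C (fst e')) (Dom C (fst e''))"
  shows "ext_mor C e' e'' k f"
  using op.ext_mor_factor_pullback [of "prod.swap e''" "prod.swap e" f g k "prod.swap e'"] assms
  by (simp add: ext_mor_opposite)

end

section \<open>Extension classes and the action of arrows on them\<close>

lemma extensions_iff:
  "e \<in> extensions C X Y \<longleftrightarrow>
     short_exact C (fst e) (snd e) \<and> Dom C (fst e) = Y \<and> Cod C (snd e) = X"
  by (auto simp: extensions_def split: prod.splits)

lemma ext_morD:
  assumes "ext_mor C e e' g f"
  shows "e \<in> extensions C (Cod C (snd e)) (Dom C (fst e))"
    and "e' \<in> extensions C (Cod C (snd e')) (Dom C (fst e'))"
    and "g \<in> Hom C (Dom C (fst e)) (Dom C (fst e'))"
    and "f \<in> Hom C (Cod C (snd e)) (Cod C (snd e'))"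
  using assms by (auto simp: ext_mor_def extensions_iff)

lemma in_ext_pullback:
  "e' \<in> ext_pullback C f \<mu> \<longleftrightarrow> short_exact C (fst e') (snd e') \<and>
     (\<exists>e\<in>\<mu>. \<exists>h\<in>Hom C (Cod C (fst e')) (Cod C (fst e)).
        h \<cdot>\<^bsub>C\<^esub> fst e' = fst e \<and> is_pullback C (snd e) f h (snd e'))"
  by (simp add: ext_pullback_def case_prod_beta)

lemma in_ext_pushout:
  "e' \<in> ext_pushout C g \<mu> \<longleftrightarrow> short_exact C (fst e') (snd e') \<and>
     (\<exists>e\<in>\<mu>. \<exists>h\<in>Hom C (Cod C (fst e)) (Cod C (fst e')).
        snd e' \<cdot>\<^bsub>C\<^esub> h = snd e \<and> is_pushout C (fst e) g h (fst e'))"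
  by (simp add: ext_pushout_def case_prod_beta)

text \<open>The outer objects are read off the representative, so the class depends on the extension
  as sole argument.\<close>

definition ext_class :: "('o, 'm, 'z) preadditive_scheme \<Rightarrow> 'm \<times> 'm \<Rightarrow> ('m \<times> 'm) set" where
  "ext_class C e = ext_equiv C (Cod C (snd e)) (Dom C (fst e)) `` {e}"

context abelian_category
begin

lemma extensions_Obj:
  assumes "e \<in> extensions C X Y"
  shows "X \<in> Obj C" "Y \<in> Obj C"
  using assms by (auto simp: extensions_iff dest: short_exactD)

text \<open>The composites enter as equations with free right-hand sides, so identities disappear
  when the remaining premises are simplified.\<close>

lemma ext_mor_trans:
  "\<lbrakk>ext_mor C e e' g f; ext_mor C e' e'' g' f'; g' \<cdot> g = g''; f' \<cdot> f = f''\<rbrakk> \<Longrightarrow> ext_mor C e e'' g'' f''"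
  using ext_mor_Comp by blast

lemma ext_mor_refl:
  "e \<in> extensions C X Y \<Longrightarrow> ext_mor C e e (Ident C Y) (Ident C X)"
  using ext_mor_Ident [of e] by (auto simp: extensions_iff)

lemma ex_ext_mor_pullback:
  assumes "e \<in> extensions C X Y" "f \<in> Hom C X' X"
  obtains m where "m \<in> extensions C X' Y" "ext_mor C m e (Ident C Y) f"
proof -
  have e: "short_exact C (fst e) (snd e)" "f \<in> Hom C X' (Cod C (snd e))" "Dom C (fst e) = Y"
    using assms by (auto simp: extensions_iff)
  obtain m where m: "ext_mor C m e (Ident C Y) f" "Cod C (snd m) = X'" "Dom C (fst m) = Y"
    using ext_mor_pullback_exists [OF e(1,2)] unfolding e(3) by blast
  then have "m \<in> extensions C X' Y" using ext_morD(1) [OF m(1)] by (simp add: extensions_iff)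
  with m(1) show thesis using that by blast
qed

lemma ex_ext_mor_pushout:
  assumes "e \<in> extensions C X Y" "g \<in> Hom C Y Y'"
  obtains m where "m \<in> extensions C X Y'" "ext_mor C e m g (Ident C X)"
proof -
  have e: "short_exact C (fst e) (snd e)" "g \<in> Hom C (Dom C (fst e)) Y'" "Cod C (snd e) = X"
    using assms by (auto simp: extensions_iff)
  obtain m where m: "ext_mor C e m g (Ident C X)" "Dom C (fst m) = Y'" "Cod C (snd m) = X"
    using ext_mor_pushout_exists [OF e(1,2)] unfolding e(3) by blast
  then have "m \<in> extensions C X Y'" using ext_morD(2) [OF m(1)] by (simp add: extensions_iff)
  with m(1) show thesis using that by blast
qed

text \<open>Cancellation of a cartesian morphism with named outer objects and with the composite as
  an equation, in a form that chains with \<open>ext_mor_trans\<close>.\<close>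

lemma ext_mor_cancel_pullback:
  assumes "ext_mor C e'' e g f''" "ext_mor C e' e (Ident C Y) f" "f \<cdot> k = f''"
    "e \<in> extensions C X Y" "e' \<in> extensions C X' Y" "e'' \<in> extensions C X'' Y''"
    "k \<in> Hom C X'' X'"
  shows "ext_mor C e'' e' g k"
  using assms ext_mor_factor_pullback [of e'' e g f k e'] by (auto simp: extensions_iff)

lemma ext_mor_cancel_pushout:
  assumes "ext_mor C e e'' g'' f" "ext_mor C e e' g (Ident C X)" "k \<cdot> g = g''"
    "e \<in> extensions C X Y" "e' \<in> extensions C X Y'" "e'' \<in> extensions C X'' Y''"
    "k \<in> Hom C Y' Y''"
  shows "ext_mor C e' e'' k f"
  using assms ext_mor_factor_pushout [of e e'' k g f e'] by (auto simp: extensions_iff)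

text \<open>A morphism that is the identity at both ends is in particular cartesian, so the identity
  of \<open>e'\<close> factors through it; no inverse of the middle arrow has to be
  computed.\<close>

lemma ext_mor_sym:
  assumes "ext_mor C e e' (Ident C Y) (Ident C X)" "e \<in> extensions C X Y" "e' \<in> extensions C X Y"
  shows "ext_mor C e' e (Ident C Y) (Ident C X)"
proof -
  have XY: "X \<in> Obj C" "Y \<in> Obj C" using extensions_Obj assms(2) by auto
  show ?thesis
    by (rule ext_mor_cancel_pullback [OF ext_mor_refl [OF assms(3)] assms(1) _ assms(3,2,3)])
      (use XY in auto)
qed

text \<open>Invertibility of the middle arrow is automatic by the short five lemma.\<close>

lemma ext_equiv_iff:
  "(e, e') \<in> ext_equiv C X Y \<longleftrightarrow>
     e \<in> extensions C X Y \<and> e' \<in> extensions C X Y \<and> ext_mor C e e' (Ident C Y) (Ident C X)"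
proof -
  have "(\<exists>h\<in>Hom C (Cod C (fst e)) (Cod C (fst e')).
      is_iso C h \<and> h \<cdot> fst e = fst e' \<and> snd e' \<cdot> h = snd e) \<longleftrightarrow>
      ext_mor C e e' (Ident C Y) (Ident C X)"
    if e: "e \<in> extensions C X Y" and e': "e' \<in> extensions C X Y"
  proof -
    have se: "short_exact C (fst e) (snd e)" "short_exact C (fst e') (snd e')"
      "Dom C (fst e) = Y" "Dom C (fst e') = Y" "Cod C (snd e) = X" "Cod C (snd e') = X"
      using e e' by (auto simp: extensions_iff)
    note D = short_exactD [OF se(1)] short_exactD [OF se(2)]
    have "is_iso C h" if "h \<in> Hom C (Cod C (fst e)) (Cod C (fst e'))" "h \<cdot> fst e = fst e'"
      "snd e' \<cdot> h = snd e" for h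
      using short_five [OF se(1,2)] that se by auto
    moreover have "fst e' \<cdot> Ident C Y = fst e'" "Ident C X \<cdot> snd e = snd e"
      "Ident C Y \<in> Hom C Y Y" "Ident C X \<in> Hom C X X"
      using se D extensions_Obj [OF e] by auto
    ultimately show ?thesis
      unfolding ext_mor_def se(3-6) using se(1,2) by metis
  qed
  then show ?thesis
    unfolding ext_equiv_def case_prod_beta mem_Collect_eq fst_conv snd_conv prod.collapse by metis
qed

lemma equiv_ext_equiv: "equiv (extensions C X Y) (ext_equiv C X Y)"
proof (rule equivI)
  show "refl_on (extensions C X Y) (ext_equiv C X Y)"
    by (auto simp: refl_on_def ext_equiv_iff intro: ext_mor_refl)
  show "sym (ext_equiv C X Y)"
    by (auto intro!: symI simp: ext_equiv_iff intro: ext_mor_sym)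
  show "trans (ext_equiv C X Y)"
  proof (rule transI)
    fix a b c assume *: "(a, b) \<in> ext_equiv C X Y" "(b, c) \<in> ext_equiv C X Y"
    then have "X \<in> Obj C" "Y \<in> Obj C" by (auto simp: ext_equiv_iff dest: extensions_Obj)
    with * show "(a, c) \<in> ext_equiv C X Y"
      by (auto simp: ext_equiv_iff intro: ext_mor_trans)
  qed
qed (auto simp: ext_equiv_iff)

lemma in_ext_class:
  assumes "e \<in> extensions C X Y"
  shows "e' \<in> ext_class C e \<longleftrightarrow> e' \<in> extensions C X Y \<and> ext_mor C e' e (Ident C Y) (Ident C X)"
proof -
  have "ext_class C e = ext_equiv C X Y `` {e}"
    using assms by (auto simp: ext_class_def extensions_iff)
  then show ?thesis using assms by (auto simp: ext_equiv_iff intro: ext_mor_sym)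
qed

lemma ext_class_eq_iff:
  assumes "e \<in> extensions C X Y" "e' \<in> extensions C X Y"
  shows "ext_class C e = ext_class C e' \<longleftrightarrow> ext_mor C e e' (Ident C Y) (Ident C X)"
proof -
  have "ext_class C e = ext_equiv C X Y `` {e}" "ext_class C e' = ext_equiv C X Y `` {e'}"
    using assms by (auto simp: ext_class_def extensions_iff)
  then show ?thesis
    using eq_equiv_class_iff [OF equiv_ext_equiv assms] assms by (simp add: ext_equiv_iff)
qed

lemma Ext_group_carrier:
  "carrier (Ext_group C X Y) = ext_class C ` extensions C X Y"
  by (auto simp: Ext_group_def quotient_def ext_class_def extensions_iff)

text \<open>One pullback of one representative determines the whole set. Any other member maps to
  \<open>e\<close> over \<open>f\<close> and factors through \<open>e'\<close>; conversely, whatever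
  is equivalent to \<open>e'\<close> maps to \<open>e\<close> over \<open>f\<close>, and such a
  morphism is a pullback square.\<close>

lemma ext_pullback_class:
  assumes e: "e \<in> extensions C X Y" "e' \<in> extensions C X' Y" and m: "ext_mor C e' e (Ident C Y) f"
  shows "ext_pullback C f (ext_class C e) = ext_class C e'"
proof -
  have XY: "X \<in> Obj C" "Y \<in> Obj C" "X' \<in> Obj C" using extensions_Obj e by auto
  have f: "f \<in> Hom C X' X" using ext_morD(4) [OF m] e by (simp add: extensions_iff)
  have "a \<in> ext_pullback C f (ext_class C e) \<longleftrightarrow> a \<in> ext_class C e'" for a
  proof
    assume "a \<in> ext_pullback C f (ext_class C e)"
    then obtain b h where *: "short_exact C (fst a) (snd a)" "b \<in> ext_class C e"
      "h \<in> Hom C (Cod C (fst a)) (Cod C (fst b))" "h \<cdot> fst a = fst b" "is_pullback C (snd b) f h (snd a)"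
      unfolding in_ext_pullback by blast
    have b: "b \<in> extensions C X Y" "ext_mor C b e (Ident C Y) (Ident C X)"
      using * e in_ext_class by auto
    note D = short_exactD [OF *(1)]
    have "h \<cdot> fst a \<in> Hom C (Dom C (fst a)) (Cod C (fst b))" using *(3) D by simp
    then have "Dom C (fst a) = Y" using *(4) b by (simp add: extensions_iff)
    moreover have "Cod C (snd a) = X'" using *(5) f by (simp add: is_pullback_def)
    ultimately have a: "a \<in> extensions C X' Y" using * by (simp add: extensions_iff)
    have db: "short_exact C (fst b) (snd b)" using b by (simp add: extensions_iff)
    have "ext_mor C a b (Ident C Y) f"
      unfolding ext_mor_def using a b * f D XY short_exactD [OF db]
      by (auto simp: extensions_iff is_pullback_def intro!: bexI [of _ h])
    then have "ext_mor C a e (Ident C Y) f"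
      by (rule ext_mor_trans [OF _ b(2)]) (use f XY in auto)
    then have "ext_mor C a e' (Ident C Y) (Ident C X')"
      by (rule ext_mor_cancel_pullback [OF _ m _ e a]) (use f XY in auto)
    with a e show "a \<in> ext_class C e'" by (simp add: in_ext_class)
  next
    assume "a \<in> ext_class C e'"
    then have a: "a \<in> extensions C X' Y" "ext_mor C a e' (Ident C Y) (Ident C X')"
      using e by (simp_all add: in_ext_class)
    have "ext_mor C a e (Ident C Y) f"
      by (rule ext_mor_trans [OF a(2) m]) (use f XY in auto)
    then obtain h where "h \<in> Hom C (Cod C (fst a)) (Cod C (fst e))" "h \<cdot> fst a = fst e"
      "is_pullback C (snd e) f h (snd a)"
      using ext_mor_imp_pullback [of a e f] e by (auto simp: extensions_iff)
    moreover have "e \<in> ext_class C e" using e ext_mor_refl by (simp add: in_ext_class)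
    ultimately show "a \<in> ext_pullback C f (ext_class C e)"
      using a(1) unfolding in_ext_pullback extensions_iff by blast
  qed
  then show ?thesis by blast
qed

text \<open>The argument for pullbacks with arrows reversed. Pushouts give arrows out of
  \<open>e\<close> and \<open>e'\<close>, while membership in a class is expressed by arrows into
  the representative, hence the uses of \<open>ext_mor_sym\<close>.\<close>

lemma ext_pushout_class:
  assumes e: "e \<in> extensions C X Y" "e' \<in> extensions C X Y'" and m: "ext_mor C e e' g (Ident C X)"
  shows "ext_pushout C g (ext_class C e) = ext_class C e'"
proof -
  have XY: "X \<in> Obj C" "Y \<in> Obj C" "Y' \<in> Obj C" using extensions_Obj e by auto
  have g: "g \<in> Hom C Y Y'" using ext_morD(3) [OF m] e by (simp add: extensions_iff)
  have "a \<in> ext_pushout C g (ext_class C e) \<longleftrightarrow> a \<in> ext_class C e'" for a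
  proof
    assume "a \<in> ext_pushout C g (ext_class C e)"
    then obtain b h where *: "short_exact C (fst a) (snd a)" "b \<in> ext_class C e"
      "h \<in> Hom C (Cod C (fst b)) (Cod C (fst a))" "snd a \<cdot> h = snd b" "is_pushout C (fst b) g h (fst a)"
      unfolding in_ext_pushout by blast
    have b: "b \<in> extensions C X Y" "ext_mor C b e (Ident C Y) (Ident C X)"
      using * e in_ext_class by auto
    note D = short_exactD [OF *(1)]
    have db: "short_exact C (fst b) (snd b)" using b by (simp add: extensions_iff)
    have "snd a \<cdot> h \<in> Hom C (Cod C (fst b)) (Cod C (snd a))" using *(3) D by simp
    then have "Cod C (snd a) = X" using *(4) b by (simp add: extensions_iff)
    moreover have "Dom C (fst a) = Y'" using *(5) g by (simp add: is_pushout_def)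
    ultimately have a: "a \<in> extensions C X Y'" using * by (simp add: extensions_iff)
    have "ext_mor C b a g (Ident C X)"
      unfolding ext_mor_def using a b * g D XY short_exactD [OF db]
      by (auto simp: extensions_iff is_pushout_def intro!: bexI [of _ h])
    then have "ext_mor C e a g (Ident C X)"
      by (rule ext_mor_trans [OF ext_mor_sym [OF b(2) b(1) e(1)]]) (use g XY in auto)
    then have "ext_mor C e' a (Ident C Y') (Ident C X)"
      by (rule ext_mor_cancel_pushout [OF _ m _ e a]) (use g XY in auto)
    with a e show "a \<in> ext_class C e'" by (simp add: in_ext_class ext_mor_sym)
  next
    assume "a \<in> ext_class C e'"
    then have a: "a \<in> extensions C X Y'" "ext_mor C a e' (Ident C Y') (Ident C X)"
      using e by (simp_all add: in_ext_class)
    have "ext_mor C e a g (Ident C X)"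
      by (rule ext_mor_trans [OF m ext_mor_sym [OF a(2) a(1) e(2)]]) (use g XY in auto)
    then obtain h where "h \<in> Hom C (Cod C (fst e)) (Cod C (fst a))" "snd a \<cdot> h = snd e"
      "is_pushout C (fst e) g h (fst a)"
      using ext_mor_imp_pushout [of e a g] e by (auto simp: extensions_iff)
    moreover have "e \<in> ext_class C e" using e ext_mor_refl by (simp add: in_ext_class)
    ultimately show "a \<in> ext_pushout C g (ext_class C e)"
      using a(1) unfolding in_ext_pushout extensions_iff by blast
  qed
  then show ?thesis by blast
qed

lemma ext_map_class:
  assumes "e \<in> extensions C X Y" "m \<in> extensions C X' Y" "e' \<in> extensions C X' Y'"
    "ext_mor C m e (Ident C Y) f" "ext_mor C m e' g (Ident C X')"
  shows "ext_map C f g (ext_class C e) = ext_class C e'"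
  unfolding ext_map_def
  using ext_pullback_class [OF assms(1,2,4)] ext_pushout_class [OF assms(2,3,5)] by simp

text \<open>Computations with \<open>ext_map\<close> take place on this span: \<open>m\<close> is a
  pullback of \<open>e\<close>, and \<open>e'\<close> is a pushout of \<open>m\<close>.\<close>

lemma ext_map_classE:
  assumes "e \<in> extensions C X Y" "f \<in> Hom C X' X" "g \<in> Hom C Y Y'"
  obtains m e' where "m \<in> extensions C X' Y" "e' \<in> extensions C X' Y'"
    "ext_mor C m e (Ident C Y) f" "ext_mor C m e' g (Ident C X')"
    "ext_map C f g (ext_class C e) = ext_class C e'"
proof -
  obtain m where m: "m \<in> extensions C X' Y" "ext_mor C m e (Ident C Y) f"
    by (rule ex_ext_mor_pullback [OF assms(1,2)])
  moreover obtain e' where "e' \<in> extensions C X' Y'" "ext_mor C m e' g (Ident C X')"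
    by (rule ex_ext_mor_pushout [OF m(1) assms(3)])
  ultimately show thesis using that ext_map_class [OF assms(1)] by blast
qed

end

section \<open>Baer sums\<close>

context preadditive_category
begin

lemma is_biproductD:
  assumes "is_biproduct C X Y (B, j\<^sub>1, j\<^sub>2, q\<^sub>1, q\<^sub>2)"
  shows "j\<^sub>1 \<in> Arr C" "Dom C j\<^sub>1 = X" "Cod C j\<^sub>1 = B" "j\<^sub>2 \<in> Arr C" "Dom C j\<^sub>2 = Y" "Cod C j\<^sub>2 = B"
    "q\<^sub>1 \<in> Arr C" "Dom C q\<^sub>1 = B" "Cod C q\<^sub>1 = X" "q\<^sub>2 \<in> Arr C" "Dom C q\<^sub>2 = B" "Cod C q\<^sub>2 = Y"
    "q\<^sub>1 \<cdot> j\<^sub>1 = Ident C X" "q\<^sub>2 \<cdot> j\<^sub>2 = Ident C Y" "q\<^sub>2 \<cdot> j\<^sub>1 = Zero C X Y" "q\<^sub>1 \<cdot> j\<^sub>2 = Zero C Y X"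
    "j\<^sub>1 \<cdot> q\<^sub>1 \<boxplus> j\<^sub>2 \<cdot> q\<^sub>2 = Ident C B" "X \<in> Obj C" "Y \<in> Obj C" "B \<in> Obj C"
  using assms by (auto simp: is_biproduct_def)

lemma is_biproduct_rewrite:
  assumes "is_biproduct C X Y (B, j\<^sub>1, j\<^sub>2, q\<^sub>1, q\<^sub>2)" "f \<in> Arr C"
  shows "Cod C f = X \<Longrightarrow> q\<^sub>1 \<cdot> (j\<^sub>1 \<cdot> f) = f" "Cod C f = Y \<Longrightarrow> q\<^sub>2 \<cdot> (j\<^sub>2 \<cdot> f) = f"
    "Cod C f = X \<Longrightarrow> q\<^sub>2 \<cdot> (j\<^sub>1 \<cdot> f) = Zero C (Dom C f) Y"
    "Cod C f = Y \<Longrightarrow> q\<^sub>1 \<cdot> (j\<^sub>2 \<cdot> f) = Zero C (Dom C f) X"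
    "Cod C f = B \<Longrightarrow> j\<^sub>1 \<cdot> (q\<^sub>1 \<cdot> f) \<boxplus> j\<^sub>2 \<cdot> (q\<^sub>2 \<cdot> f) = f"
proof -
  note b = is_biproductD [OF assms(1)]
  show "Cod C f = X \<Longrightarrow> q\<^sub>1 \<cdot> (j\<^sub>1 \<cdot> f) = f" "Cod C f = Y \<Longrightarrow> q\<^sub>2 \<cdot> (j\<^sub>2 \<cdot> f) = f"
    "Cod C f = X \<Longrightarrow> q\<^sub>2 \<cdot> (j\<^sub>1 \<cdot> f) = Zero C (Dom C f) Y"
    "Cod C f = Y \<Longrightarrow> q\<^sub>1 \<cdot> (j\<^sub>2 \<cdot> f) = Zero C (Dom C f) X"
    using b assms(2) by (simp_all add: Comp_rewrite [OF b(13)] Comp_rewrite [OF b(14)]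
      Comp_rewrite [OF b(15)] Comp_rewrite [OF b(16)])
  assume f: "Cod C f = B"
  have "j\<^sub>1 \<cdot> (q\<^sub>1 \<cdot> f) \<boxplus> j\<^sub>2 \<cdot> (q\<^sub>2 \<cdot> f) = (j\<^sub>1 \<cdot> q\<^sub>1 \<boxplus> j\<^sub>2 \<cdot> q\<^sub>2) \<cdot> f"
    using b(1-12) assms(2) f by (subst Comp_Add(1)) auto
  then show "j\<^sub>1 \<cdot> (q\<^sub>1 \<cdot> f) \<boxplus> j\<^sub>2 \<cdot> (q\<^sub>2 \<cdot> f) = f"
    using b assms(2) f by simp
qed

lemma biproduct_joint_mono:
  assumes "is_biproduct C X Y (B, j\<^sub>1, j\<^sub>2, q\<^sub>1, q\<^sub>2)" "f \<in> Hom C W B" "g \<in> Hom C W B"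
    "q\<^sub>1 \<cdot> f = q\<^sub>1 \<cdot> g" "q\<^sub>2 \<cdot> f = q\<^sub>2 \<cdot> g"
  shows "f = g"
proof -
  have "f = j\<^sub>1 \<cdot> (q\<^sub>1 \<cdot> f) \<boxplus> j\<^sub>2 \<cdot> (q\<^sub>2 \<cdot> f)"
    using is_biproduct_rewrite(5) [OF assms(1), of f] assms(2) by simp
  also have "\<dots> = g"
    unfolding assms(4,5) using is_biproduct_rewrite(5) [OF assms(1), of g] assms(3) by simp
  finally show ?thesis .
qed

lemma biproduct_joint_epi:
  assumes b: "is_biproduct C X Y (B, j\<^sub>1, j\<^sub>2, q\<^sub>1, q\<^sub>2)" and "f \<in> Hom C B W" "g \<in> Hom C B W"
    "f \<cdot> j\<^sub>1 = g \<cdot> j\<^sub>1" "f \<cdot> j\<^sub>2 = g \<cdot> j\<^sub>2"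
  shows "f = g"
proof (rule preadditive_category.biproduct_joint_mono
    [OF preadditive_category_opposite [OF preadditive_category_axioms]])
  show "is_biproduct (opposite C) X Y (B, q\<^sub>1, q\<^sub>2, j\<^sub>1, j\<^sub>2)"
    using b by (simp add: is_biproduct_opposite [OF preadditive_category_axioms])
qed (use assms in auto)

lemma is_monoI_retraction:
  assumes "f \<in> Arr C" "r \<in> Hom C (Cod C f) (Dom C f)" "r \<cdot> f = Ident C (Dom C f)"
  shows "is_mono C f"
proof (rule is_monoI)
  fix u assume u: "u \<in> Arr C" "Cod C u = Dom C f" "f \<cdot> u = Zero C (Dom C u) (Cod C f)"
  have "u = r \<cdot> (f \<cdot> u)"
    using assms u(1,2) by (subst Comp_rewrite [OF assms(3)]) auto
  also have "\<dots> = Zero C (Dom C u) (Dom C f)" unfolding u(3) using assms u(1,2) by auto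
  finally show "u = Zero C (Dom C u) (Dom C f)" .
qed (fact assms(1))

lemma is_epiI_section:
  assumes "f \<in> Arr C" "s \<in> Hom C (Cod C f) (Dom C f)" "f \<cdot> s = Ident C (Cod C f)"
  shows "is_epi C f"
  using preadditive_category.is_monoI_retraction
    [OF preadditive_category_opposite [OF preadditive_category_axioms], of f s] assms by simp

end

context abelian_category
begin

lemma is_biproduct_biproduct:
  assumes "X \<in> Obj C" "Y \<in> Obj C"
  obtains B j\<^sub>1 j\<^sub>2 q\<^sub>1 q\<^sub>2 where "biproduct C X Y = (B, j\<^sub>1, j\<^sub>2, q\<^sub>1, q\<^sub>2)"
    "is_biproduct C X Y (B, j\<^sub>1, j\<^sub>2, q\<^sub>1, q\<^sub>2)"
proof -
  have "is_biproduct C X Y (biproduct C X Y)"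
    unfolding biproduct_def using someI_ex [OF ex_biproduct [OF assms]] .
  then show thesis using that by (cases "biproduct C X Y") auto
qed

text \<open>By the biproduct identity, an arrow killed by \<open>q\<^sub>2\<close> is recovered from
  its first component.\<close>

lemma short_exact_biproduct:
  assumes "is_biproduct C Y X (B, j\<^sub>1, j\<^sub>2, q\<^sub>1, q\<^sub>2)"
  shows "short_exact C j\<^sub>1 q\<^sub>2"
proof (rule short_exactI)
  note b = is_biproductD [OF assms]
  show "is_epi C q\<^sub>2" by (rule is_epiI_section [of _ j\<^sub>2]) (use b in auto)
  show "is_kernel C q\<^sub>2 j\<^sub>1"
  proof (rule is_kernelI)
    show "is_mono C j\<^sub>1" by (rule is_monoI_retraction [of _ q\<^sub>1]) (use b in auto)
    fix h assume h: "h \<in> Arr C" "Cod C h = Dom C q\<^sub>2" "q\<^sub>2 \<cdot> h = Zero C (Dom C h) (Cod C q\<^sub>2)"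
    have "j\<^sub>1 \<cdot> (q\<^sub>1 \<cdot> h) \<boxplus> j\<^sub>2 \<cdot> (q\<^sub>2 \<cdot> h) = h"
      using is_biproduct_rewrite(5) [OF assms, of h] h b by simp
    then have "j\<^sub>1 \<cdot> (q\<^sub>1 \<cdot> h) = h" unfolding h(3) using b h(1,2) by simp
    then show "\<exists>u. u \<in> Hom C (Dom C h) (Dom C j\<^sub>1) \<and> j\<^sub>1 \<cdot> u = h"
      using b h by (intro exI [of _ "q\<^sub>1 \<cdot> h"]) auto
  qed (use b in auto)
qed

text \<open>Both maps are diagonal in coordinates, so exactness is checked in each summand.
  Arbitrary biproducts are allowed, since those entering \<open>direct_sum\<close> are arbitrary
  choices.\<close>

lemma direct_sum_short_exact:
  assumes e: "short_exact C i p" and e': "short_exact C i' p'"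
    and a: "is_biproduct C (Dom C i) (Dom C i') (A, a\<^sub>1, a\<^sub>2, b\<^sub>1, b\<^sub>2)"
    and c: "is_biproduct C (Cod C i) (Cod C i') (B, c\<^sub>1, c\<^sub>2, d\<^sub>1, d\<^sub>2)"
    and k: "is_biproduct C (Cod C p) (Cod C p') (K, k\<^sub>1, k\<^sub>2, r\<^sub>1, r\<^sub>2)"
  shows "short_exact C (c\<^sub>1 \<cdot> i \<cdot> b\<^sub>1 \<boxplus> c\<^sub>2 \<cdot> i' \<cdot> b\<^sub>2) (k\<^sub>1 \<cdot> p \<cdot> d\<^sub>1 \<boxplus> k\<^sub>2 \<cdot> p' \<cdot> d\<^sub>2)"
    (is "short_exact C ?i ?p")
proof -
  note D = short_exactD [OF e] short_exactD [OF e']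
  note A = is_biproductD [OF a] and B = is_biproductD [OF c] and K = is_biproductD [OF k]
  note R = is_biproduct_rewrite(1-4) [OF a] is_biproduct_rewrite(1-4) [OF c]
    is_biproduct_rewrite(1-4) [OF k]
  have i: "?i \<in> Arr C" "Dom C ?i = A" "Cod C ?i = B"
    using D A B by auto
  have p: "?p \<in> Arr C" "Dom C ?p = B" "Cod C ?p = K"
    using D B K by auto
  have di: "d\<^sub>1 \<cdot> ?i = i \<cdot> b\<^sub>1" "d\<^sub>2 \<cdot> ?i = i' \<cdot> b\<^sub>2"
    using D(1-3,5-7) A(1-12,18-20) B(1-12,18-20) by (simp_all add: R)
  have rp: "r\<^sub>1 \<cdot> ?p = p \<cdot> d\<^sub>1" "r\<^sub>2 \<cdot> ?p = p' \<cdot> d\<^sub>2"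
    using D(1-3,5-7) K(1-12,18-20) B(1-12,18-20) by (simp_all add: R)
  have pc: "?p \<cdot> c\<^sub>1 = k\<^sub>1 \<cdot> p" "?p \<cdot> c\<^sub>2 = k\<^sub>2 \<cdot> p'"
    using D(1-3,5-7) K(1-12,18-20) B by simp_all
  have "is_epi C ?p"
    unfolding is_epi_def
  proof (intro conjI ballI impI, goal_cases)
    case (2 u v)
    show "u = v"
    proof (rule biproduct_joint_epi [OF k])
      have uv: "u \<in> Hom C K (Cod C v)" "v \<in> Hom C K (Cod C v)" "u \<cdot> ?p = v \<cdot> ?p"
        using 2 p by auto
      have *: "u \<cdot> (?p \<cdot> x) = v \<cdot> (?p \<cdot> x)" if "x \<in> Arr C" "Cod C x = B" for x
        using Comp_rewrite [OF uv(3), of x] uv(1,2) p that by simp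
      have "u \<cdot> (k\<^sub>1 \<cdot> p) = v \<cdot> (k\<^sub>1 \<cdot> p)" "u \<cdot> (k\<^sub>2 \<cdot> p') = v \<cdot> (k\<^sub>2 \<cdot> p')"
        using * [of c\<^sub>1] * [of c\<^sub>2] B unfolding pc by auto
      then have **: "(u \<cdot> k\<^sub>1) \<cdot> p = (v \<cdot> k\<^sub>1) \<cdot> p" "(u \<cdot> k\<^sub>2) \<cdot> p' = (v \<cdot> k\<^sub>2) \<cdot> p'"
        using uv(1,2) K D by auto
      show "u \<cdot> k\<^sub>1 = v \<cdot> k\<^sub>1"
        by (rule is_epiD [OF short_exact_epi [OF e] _ _ _ _ _ **(1)]) (use uv(1,2) K in auto)
      show "u \<cdot> k\<^sub>2 = v \<cdot> k\<^sub>2"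
        by (rule is_epiD [OF short_exact_epi [OF e'] _ _ _ _ _ **(2)]) (use uv(1,2) K in auto)
    qed (use 2 p in auto)
  qed (use p in auto)
  moreover have "is_kernel C ?p ?i"
  proof (rule is_kernelI)
    show "is_mono C ?i"
      unfolding is_mono_def
    proof (intro conjI ballI impI, goal_cases)
      case (2 u v)
      then have uv: "u \<in> Hom C (Dom C v) A" "v \<in> Hom C (Dom C v) A" "?i \<cdot> u = ?i \<cdot> v"
        using i by auto
      have *: "i \<cdot> (b\<^sub>1 \<cdot> x) = d\<^sub>1 \<cdot> (?i \<cdot> x)" "i' \<cdot> (b\<^sub>2 \<cdot> x) = d\<^sub>2 \<cdot> (?i \<cdot> x)"
        if "x \<in> Arr C" "Cod C x = A" for x
        using Comp_rewrite [OF di(1), of x] Comp_rewrite [OF di(2), of x] that i D A B by auto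
      show "u = v"
      proof (rule biproduct_joint_mono [OF a uv(1,2)])
        have "i \<cdot> (b\<^sub>1 \<cdot> u) = i \<cdot> (b\<^sub>1 \<cdot> v)" using * [of u] * [of v] uv by auto
        then show "b\<^sub>1 \<cdot> u = b\<^sub>1 \<cdot> v"
          by (rule is_monoD [OF short_exact_mono [OF e], rotated -1]) (use uv(1,2) A in auto)
        have "i' \<cdot> (b\<^sub>2 \<cdot> u) = i' \<cdot> (b\<^sub>2 \<cdot> v)" using * [of u] * [of v] uv by auto
        then show "b\<^sub>2 \<cdot> u = b\<^sub>2 \<cdot> v"
          by (rule is_monoD [OF short_exact_mono [OF e'], rotated -1]) (use uv(1,2) A in auto)
      qed
    qed (use i in auto)
    \<comment> \<open>\<open>Comp_Add\<close> is switched off so that the two diagonal maps stay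
      whole and can be replaced by their components through \<open>rp\<close> and
      \<open>di\<close>.\<close>
    show "?p \<cdot> ?i = Zero C (Dom C ?i) (Cod C ?p)"
    proof (rule biproduct_joint_mono [OF k])
      show "r\<^sub>1 \<cdot> (?p \<cdot> ?i) = r\<^sub>1 \<cdot> Zero C (Dom C ?i) (Cod C ?p)"
        using Comp_rewrite [OF rp(1), of ?i] i p K(7-12,18-20) B(7-12) A D
        by (simp add: di Comp_rewrite [OF D(4)] del: Comp_Add)
      show "r\<^sub>2 \<cdot> (?p \<cdot> ?i) = r\<^sub>2 \<cdot> Zero C (Dom C ?i) (Cod C ?p)"
        using Comp_rewrite [OF rp(2), of ?i] i p K(7-12,18-20) B(7-12) A D
        by (simp add: di Comp_rewrite [OF D(8)] del: Comp_Add)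
    qed (use i p A K in \<open>auto simp del: Comp_Add\<close>)
    fix h assume h: "h \<in> Arr C" "Cod C h = Dom C ?p" "?p \<cdot> h = Zero C (Dom C h) (Cod C ?p)"
    have "p \<cdot> (d\<^sub>1 \<cdot> h) = r\<^sub>1 \<cdot> (?p \<cdot> h)" "p' \<cdot> (d\<^sub>2 \<cdot> h) = r\<^sub>2 \<cdot> (?p \<cdot> h)"
      using Comp_rewrite [OF rp(1), of h] Comp_rewrite [OF rp(2), of h] h(1,2) p D K B by auto
    then have *: "p \<cdot> (d\<^sub>1 \<cdot> h) = Zero C (Dom C h) (Cod C p)"
      "p' \<cdot> (d\<^sub>2 \<cdot> h) = Zero C (Dom C h) (Cod C p')"
      unfolding h(3) p(3) using h(1) K by auto
    obtain u where u: "u \<in> Arr C" "Dom C u = Dom C h" "Cod C u = Dom C i" "i \<cdot> u = d\<^sub>1 \<cdot> h"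
      using is_kernel_lift [of C p i "d\<^sub>1 \<cdot> h"] e h(1,2) * p D B unfolding short_exact_def by auto
    obtain u' where u': "u' \<in> Arr C" "Dom C u' = Dom C h" "Cod C u' = Dom C i'" "i' \<cdot> u' = d\<^sub>2 \<cdot> h"
      using is_kernel_lift [of C p' i' "d\<^sub>2 \<cdot> h"] e' h(1,2) * p D B unfolding short_exact_def by auto
    define x where "x = a\<^sub>1 \<cdot> u \<boxplus> a\<^sub>2 \<cdot> u'"
    have x: "x \<in> Hom C (Dom C h) A" using u u' A by (auto simp: x_def)
    have bx: "b\<^sub>1 \<cdot> x = u" "b\<^sub>2 \<cdot> x = u'"
      using u u' A(1-12,18-20) by (simp_all add: x_def R)
    have "?i \<cdot> x = c\<^sub>1 \<cdot> (i \<cdot> (b\<^sub>1 \<cdot> x)) \<boxplus> c\<^sub>2 \<cdot> (i' \<cdot> (b\<^sub>2 \<cdot> x))"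
      using x A(1-12) B(1-12) D(1-3,5-7) by simp
    also have "\<dots> = h"
      unfolding bx u(4) u'(4) using is_biproduct_rewrite(5) [OF c, of h] h p by simp
    finally show "\<exists>u. u \<in> Hom C (Dom C h) (Dom C ?i) \<and> ?i \<cdot> u = h"
      using x i by auto
  qed (use i p in \<open>auto simp del: Comp_Add\<close>)
  ultimately show ?thesis using short_exactI by blast
qed

text \<open>The direct sum is a biproduct of extensions, compatibly with the chosen biproducts at
  the ends. Later arguments use these morphisms and not the arrows of the direct sum.\<close>

lemma ext_direct_sum_mor:
  assumes e: "e \<in> extensions C X Y" "e' \<in> extensions C X' Y'"
    and Y: "biproduct C Y Y' = (L, j\<^sub>1, j\<^sub>2, q\<^sub>1, q\<^sub>2)" and X: "biproduct C X X' = (K, k\<^sub>1, k\<^sub>2, r\<^sub>1, r\<^sub>2)"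
  defines "s \<equiv> (direct_sum C (fst e) (fst e'), direct_sum C (snd e) (snd e'))"
  shows "s \<in> extensions C K L" "ext_mor C e s j\<^sub>1 k\<^sub>1" "ext_mor C e' s j\<^sub>2 k\<^sub>2"
    "ext_mor C s e q\<^sub>1 r\<^sub>1" "ext_mor C s e' q\<^sub>2 r\<^sub>2"
proof -
  have se: "short_exact C (fst e) (snd e)" "short_exact C (fst e') (snd e')"
    and XY: "Dom C (fst e) = Y" "Dom C (fst e') = Y'" "Cod C (snd e) = X" "Cod C (snd e') = X'"
    using e by (auto simp: extensions_iff)
  note D = short_exactD [OF se(1)] short_exactD [OF se(2)]
  note O = extensions_Obj [OF e(1)] extensions_Obj [OF e(2)]
  obtain B c\<^sub>1 c\<^sub>2 d\<^sub>1 d\<^sub>2 where bB: "biproduct C (Cod C (fst e)) (Cod C (fst e')) = (B, c\<^sub>1, c\<^sub>2, d\<^sub>1, d\<^sub>2)"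
    and c: "is_biproduct C (Cod C (fst e)) (Cod C (fst e')) (B, c\<^sub>1, c\<^sub>2, d\<^sub>1, d\<^sub>2)"
    by (rule is_biproduct_biproduct [OF Cod_Obj [OF D(1)] Cod_Obj [OF D(5)]])
  have a: "is_biproduct C Y Y' (L, j\<^sub>1, j\<^sub>2, q\<^sub>1, q\<^sub>2)"
    using is_biproduct_biproduct [OF O(2,4)] Y by metis
  have k: "is_biproduct C X X' (K, k\<^sub>1, k\<^sub>2, r\<^sub>1, r\<^sub>2)"
    using is_biproduct_biproduct [OF O(1,3)] X by metis
  let ?i = "c\<^sub>1 \<cdot> fst e \<cdot> q\<^sub>1 \<boxplus> c\<^sub>2 \<cdot> fst e' \<cdot> q\<^sub>2"
  let ?p = "k\<^sub>1 \<cdot> snd e \<cdot> d\<^sub>1 \<boxplus> k\<^sub>2 \<cdot> snd e' \<cdot> d\<^sub>2"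
  have s: "s = (?i, ?p)"
    using bB X Y XY D by (simp add: s_def direct_sum_def)
  note A = is_biproductD [OF a] and B = is_biproductD [OF c] and K = is_biproductD [OF k]
  have ses: "short_exact C ?i ?p"
    using direct_sum_short_exact [OF se] a c k XY by simp
  have ty: "Dom C ?i = L" "Cod C ?i = B" "Dom C ?p = B" "Cod C ?p = K"
    using A(1-12) B(1-12) K(1-12) D XY by simp_all
  show "s \<in> extensions C K L" using s ses ty by (simp add: extensions_iff)
  note R = is_biproduct_rewrite(1-4) [OF a] is_biproduct_rewrite(1-4) [OF c]
    is_biproduct_rewrite(1-4) [OF k]
  have "c\<^sub>1 \<cdot> fst e = ?i \<cdot> j\<^sub>1" "c\<^sub>2 \<cdot> fst e' = ?i \<cdot> j\<^sub>2"
    "?p \<cdot> c\<^sub>1 = k\<^sub>1 \<cdot> snd e" "?p \<cdot> c\<^sub>2 = k\<^sub>2 \<cdot> snd e'"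
    "d\<^sub>1 \<cdot> ?i = fst e \<cdot> q\<^sub>1" "d\<^sub>2 \<cdot> ?i = fst e' \<cdot> q\<^sub>2"
    "snd e \<cdot> d\<^sub>1 = r\<^sub>1 \<cdot> ?p" "snd e' \<cdot> d\<^sub>2 = r\<^sub>2 \<cdot> ?p"
    using A B K D(1-3,5-7) XY by (simp_all add: R)
  then show "ext_mor C e s j\<^sub>1 k\<^sub>1" "ext_mor C e' s j\<^sub>2 k\<^sub>2" "ext_mor C s e q\<^sub>1 r\<^sub>1" "ext_mor C s e' q\<^sub>2 r\<^sub>2"
    unfolding ext_mor_def s fst_conv snd_conv ty XY using se ses A(1-12) B(1-12) K(1-12) by auto
qed

text \<open>Independence of representatives: other representatives give an equivalent direct sum, so
  the double union collapses to a single class.\<close>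

lemma ext_direct_sum_class:
  assumes e: "e \<in> extensions C X Y" "e' \<in> extensions C X Y"
  shows "ext_direct_sum C X Y (ext_class C e) (ext_class C e') =
    ext_class C (direct_sum C (fst e) (fst e'), direct_sum C (snd e) (snd e'))"
proof -
  note O = extensions_Obj [OF e(1)]
  obtain L j\<^sub>1 j\<^sub>2 q\<^sub>1 q\<^sub>2 where Y: "biproduct C Y Y = (L, j\<^sub>1, j\<^sub>2, q\<^sub>1, q\<^sub>2)"
    "is_biproduct C Y Y (L, j\<^sub>1, j\<^sub>2, q\<^sub>1, q\<^sub>2)"
    by (rule is_biproduct_biproduct [OF O(2,2)])
  obtain K k\<^sub>1 k\<^sub>2 r\<^sub>1 r\<^sub>2 where X: "biproduct C X X = (K, k\<^sub>1, k\<^sub>2, r\<^sub>1, r\<^sub>2)"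
    "is_biproduct C X X (K, k\<^sub>1, k\<^sub>2, r\<^sub>1, r\<^sub>2)"
    by (rule is_biproduct_biproduct [OF O(1,1)])
  note YD = is_biproductD [OF Y(2)] and XD = is_biproductD [OF X(2)]
  define s where "s a b = (direct_sum C (fst a) (fst b), direct_sum C (snd a) (snd b))" for a b
  have s: "s a b \<in> extensions C K L" if "a \<in> extensions C X Y" "b \<in> extensions C X Y" for a b
    unfolding s_def by (rule ext_direct_sum_mor(1) [OF that Y(1) X(1)])
  have eq: "ext_class C (s a b) = ext_class C (s e e')"
    if "a \<in> ext_class C e" "b \<in> ext_class C e'" for a b
  proof -
    have a: "a \<in> extensions C X Y" "ext_mor C a e (Ident C Y) (Ident C X)"
      and b: "b \<in> extensions C X Y" "ext_mor C b e' (Ident C Y) (Ident C X)"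
      using that e by (auto simp: in_ext_class)
    note sab = ext_direct_sum_mor [OF a(1) b(1) Y(1) X(1), folded s_def]
    note see = ext_direct_sum_mor [OF e Y(1) X(1), folded s_def]
    have "ext_mor C (s a b) e q\<^sub>1 r\<^sub>1" "ext_mor C (s a b) e' q\<^sub>2 r\<^sub>2"
      by (rule ext_mor_trans [OF sab(4) a(2)], use YD XD in simp_all)
        (rule ext_mor_trans [OF sab(5) b(2)], use YD XD in simp_all)
    \<comment> \<open>Going through each summand and adding yields a morphism whose ends are the
      biproduct identities, that is, an equivalence.\<close>
    then have "ext_mor C (s a b) (s e e') (j\<^sub>1 \<cdot> q\<^sub>1 \<boxplus> j\<^sub>2 \<cdot> q\<^sub>2) (k\<^sub>1 \<cdot> r\<^sub>1 \<boxplus> k\<^sub>2 \<cdot> r\<^sub>2)"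
      by (intro ext_mor_Add ext_mor_Comp [OF _ see(2)] ext_mor_Comp [OF _ see(3)])
    then show ?thesis
      unfolding YD(17) XD(17) ext_class_eq_iff [OF s [OF a(1) b(1)] s [OF e]] .
  qed
  have cl: "ext_equiv C K L `` {s a b} = ext_class C (s a b)"
    if "a \<in> ext_class C e" "b \<in> ext_class C e'" for a b
  proof -
    have "a \<in> extensions C X Y" "b \<in> extensions C X Y"
      using that e by (simp_all add: in_ext_class)
    then have "s a b \<in> extensions C K L" by (rule s)
    then have "Cod C (snd (s a b)) = K" "Dom C (fst (s a b)) = L"
      by (simp_all add: extensions_iff)
    then show ?thesis by (simp only: ext_class_def)
  qed
  have "ext_direct_sum C X Y (ext_class C e) (ext_class C e') =
      (\<Union>a\<in>ext_class C e. \<Union>b\<in>ext_class C e'. ext_equiv C K L `` {s a b})"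
    by (simp add: ext_direct_sum_def case_prod_beta s_def biproduct_obj_def X Y)
  also have "\<dots> = (\<Union>a\<in>ext_class C e. \<Union>b\<in>ext_class C e'. ext_class C (s e e'))"
    by (intro SUP_cong refl) (use cl eq in simp)
  also have "\<dots> = ext_class C (s e e')"
  proof -
    have "e \<in> ext_class C e" "e' \<in> ext_class C e'"
      using e ext_mor_refl by (simp_all add: in_ext_class)
    then show ?thesis by auto
  qed
  finally show ?thesis by (simp add: s_def)
qed

text \<open>Baer addition is addition of the arrows along which a common extension is pushed out.\<close>

lemma baer_sum_class:
  assumes d: "d \<in> extensions C X Z" and e: "e\<^sub>1 \<in> extensions C X Y" "e\<^sub>2 \<in> extensions C X Y" "e\<^sub>3 \<in> extensions C X Y"
    and m: "ext_mor C d e\<^sub>1 g\<^sub>1 (Ident C X)" "ext_mor C d e\<^sub>2 g\<^sub>2 (Ident C X)"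
      "ext_mor C d e\<^sub>3 (g\<^sub>1 \<boxplus> g\<^sub>2) (Ident C X)"
  shows "baer_sum C X Y (ext_class C e\<^sub>1) (ext_class C e\<^sub>2) = ext_class C e\<^sub>3"
proof -
  note O = extensions_Obj [OF e(1)]
  obtain L j\<^sub>1 j\<^sub>2 q\<^sub>1 q\<^sub>2 where Y: "biproduct C Y Y = (L, j\<^sub>1, j\<^sub>2, q\<^sub>1, q\<^sub>2)"
    "is_biproduct C Y Y (L, j\<^sub>1, j\<^sub>2, q\<^sub>1, q\<^sub>2)"
    by (rule is_biproduct_biproduct [OF O(2,2)])
  obtain K k\<^sub>1 k\<^sub>2 r\<^sub>1 r\<^sub>2 where X: "biproduct C X X = (K, k\<^sub>1, k\<^sub>2, r\<^sub>1, r\<^sub>2)"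
    "is_biproduct C X X (K, k\<^sub>1, k\<^sub>2, r\<^sub>1, r\<^sub>2)"
    by (rule is_biproduct_biproduct [OF O(1,1)])
  note YD = is_biproductD [OF Y(2)] and XD = is_biproductD [OF X(2)]
  define s where "s = (direct_sum C (fst e\<^sub>1) (fst e\<^sub>2), direct_sum C (snd e\<^sub>1) (snd e\<^sub>2))"
  note s = ext_direct_sum_mor [OF e(1,2) Y(1) X(1), folded s_def]
  have g: "g\<^sub>1 \<in> Hom C Z Y" "g\<^sub>2 \<in> Hom C Z Y"
    using ext_morD(3) [OF m(1)] ext_morD(3) [OF m(2)] d e by (auto simp: extensions_iff)
  have delta: "diagonal C X = k\<^sub>1 \<boxplus> k\<^sub>2" and nabla: "codiagonal C Y = q\<^sub>1 \<boxplus> q\<^sub>2"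
    by (simp_all add: diagonal_def codiagonal_def X Y)
  have ty: "k\<^sub>1 \<boxplus> k\<^sub>2 \<in> Hom C X K" "q\<^sub>1 \<boxplus> q\<^sub>2 \<in> Hom C L Y" "j\<^sub>1 \<cdot> g\<^sub>1 \<boxplus> j\<^sub>2 \<cdot> g\<^sub>2 \<in> Hom C Z L"
    using XD YD g by auto
  \<comment> \<open>The pullback of the direct sum along the diagonal; its pushout along the
    codiagonal is the Baer sum. The morphism from \<open>d\<close> into it has components
    \<open>g\<^sub>1\<close> and \<open>g\<^sub>2\<close>.\<close>
  obtain t where t: "t \<in> extensions C X L" "ext_mor C t s (Ident C L) (k\<^sub>1 \<boxplus> k\<^sub>2)"
    by (rule ex_ext_mor_pullback [OF s(1) ty(1)])
  have "ext_mor C d s (j\<^sub>1 \<cdot> g\<^sub>1) k\<^sub>1" "ext_mor C d s (j\<^sub>2 \<cdot> g\<^sub>2) k\<^sub>2"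
    by (rule ext_mor_trans [OF m(1) s(2)], use XD in simp_all)
      (rule ext_mor_trans [OF m(2) s(3)], use XD in simp_all)
  then have ds: "ext_mor C d s (j\<^sub>1 \<cdot> g\<^sub>1 \<boxplus> j\<^sub>2 \<cdot> g\<^sub>2) (k\<^sub>1 \<boxplus> k\<^sub>2)"
    by (rule ext_mor_Add)
  have dt: "ext_mor C d t (j\<^sub>1 \<cdot> g\<^sub>1 \<boxplus> j\<^sub>2 \<cdot> g\<^sub>2) (Ident C X)"
    by (rule ext_mor_cancel_pullback [OF ds t(2) _ s(1) t(1) d]) (use ty O in auto)
  \<comment> \<open>The codiagonal adds the two components. Cancelling
    \<open>d \<rightarrow> t\<close> from \<open>d \<rightarrow> e\<^sub>3\<close> then exhibits
    \<open>e\<^sub>3\<close> as the pushout of \<open>t\<close> along the codiagonal.\<close>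
  have "(q\<^sub>1 \<boxplus> q\<^sub>2) \<cdot> (j\<^sub>1 \<cdot> g\<^sub>1 \<boxplus> j\<^sub>2 \<cdot> g\<^sub>2) = g\<^sub>1 \<boxplus> g\<^sub>2"
    using YD(1-12,18-20) g extensions_Obj [OF d] by (simp add: is_biproduct_rewrite(1-4) [OF Y(2)])
  then have "ext_mor C t e\<^sub>3 (q\<^sub>1 \<boxplus> q\<^sub>2) (Ident C X)"
    by (rule ext_mor_cancel_pushout [OF m(3) dt _ d t(1) e(3) ty(2)])
  then show ?thesis
    unfolding baer_sum_def ext_direct_sum_class [OF e(1,2)] delta nabla s_def [symmetric]
    using ext_map_class [OF s(1) t(1) e(3) t(2)] by blast
qed

text \<open>The extension \<open>d\<close> is the direct sum pulled back along the diagonal of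
  \<open>X\<close>; its subobject is the biproduct of \<open>Y\<^sub>1\<close> and
  \<open>Y\<^sub>2\<close>, and \<open>g\<^sub>1\<close>, \<open>g\<^sub>2\<close> are the
  projections.\<close>

lemma ex_common_pushout:
  assumes e: "e\<^sub>1 \<in> extensions C X Y\<^sub>1" "e\<^sub>2 \<in> extensions C X Y\<^sub>2"
  obtains d Z g\<^sub>1 g\<^sub>2 where "d \<in> extensions C X Z" "g\<^sub>1 \<in> Hom C Z Y\<^sub>1" "g\<^sub>2 \<in> Hom C Z Y\<^sub>2"
    "ext_mor C d e\<^sub>1 g\<^sub>1 (Ident C X)" "ext_mor C d e\<^sub>2 g\<^sub>2 (Ident C X)"
proof -
  note O = extensions_Obj [OF e(1)] extensions_Obj [OF e(2)]
  obtain L j\<^sub>1 j\<^sub>2 q\<^sub>1 q\<^sub>2 where Y: "biproduct C Y\<^sub>1 Y\<^sub>2 = (L, j\<^sub>1, j\<^sub>2, q\<^sub>1, q\<^sub>2)"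
    "is_biproduct C Y\<^sub>1 Y\<^sub>2 (L, j\<^sub>1, j\<^sub>2, q\<^sub>1, q\<^sub>2)"
    by (rule is_biproduct_biproduct [OF O(2,4)])
  obtain K k\<^sub>1 k\<^sub>2 r\<^sub>1 r\<^sub>2 where X: "biproduct C X X = (K, k\<^sub>1, k\<^sub>2, r\<^sub>1, r\<^sub>2)"
    "is_biproduct C X X (K, k\<^sub>1, k\<^sub>2, r\<^sub>1, r\<^sub>2)"
    by (rule is_biproduct_biproduct [OF O(1,1)])
  note YD = is_biproductD [OF Y(2)] and XD = is_biproductD [OF X(2)]
  note s = ext_direct_sum_mor [OF e Y(1) X(1)]
  have ty: "k\<^sub>1 \<boxplus> k\<^sub>2 \<in> Hom C X K" using XD by auto
  obtain t where t: "t \<in> extensions C X L"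
    "ext_mor C t (direct_sum C (fst e\<^sub>1) (fst e\<^sub>2), direct_sum C (snd e\<^sub>1) (snd e\<^sub>2)) (Ident C L) (k\<^sub>1 \<boxplus> k\<^sub>2)"
    by (rule ex_ext_mor_pullback [OF s(1) ty])
  have "ext_mor C t e\<^sub>1 q\<^sub>1 (Ident C X)" "ext_mor C t e\<^sub>2 q\<^sub>2 (Ident C X)"
    by (rule ext_mor_trans [OF t(2) s(4)], use XD YD in simp_all)
      (rule ext_mor_trans [OF t(2) s(5)], use XD YD in simp_all)
  then show thesis using that [OF t(1)] YD by simp
qed

lemma baer_sumE:
  assumes e: "e\<^sub>1 \<in> extensions C X Y" "e\<^sub>2 \<in> extensions C X Y"
  obtains d Z g\<^sub>1 g\<^sub>2 e\<^sub>3 where "d \<in> extensions C X Z" "g\<^sub>1 \<in> Hom C Z Y" "g\<^sub>2 \<in> Hom C Z Y"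
    "e\<^sub>3 \<in> extensions C X Y"
    "ext_mor C d e\<^sub>1 g\<^sub>1 (Ident C X)" "ext_mor C d e\<^sub>2 g\<^sub>2 (Ident C X)"
    "ext_mor C d e\<^sub>3 (g\<^sub>1 \<boxplus> g\<^sub>2) (Ident C X)"
    "baer_sum C X Y (ext_class C e\<^sub>1) (ext_class C e\<^sub>2) = ext_class C e\<^sub>3"
proof -
  obtain d Z g\<^sub>1 g\<^sub>2 where d: "d \<in> extensions C X Z" "g\<^sub>1 \<in> Hom C Z Y" "g\<^sub>2 \<in> Hom C Z Y"
    "ext_mor C d e\<^sub>1 g\<^sub>1 (Ident C X)" "ext_mor C d e\<^sub>2 g\<^sub>2 (Ident C X)"
    by (rule ex_common_pushout [OF e])
  have "g\<^sub>1 \<boxplus> g\<^sub>2 \<in> Hom C Z Y" using d by simp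
  then obtain e\<^sub>3 where e\<^sub>3: "e\<^sub>3 \<in> extensions C X Y" "ext_mor C d e\<^sub>3 (g\<^sub>1 \<boxplus> g\<^sub>2) (Ident C X)"
    by (rule ex_ext_mor_pushout [OF d(1)])
  then show thesis using that d baer_sum_class [OF d(1) e e\<^sub>3(1) d(4,5) e\<^sub>3(2)] by blast
qed

text \<open>The section \<open>j\<^sub>2\<close> makes the split extension a pushout along zero of
  every extension of \<open>X\<close>; this is the only property of the neutral element that the
  group laws need.\<close>

lemma split_extension_classE:
  assumes "X \<in> Obj C" "Y \<in> Obj C"
  obtains s where "s \<in> extensions C X Y" "split_extension_class C X Y = ext_class C s"
    "\<forall>e Z. e \<in> extensions C X Z \<longrightarrow> ext_mor C e s (Zero C Z Y) (Ident C X)"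
proof -
  obtain B j\<^sub>1 j\<^sub>2 q\<^sub>1 q\<^sub>2 where b: "biproduct C Y X = (B, j\<^sub>1, j\<^sub>2, q\<^sub>1, q\<^sub>2)"
    "is_biproduct C Y X (B, j\<^sub>1, j\<^sub>2, q\<^sub>1, q\<^sub>2)"
    by (rule is_biproduct_biproduct [OF assms(2,1)])
  note D = is_biproductD [OF b(2)] and se = short_exact_biproduct [OF b(2)]
  have "(j\<^sub>1, q\<^sub>2) \<in> extensions C X Y" using se D by (simp add: extensions_iff)
  moreover have "split_extension_class C X Y = ext_class C (j\<^sub>1, q\<^sub>2)"
    using D by (simp add: split_extension_class_def b ext_class_def)
  moreover have "ext_mor C e (j\<^sub>1, q\<^sub>2) (Zero C Z Y) (Ident C X)" if "e \<in> extensions C X Z" for e Z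
    using ext_mor_to_split [of e "Zero C Z Y" Y j\<^sub>1 q\<^sub>2 j\<^sub>2] that se D extensions_Obj [OF that]
    by (simp add: extensions_iff)
  ultimately show thesis using that by blast
qed

section \<open>The group laws for Ext\<close>

text \<open>Each law is the corresponding law for arrows out of the subobject of a common extension,
  transferred by \<open>baer_sum_class\<close>.\<close>

lemma comm_group_Ext_group:
  assumes X: "X \<in> Obj C" and Y: "Y \<in> Obj C"
  shows "comm_group (Ext_group C X Y)"
proof (rule comm_groupI)
  let ?G = "Ext_group C X Y"
  have simps: "x \<otimes>\<^bsub>?G\<^esub> y = baer_sum C X Y x y" "\<one>\<^bsub>?G\<^esub> = split_extension_class C X Y" for x y
    by (simp_all add: Ext_group_def)
  obtain s where s: "s \<in> extensions C X Y" "split_extension_class C X Y = ext_class C s"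
    "\<forall>e Z. e \<in> extensions C X Z \<longrightarrow> ext_mor C e s (Zero C Z Y) (Ident C X)"
    by (rule split_extension_classE [OF X Y])
  show "\<one>\<^bsub>?G\<^esub> \<in> carrier ?G"
    using s by (simp add: simps Ext_group_carrier)
  show "x \<otimes>\<^bsub>?G\<^esub> y \<in> carrier ?G" if xyz: "x \<in> carrier ?G" "y \<in> carrier ?G" for x y
  proof -
    obtain e\<^sub>1 e\<^sub>2 where e: "e\<^sub>1 \<in> extensions C X Y" "e\<^sub>2 \<in> extensions C X Y"
      "x = ext_class C e\<^sub>1" "y = ext_class C e\<^sub>2" using xyz unfolding Ext_group_carrier by blast
    show ?thesis
      unfolding simps Ext_group_carrier e(3,4) by (rule baer_sumE [OF e(1,2)]) blast
  qed
  show "x \<otimes>\<^bsub>?G\<^esub> y = y \<otimes>\<^bsub>?G\<^esub> x" if xyz: "x \<in> carrier ?G" "y \<in> carrier ?G" for x y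
  proof -
    obtain e\<^sub>1 e\<^sub>2 where e: "e\<^sub>1 \<in> extensions C X Y" "e\<^sub>2 \<in> extensions C X Y"
      "x = ext_class C e\<^sub>1" "y = ext_class C e\<^sub>2" using xyz unfolding Ext_group_carrier by blast
    obtain d Z g\<^sub>1 g\<^sub>2 e\<^sub>3 where d: "d \<in> extensions C X Z" "g\<^sub>1 \<in> Hom C Z Y" "g\<^sub>2 \<in> Hom C Z Y"
      "e\<^sub>3 \<in> extensions C X Y" "ext_mor C d e\<^sub>1 g\<^sub>1 (Ident C X)" "ext_mor C d e\<^sub>2 g\<^sub>2 (Ident C X)"
      "ext_mor C d e\<^sub>3 (g\<^sub>1 \<boxplus> g\<^sub>2) (Ident C X)"
      "baer_sum C X Y (ext_class C e\<^sub>1) (ext_class C e\<^sub>2) = ext_class C e\<^sub>3"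
      by (rule baer_sumE [OF e(1,2)])
    have "g\<^sub>1 \<boxplus> g\<^sub>2 = g\<^sub>2 \<boxplus> g\<^sub>1" using d by (intro Add_commute) auto
    then show ?thesis
      unfolding simps e(3,4) d(8)
      using baer_sum_class [OF d(1) e(2,1) d(4,6,5)] d(7) by simp
  qed
  show "(x \<otimes>\<^bsub>?G\<^esub> y) \<otimes>\<^bsub>?G\<^esub> z = x \<otimes>\<^bsub>?G\<^esub> (y \<otimes>\<^bsub>?G\<^esub> z)"
    if xyz: "x \<in> carrier ?G" "y \<in> carrier ?G" "z \<in> carrier ?G" for x y z
  proof -
    obtain e\<^sub>1 e\<^sub>2 e\<^sub>3 where e: "e\<^sub>1 \<in> extensions C X Y" "e\<^sub>2 \<in> extensions C X Y" "e\<^sub>3 \<in> extensions C X Y"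
      "x = ext_class C e\<^sub>1" "y = ext_class C e\<^sub>2" "z = ext_class C e\<^sub>3"
      using xyz unfolding Ext_group_carrier by blast
    obtain d Z g\<^sub>1 g\<^sub>2 where d: "d \<in> extensions C X Z" "g\<^sub>1 \<in> Hom C Z Y" "g\<^sub>2 \<in> Hom C Z Y"
      "ext_mor C d e\<^sub>1 g\<^sub>1 (Ident C X)" "ext_mor C d e\<^sub>2 g\<^sub>2 (Ident C X)"
      by (rule ex_common_pushout [OF e(1,2)])
    \<comment> \<open>A common extension for three classes: the first two are already pushouts of
      \<open>d\<close>, so it is enough to dominate \<open>d\<close> and
      \<open>e\<^sub>3\<close>.\<close>
    obtain c W k g where c: "c \<in> extensions C X W" "k \<in> Hom C W Z" "g \<in> Hom C W Y"
      "ext_mor C c d k (Ident C X)" "ext_mor C c e\<^sub>3 g (Ident C X)"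
      by (rule ex_common_pushout [OF d(1) e(3)])
    define h\<^sub>1 h\<^sub>2 where "h\<^sub>1 = g\<^sub>1 \<cdot> k" and "h\<^sub>2 = g\<^sub>2 \<cdot> k"
    have h: "h\<^sub>1 \<in> Hom C W Y" "h\<^sub>2 \<in> Hom C W Y" using c d by (auto simp: h\<^sub>1_def h\<^sub>2_def)
    have m: "ext_mor C c e\<^sub>1 h\<^sub>1 (Ident C X)" "ext_mor C c e\<^sub>2 h\<^sub>2 (Ident C X)"
      by (rule ext_mor_trans [OF c(4) d(4)], use X in \<open>simp_all add: h\<^sub>1_def\<close>)
        (rule ext_mor_trans [OF c(4) d(5)], use X in \<open>simp_all add: h\<^sub>2_def\<close>)
    have ty: "h\<^sub>1 \<boxplus> h\<^sub>2 \<in> Hom C W Y" "h\<^sub>2 \<boxplus> g \<in> Hom C W Y" "(h\<^sub>1 \<boxplus> h\<^sub>2) \<boxplus> g \<in> Hom C W Y"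
      using h c by auto
    obtain e\<^sub>1\<^sub>2 where e12: "e\<^sub>1\<^sub>2 \<in> extensions C X Y" "ext_mor C c e\<^sub>1\<^sub>2 (h\<^sub>1 \<boxplus> h\<^sub>2) (Ident C X)"
      by (rule ex_ext_mor_pushout [OF c(1) ty(1)])
    obtain e\<^sub>2\<^sub>3 where e23: "e\<^sub>2\<^sub>3 \<in> extensions C X Y" "ext_mor C c e\<^sub>2\<^sub>3 (h\<^sub>2 \<boxplus> g) (Ident C X)"
      by (rule ex_ext_mor_pushout [OF c(1) ty(2)])
    obtain a where a: "a \<in> extensions C X Y" "ext_mor C c a ((h\<^sub>1 \<boxplus> h\<^sub>2) \<boxplus> g) (Ident C X)"
      by (rule ex_ext_mor_pushout [OF c(1) ty(3)])
    have assoc: "(h\<^sub>1 \<boxplus> h\<^sub>2) \<boxplus> g = h\<^sub>1 \<boxplus> (h\<^sub>2 \<boxplus> g)" using h c by (intro Add_assoc) auto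
    show ?thesis
      unfolding simps e(4-6)
      unfolding baer_sum_class [OF c(1) e(1,2) e12(1) m e12(2)]
        baer_sum_class [OF c(1) e(2,3) e23(1) m(2) c(5) e23(2)]
        baer_sum_class [OF c(1) e12(1) e(3) a(1) e12(2) c(5) a(2)]
        baer_sum_class [OF c(1) e(1) e23(1) a(1) m(1) e23(2) a(2) [unfolded assoc]] ..
  qed
  show "\<one>\<^bsub>?G\<^esub> \<otimes>\<^bsub>?G\<^esub> x = x" if xyz: "x \<in> carrier ?G" for x
  proof -
    obtain e where e: "e \<in> extensions C X Y" "x = ext_class C e"
      using xyz unfolding Ext_group_carrier by blast
    \<comment> \<open>Here \<open>e\<close> itself is the common extension: pushing it out along
      zero gives the split class, along the identity its own class.\<close>
    have "ext_mor C e e (Zero C Y Y \<boxplus> Ident C Y) (Ident C X)"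
      using ext_mor_refl [OF e(1)] Y by simp
    then show ?thesis
      unfolding simps e(2) s(2)
      by (rule baer_sum_class [OF e(1) s(1) e(1,1) s(3) [rule_format, OF e(1)] ext_mor_refl [OF e(1)]])
  qed
  show "\<exists>y\<in>carrier ?G. y \<otimes>\<^bsub>?G\<^esub> x = \<one>\<^bsub>?G\<^esub>" if xyz: "x \<in> carrier ?G" for x
  proof -
    obtain e where e: "e \<in> extensions C X Y" "x = ext_class C e"
      using xyz unfolding Ext_group_carrier by blast
    \<comment> \<open>The inverse class is the pushout along minus the identity.\<close>
    have "Neg C (Ident C Y) \<in> Hom C Y Y" using Y by simp
    then obtain e' where e': "e' \<in> extensions C X Y" "ext_mor C e e' (Neg C (Ident C Y)) (Ident C X)"
      by (rule ex_ext_mor_pushout [OF e(1)])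
    have "ext_mor C e s (Neg C (Ident C Y) \<boxplus> Ident C Y) (Ident C X)"
      using s(3) [rule_format, OF e(1)] Y by simp
    then have "baer_sum C X Y (ext_class C e') (ext_class C e) = ext_class C s"
      by (rule baer_sum_class [OF e(1) e'(1) e(1) s(1) e'(2) ext_mor_refl [OF e(1)]])
    with e e' s show ?thesis
      by (auto simp: simps Ext_group_carrier)
  qed
qed

end

section \<open>The Ext bifunctor\<close>

context abelian_category
begin

lemma Ext_carrierE:
  assumes "\<mu> \<in> carrier (Ext_group C X Y)"
  obtains e where "e \<in> extensions C X Y" "\<mu> = ext_class C e"
  using assms unfolding Ext_group_carrier by (rule imageE)

lemma Ext_mult: "\<mu> \<otimes>\<^bsub>Ext_group C X Y\<^esub> \<nu> = baer_sum C X Y \<mu> \<nu>"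
  by (simp add: Ext_group_def)

lemma ext_map_in_Ext_group:
  assumes "f \<in> Hom C X' X" "g \<in> Hom C Y Y'" "\<mu> \<in> carrier (Ext_group C X Y)"
  shows "ext_map C f g \<mu> \<in> carrier (Ext_group C X' Y')"
proof -
  obtain e where e: "e \<in> extensions C X Y" "\<mu> = ext_class C e"
    using assms(3) by (rule Ext_carrierE)
  obtain e' where "e' \<in> extensions C X' Y'" "ext_map C f g (ext_class C e) = ext_class C e'"
    using ext_map_classE [OF e(1) assms(1,2)] by blast
  then show ?thesis by (simp add: e(2) Ext_group_carrier)
qed

text \<open>The common extension is pulled back along \<open>f\<close> and remains common: the three
  images are pushouts of \<open>d'\<close> along \<open>g \<cdot> g\<^sub>1\<close>,
  \<open>g \<cdot> g\<^sub>2\<close> and their sum.\<close>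

lemma ext_map_baer_sum:
  assumes f: "f \<in> Hom C X' X" and g: "g \<in> Hom C Y Y'"
    and "\<mu> \<in> carrier (Ext_group C X Y)" "\<nu> \<in> carrier (Ext_group C X Y)"
  shows "ext_map C f g (baer_sum C X Y \<mu> \<nu>) =
    baer_sum C X' Y' (ext_map C f g \<mu>) (ext_map C f g \<nu>)"
proof -
  obtain e\<^sub>1 where e1: "e\<^sub>1 \<in> extensions C X Y" "\<mu> = ext_class C e\<^sub>1"
    using assms(3) by (rule Ext_carrierE)
  obtain e\<^sub>2 where e2: "e\<^sub>2 \<in> extensions C X Y" "\<nu> = ext_class C e\<^sub>2"
    using assms(4) by (rule Ext_carrierE)
  obtain d Z g\<^sub>1 g\<^sub>2 e\<^sub>3 where d: "d \<in> extensions C X Z" "g\<^sub>1 \<in> Hom C Z Y" "g\<^sub>2 \<in> Hom C Z Y"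
    "e\<^sub>3 \<in> extensions C X Y" "ext_mor C d e\<^sub>1 g\<^sub>1 (Ident C X)" "ext_mor C d e\<^sub>2 g\<^sub>2 (Ident C X)"
    "ext_mor C d e\<^sub>3 (g\<^sub>1 \<boxplus> g\<^sub>2) (Ident C X)"
    "baer_sum C X Y (ext_class C e\<^sub>1) (ext_class C e\<^sub>2) = ext_class C e\<^sub>3"
    by (rule baer_sumE [OF e1(1) e2(1)])
  note O = extensions_Obj [OF e1(1)] extensions_Obj [OF d(1)]
  have X': "X' \<in> Obj C" using f by auto
  obtain d' where d': "d' \<in> extensions C X' Z" "ext_mor C d' d (Ident C Z) f"
    by (rule ex_ext_mor_pullback [OF d(1) f])
  \<comment> \<open>Pullback commutes with pushout: the composite
    \<open>d' \<rightarrow> d \<rightarrow> e\<close> lies over \<open>f\<close> and so factors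
    through the pullback \<open>m\<close> of \<open>e\<close>, after which the pushout along
    \<open>g\<close> is appended.\<close>
  have push: "ext_mor C d' a (g \<cdot> k) (Ident C X')"
    if "e \<in> extensions C X Y" "ext_mor C d e k (Ident C X)" "k \<in> Hom C Z Y"
      "m \<in> extensions C X' Y" "ext_mor C m e (Ident C Y) f" "ext_mor C m a g (Ident C X')" for e k m a
  proof -
    have "ext_mor C d' e k f"
      by (rule ext_mor_trans [OF d'(2) that(2)]) (use that(3) f O in auto)
    then have "ext_mor C d' m k (Ident C X')"
      by (rule ext_mor_cancel_pullback [OF _ that(5) _ that(1,4) d'(1)]) (use f X' in auto)
    then show ?thesis
      by (rule ext_mor_trans [OF _ that(6)]) (use X' in auto)
  qed
  obtain m\<^sub>1 a\<^sub>1 where 1: "m\<^sub>1 \<in> extensions C X' Y" "a\<^sub>1 \<in> extensions C X' Y'"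
    "ext_mor C m\<^sub>1 e\<^sub>1 (Ident C Y) f" "ext_mor C m\<^sub>1 a\<^sub>1 g (Ident C X')"
    "ext_map C f g (ext_class C e\<^sub>1) = ext_class C a\<^sub>1"
    by (rule ext_map_classE [OF e1(1) f g])
  obtain m\<^sub>2 a\<^sub>2 where 2: "m\<^sub>2 \<in> extensions C X' Y" "a\<^sub>2 \<in> extensions C X' Y'"
    "ext_mor C m\<^sub>2 e\<^sub>2 (Ident C Y) f" "ext_mor C m\<^sub>2 a\<^sub>2 g (Ident C X')"
    "ext_map C f g (ext_class C e\<^sub>2) = ext_class C a\<^sub>2"
    by (rule ext_map_classE [OF e2(1) f g])
  obtain m\<^sub>3 a\<^sub>3 where 3: "m\<^sub>3 \<in> extensions C X' Y" "a\<^sub>3 \<in> extensions C X' Y'"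
    "ext_mor C m\<^sub>3 e\<^sub>3 (Ident C Y) f" "ext_mor C m\<^sub>3 a\<^sub>3 g (Ident C X')"
    "ext_map C f g (ext_class C e\<^sub>3) = ext_class C a\<^sub>3"
    by (rule ext_map_classE [OF d(4) f g])
  have "g\<^sub>1 \<boxplus> g\<^sub>2 \<in> Hom C Z Y" using d by simp
  then have "ext_mor C d' a\<^sub>3 (g \<cdot> (g\<^sub>1 \<boxplus> g\<^sub>2)) (Ident C X')"
    by (rule push [OF d(4,7) _ 3(1,3,4)])
  then have "ext_mor C d' a\<^sub>3 (g \<cdot> g\<^sub>1 \<boxplus> g \<cdot> g\<^sub>2) (Ident C X')"
    using d g by simp
  then have "baer_sum C X' Y' (ext_class C a\<^sub>1) (ext_class C a\<^sub>2) = ext_class C a\<^sub>3"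
    by (rule baer_sum_class [OF d'(1) 1(2) 2(2) 3(2) push [OF e1(1) d(5,2) 1(1,3,4)]
      push [OF e2(1) d(6,3) 2(1,3,4)]])
  then show ?thesis
    unfolding e1(2) e2(2) d(8) 1(5) 2(5) 3(5) by simp
qed

lemma ext_map_Ident:
  assumes "\<mu> \<in> carrier (Ext_group C X Y)"
  shows "ext_map C (Ident C X) (Ident C Y) \<mu> = \<mu>"
proof -
  obtain e where e: "e \<in> extensions C X Y" "\<mu> = ext_class C e"
    using assms by (rule Ext_carrierE)
  show ?thesis
    unfolding e(2)
    by (rule ext_map_class [OF e(1,1,1) ext_mor_refl [OF e(1)] ext_mor_refl [OF e(1)]])
qed

text \<open>Both sides are computed from \<open>n\<close>, the pullback of \<open>m\<^sub>1\<close>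
  along \<open>f'\<close>. The content is the interchange of the pushout along \<open>g\<close> with
  the pullback along \<open>f'\<close>.\<close>

lemma ext_map_Comp:
  assumes f: "f \<in> Hom C X' X" "f' \<in> Hom C X'' X'" and g: "g \<in> Hom C Y Y'" "g' \<in> Hom C Y' Y''"
    and \<mu>: "\<mu> \<in> carrier (Ext_group C X Y)"
  shows "ext_map C (f \<cdot> f') (g' \<cdot> g) \<mu> = ext_map C f' g' (ext_map C f g \<mu>)"
proof -
  obtain e where e: "e \<in> extensions C X Y" "\<mu> = ext_class C e"
    using \<mu> by (rule Ext_carrierE)
  obtain m\<^sub>1 a\<^sub>1 where 1: "m\<^sub>1 \<in> extensions C X' Y" "a\<^sub>1 \<in> extensions C X' Y'"
    "ext_mor C m\<^sub>1 e (Ident C Y) f" "ext_mor C m\<^sub>1 a\<^sub>1 g (Ident C X')"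
    "ext_map C f g (ext_class C e) = ext_class C a\<^sub>1"
    by (rule ext_map_classE [OF e(1) f(1) g(1)])
  obtain m\<^sub>2 a\<^sub>2 where 2: "m\<^sub>2 \<in> extensions C X'' Y'" "a\<^sub>2 \<in> extensions C X'' Y''"
    "ext_mor C m\<^sub>2 a\<^sub>1 (Ident C Y') f'" "ext_mor C m\<^sub>2 a\<^sub>2 g' (Ident C X'')"
    "ext_map C f' g' (ext_class C a\<^sub>1) = ext_class C a\<^sub>2"
    by (rule ext_map_classE [OF 1(2) f(2) g(2)])
  obtain n where n: "n \<in> extensions C X'' Y" "ext_mor C n m\<^sub>1 (Ident C Y) f'"
    by (rule ex_ext_mor_pullback [OF 1(1) f(2)])
  note O = extensions_Obj [OF n(1)] extensions_Obj [OF 1(2)]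
  have ne: "ext_mor C n e (Ident C Y) (f \<cdot> f')"
    by (rule ext_mor_trans [OF n(2) 1(3)]) (use O in auto)
  have "ext_mor C n a\<^sub>1 g f'"
    by (rule ext_mor_trans [OF n(2) 1(4)]) (use f g in auto)
  \<comment> \<open>The interchange: a morphism into \<open>a\<^sub>1\<close> over \<open>f'\<close>
    factors through the pullback \<open>m\<^sub>2\<close> of \<open>a\<^sub>1\<close>.\<close>
  then have "ext_mor C n m\<^sub>2 g (Ident C X'')"
    by (rule ext_mor_cancel_pullback [OF _ 2(3) _ 1(2) 2(1) n(1)]) (use f O in auto)
  then have "ext_mor C n a\<^sub>2 (g' \<cdot> g) (Ident C X'')"
    by (rule ext_mor_trans [OF _ 2(4)]) (use O in auto)
  then show ?thesis
    unfolding e(2) 1(5) 2(5) by (rule ext_map_class [OF e(1) n(1) 2(2) ne])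
qed

text \<open>The pullbacks along \<open>f\<close> and \<open>f'\<close> are two different extensions
  of \<open>X'\<close>. Once both are pushouts of one \<open>d\<close>, their sum is given by adding
  arrows out of the subobject of \<open>d\<close>.\<close>

lemma ext_map_Add_left:
  assumes f: "f \<in> Hom C X' X" "f' \<in> Hom C X' X" and g: "g \<in> Hom C Y Y'"
    and \<mu>: "\<mu> \<in> carrier (Ext_group C X Y)"
  shows "ext_map C (f \<boxplus> f') g \<mu> = baer_sum C X' Y' (ext_map C f g \<mu>) (ext_map C f' g \<mu>)"
proof -
  obtain e where e: "e \<in> extensions C X Y" "\<mu> = ext_class C e"
    using \<mu> by (rule Ext_carrierE)
  have f'': "f \<boxplus> f' \<in> Hom C X' X" using f by simp
  obtain m\<^sub>1 a\<^sub>1 where 1: "m\<^sub>1 \<in> extensions C X' Y" "a\<^sub>1 \<in> extensions C X' Y'"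
    "ext_mor C m\<^sub>1 e (Ident C Y) f" "ext_mor C m\<^sub>1 a\<^sub>1 g (Ident C X')"
    "ext_map C f g (ext_class C e) = ext_class C a\<^sub>1"
    by (rule ext_map_classE [OF e(1) f(1) g])
  obtain m\<^sub>2 a\<^sub>2 where 2: "m\<^sub>2 \<in> extensions C X' Y" "a\<^sub>2 \<in> extensions C X' Y'"
    "ext_mor C m\<^sub>2 e (Ident C Y) f'" "ext_mor C m\<^sub>2 a\<^sub>2 g (Ident C X')"
    "ext_map C f' g (ext_class C e) = ext_class C a\<^sub>2"
    by (rule ext_map_classE [OF e(1) f(2) g])
  obtain m\<^sub>3 a\<^sub>3 where 3: "m\<^sub>3 \<in> extensions C X' Y" "a\<^sub>3 \<in> extensions C X' Y'"
    "ext_mor C m\<^sub>3 e (Ident C Y) (f \<boxplus> f')" "ext_mor C m\<^sub>3 a\<^sub>3 g (Ident C X')"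
    "ext_map C (f \<boxplus> f') g (ext_class C e) = ext_class C a\<^sub>3"
    by (rule ext_map_classE [OF e(1) f'' g])
  obtain d Z g\<^sub>1 g\<^sub>2 where d: "d \<in> extensions C X' Z" "g\<^sub>1 \<in> Hom C Z Y" "g\<^sub>2 \<in> Hom C Z Y"
    "ext_mor C d m\<^sub>1 g\<^sub>1 (Ident C X')" "ext_mor C d m\<^sub>2 g\<^sub>2 (Ident C X')"
    by (rule ex_common_pushout [OF 1(1) 2(1)])
  note O = extensions_Obj [OF 1(1)] extensions_Obj [OF d(1)]
  text \<open>The arrows \<open>d \<rightarrow> m\<^sub>1 \<rightarrow> e\<close> and \<open>d \<rightarrow> m\<^sub>2 \<rightarrow> e\<close> add up to one over \<open>f \<boxplus> f'\<close>.\<close>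
  have "ext_mor C d e g\<^sub>1 f" "ext_mor C d e g\<^sub>2 f'"
    by (rule ext_mor_trans [OF d(4) 1(3)], use d f O in simp_all)
      (rule ext_mor_trans [OF d(5) 2(3)], use d f O in simp_all)
  then have "ext_mor C d e (g\<^sub>1 \<boxplus> g\<^sub>2) (f \<boxplus> f')" by (rule ext_mor_Add)
  then have "ext_mor C d m\<^sub>3 (g\<^sub>1 \<boxplus> g\<^sub>2) (Ident C X')"
    by (rule ext_mor_cancel_pullback [OF _ 3(3) _ e(1) 3(1) d(1)]) (use f O in auto)
  then have d3: "ext_mor C d a\<^sub>3 (g \<cdot> g\<^sub>1 \<boxplus> g \<cdot> g\<^sub>2) (Ident C X')"
    by (rule ext_mor_trans [OF _ 3(4)]) (use d g O in auto)
  have "ext_mor C d a\<^sub>1 (g \<cdot> g\<^sub>1) (Ident C X')" "ext_mor C d a\<^sub>2 (g \<cdot> g\<^sub>2) (Ident C X')"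
    by (rule ext_mor_trans [OF d(4) 1(4)], use O in simp_all)
      (rule ext_mor_trans [OF d(5) 2(4)], use O in simp_all)
  from baer_sum_class [OF d(1) 1(2) 2(2) 3(2) this d3] show ?thesis
    unfolding e(2) 1(5) 2(5) 3(5) by simp
qed

text \<open>A single pullback \<open>m\<close> serves as the common extension, since all three
  classes are pushouts of it.\<close>

lemma ext_map_Add_right:
  assumes f: "f \<in> Hom C X' X" and g: "g \<in> Hom C Y Y'" "g' \<in> Hom C Y Y'"
    and \<mu>: "\<mu> \<in> carrier (Ext_group C X Y)"
  shows "ext_map C f (g \<boxplus> g') \<mu> = baer_sum C X' Y' (ext_map C f g \<mu>) (ext_map C f g' \<mu>)"
proof -
  obtain e where e: "e \<in> extensions C X Y" "\<mu> = ext_class C e"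
    using \<mu> by (rule Ext_carrierE)
  have g'': "g \<boxplus> g' \<in> Hom C Y Y'" using g by simp
  obtain m where m: "m \<in> extensions C X' Y" "ext_mor C m e (Ident C Y) f"
    by (rule ex_ext_mor_pullback [OF e(1) f])
  obtain a\<^sub>1 where 1: "a\<^sub>1 \<in> extensions C X' Y'" "ext_mor C m a\<^sub>1 g (Ident C X')"
    by (rule ex_ext_mor_pushout [OF m(1) g(1)])
  obtain a\<^sub>2 where 2: "a\<^sub>2 \<in> extensions C X' Y'" "ext_mor C m a\<^sub>2 g' (Ident C X')"
    by (rule ex_ext_mor_pushout [OF m(1) g(2)])
  obtain a\<^sub>3 where 3: "a\<^sub>3 \<in> extensions C X' Y'" "ext_mor C m a\<^sub>3 (g \<boxplus> g') (Ident C X')"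
    by (rule ex_ext_mor_pushout [OF m(1) g''])
  show ?thesis
    unfolding e(2) ext_map_class [OF e(1) m(1) 1(1) m(2) 1(2)]
      ext_map_class [OF e(1) m(1) 2(1) m(2) 2(2)] ext_map_class [OF e(1) m(1) 3(1) m(2) 3(2)]
    using baer_sum_class [OF m(1) 1(1) 2(1) 3(1) 1(2) 2(2) 3(2)] by simp
qed

text \<open>A morphism \<open>e \<rightarrow> e'\<close> passes through the pushout \<open>a\<close>
  of \<open>e\<close> and the pullback \<open>b\<close> of \<open>e'\<close>, leaving an equivalence
  \<open>a \<rightarrow> b\<close>; conversely, such an equivalence composes to a morphism
  \<open>e \<rightarrow> e'\<close>.\<close>

lemma ext_mor_iff:
  assumes e: "e \<in> extensions C X Y" and e': "e' \<in> extensions C X' Y'"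
    and g: "g \<in> Hom C Y Y'" and f: "f \<in> Hom C X X'"
  shows "ext_map C (Ident C X) g (ext_class C e) = ext_map C f (Ident C Y') (ext_class C e') \<longleftrightarrow>
    ext_mor C e e' g f"
proof -
  note O = extensions_Obj [OF e] extensions_Obj [OF e']
  obtain a where a: "a \<in> extensions C X Y'" "ext_mor C e a g (Ident C X)"
    by (rule ex_ext_mor_pushout [OF e g])
  obtain b where b: "b \<in> extensions C X Y'" "ext_mor C b e' (Ident C Y') f"
    by (rule ex_ext_mor_pullback [OF e' f])
  have "ext_map C (Ident C X) g (ext_class C e) = ext_class C a"
    by (rule ext_map_class [OF e e a(1) ext_mor_refl [OF e] a(2)])
  moreover have "ext_map C f (Ident C Y') (ext_class C e') = ext_class C b"
    by (rule ext_map_class [OF e' b(1,1) b(2) ext_mor_refl [OF b(1)]])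
  moreover have "ext_mor C a b (Ident C Y') (Ident C X) \<longleftrightarrow> ext_mor C e e' g f"
  proof
    assume *: "ext_mor C a b (Ident C Y') (Ident C X)"
    have "ext_mor C a e' (Ident C Y') f"
      by (rule ext_mor_trans [OF * b(2)]) (use f O in auto)
    then show "ext_mor C e e' g f"
      by (rule ext_mor_trans [OF a(2)]) (use g f in auto)
  next
    assume "ext_mor C e e' g f"
    then have "ext_mor C e b g (Ident C X)"
      by (rule ext_mor_cancel_pullback [OF _ b(2) _ e' b(1) e]) (use f O in auto)
    then show "ext_mor C a b (Ident C Y') (Ident C X)"
      by (rule ext_mor_cancel_pushout [OF _ a(2) _ e a(1) b(1)]) (use g O in auto)
  qed
  ultimately show ?thesis using ext_class_eq_iff [OF a(1) b(1)] by simp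
qed

end

section \<open>Full subcategories\<close>

lemma full_subcategory_simps [simp]:
  "Obj (full_subcategory C S) = S"
  "Dom (full_subcategory C S) = Dom C" "Cod (full_subcategory C S) = Cod C"
  "Ident (full_subcategory C S) = Ident C" "Add (full_subcategory C S) = Add C"
  "Comp (full_subcategory C S) = Comp C" "Zero (full_subcategory C S) = Zero C"
  "Arr (full_subcategory C S) = {f \<in> Arr C. Dom C f \<in> S \<and> Cod C f \<in> S}"
  by (simp_all add: full_subcategory_def)

lemma Hom_full_subcategory:
  "\<lbrakk>X \<in> S; Y \<in> S\<rbrakk> \<Longrightarrow> Hom (full_subcategory C S) X Y = Hom C X Y"
  by (auto simp: Hom_def)

lemma preadditive_full_subcategory:
  assumes "preadditive_category C" "S \<subseteq> Obj C"
  shows "preadditive_category (full_subcategory C S)"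
proof -
  interpret preadditive_category C by fact
  have *: "Hom_group (full_subcategory C S) X Y = Hom_group C X Y" if "X \<in> S" "Y \<in> S" for X Y
    using that by (simp add: Hom_group_def Hom_full_subcategory)
  show ?thesis
    by (intro preadditive_category.intro category.intro preadditive_category_axioms.intro)
      (use assms(2) in \<open>auto simp: * intro!: Hom_comm_group\<close>)
qed

lemma Ext_bifunctor_simps [simp]:
  "Val (Ext_bifunctor C) = Ext_group C" "Act (Ext_bifunctor C) = ext_map C"
  by (simp_all add: Ext_bifunctor_def)

lemma (in abelian_category) Ext_bifunctor_full_subcategory:
  assumes "additive_category (full_subcategory C S)" "additive_category (full_subcategory C S')"
    and "S \<subseteq> Obj C" "S' \<subseteq> Obj C"
  shows "biadditive_bifunctor (full_subcategory C S) (full_subcategory C S') (Ext_bifunctor C)"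
proof -
  have H: "f \<in> Hom C X Y" if "f \<in> Hom (full_subcategory C T) X Y" for f X Y T
    using that by simp
  show ?thesis
  proof (intro biadditive_bifunctor.intro biadditive_bifunctor_axioms.intro assms(1,2),
      unfold Ext_bifunctor_simps full_subcategory_simps, goal_cases)
    case 1
    then show ?case using assms(3,4) by (auto intro: comm_group_Ext_group)
  next
    case (2 f X' X g Y Y')
    then show ?case
      using ext_map_in_Ext_group [of f X' X g Y Y'] ext_map_baer_sum [of f X' X g Y Y']
      by (auto simp: hom_def Ext_mult)
  next
    case 3
    then show ?case by (intro ext_map_Ident)
  next
    case 4
    then show ?case by (rule ext_map_Comp [OF H H H H])
  next
    case 5
    then show ?case unfolding Ext_mult by (rule ext_map_Add_left [OF H H H])
  next
    case 6
    then show ?case unfolding Ext_mult by (rule ext_map_Add_right [OF H H H])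
  qed
qed

section \<open>Torsion pairs\<close>

text \<open>Reversing the torsion sequences exchanges the two classes, so that facts about torsion
  objects are facts about torsion-free objects of the opposite category.\<close>

lemma torsion_pair_opposite:
  assumes "torsion_pair C \<T> \<F>"
  shows "torsion_pair (opposite C) \<F> \<T>"
  unfolding torsion_pair_def
proof (intro conjI ballI)
  fix E assume "E \<in> Obj (opposite C)"
  then obtain i p where "short_exact C i p" "Cod C i = E" "Dom C i \<in> \<T>" "Cod C p \<in> \<F>"
    using assms by (auto simp: torsion_pair_def)
  then show "\<exists>i p. short_exact (opposite C) i p \<and> Cod (opposite C) i = E \<and>
      Dom (opposite C) i \<in> \<F> \<and> Cod (opposite C) p \<in> \<T>"
    using short_exactD(3) by (intro exI [of _ p] exI [of _ i]) auto
qed (use assms in \<open>auto simp: torsion_pair_def Hom_opposite simp del: in_Hom\<close>)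

text \<open>A single equation between arrows passes to full subcategories and is reflected by
  faithful functors, unlike the quantified universal property.\<close>

lemma (in preadditive_category) is_zero_objectI:
  assumes "Z \<in> Obj C" "Ident C Z = Zero C Z Z"
  shows "is_zero_object C Z"
proof -
  have "f = Zero C X Z" if "f \<in> Hom C X Z" for f X
    using that assms Comp_Ident(2) [of f Z] Comp_Zero(1) [of f Z Z] by simp
  moreover have "f = Zero C Z X" if "f \<in> Hom C Z X" for f X
    using that assms Comp_Ident(1) [of f Z] Comp_Zero(2) [of f Z Z] by simp
  moreover have "Zero C X Y \<in> Hom C X Y" if "X \<in> Obj C" "Y \<in> Obj C" for X Y
    using that by simp
  ultimately have "\<exists>!f. f \<in> Hom C X Z" "\<exists>!f. f \<in> Hom C Z X" if "X \<in> Obj C" for X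
    using that assms(1) by blast+
  then show ?thesis
    using assms(1) unfolding is_zero_object_def by blast
qed

text \<open>A set of objects of \<open>C\<close>, or the image of a functor, may contain a biproduct
  only up to isomorphism; the structure arrows are conjugated accordingly.\<close>

lemma (in preadditive_category) is_biproduct_iso:
  assumes "is_biproduct C X Y (B, j\<^sub>1, j\<^sub>2, q\<^sub>1, q\<^sub>2)" "u \<in> Hom C B B'" "v \<in> Hom C B' B"
    "v \<cdot> u = Ident C B" "u \<cdot> v = Ident C B'"
  shows "is_biproduct C X Y (B', u \<cdot> j\<^sub>1, u \<cdot> j\<^sub>2, q\<^sub>1 \<cdot> v, q\<^sub>2 \<cdot> v)"
proof -
  note D = is_biproductD [OF assms(1)]
  have "u \<cdot> (j\<^sub>1 \<cdot> (q\<^sub>1 \<cdot> v)) \<boxplus> u \<cdot> (j\<^sub>2 \<cdot> (q\<^sub>2 \<cdot> v)) = u \<cdot> ((j\<^sub>1 \<cdot> q\<^sub>1 \<boxplus> j\<^sub>2 \<cdot> q\<^sub>2) \<cdot> v)"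
    using D(1-12) assms(2,3) by simp
  also have "\<dots> = Ident C B'" using D assms by simp
  finally show ?thesis
    unfolding is_biproduct_def using D assms by (auto simp: Comp_rewrite [OF assms(4)])
qed

text \<open>The torsion part of the biproduct maps by zero to both torsion-free summands, so its
  inclusion is zero and \<open>p\<close> is an isomorphism. The biproduct is then moved to
  \<open>Cod C p\<close>, since \<open>B\<close> itself need not belong to
  \<open>\<F>\<close>.\<close>

lemma torsion_free_biproduct:
  fixes C :: "('o, 'm, 'z) preadditive_scheme" (structure)
  assumes "abelian_category C" "torsion_pair C \<T> \<F>" "X \<in> \<F>" "Y \<in> \<F>"
  shows "\<exists>B\<in>\<F>. \<exists>j\<^sub>1 j\<^sub>2 q\<^sub>1 q\<^sub>2. is_biproduct C X Y (B, j\<^sub>1, j\<^sub>2, q\<^sub>1, q\<^sub>2)"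
proof -
  interpret abelian_category C by fact
  have "X \<in> Obj C" "Y \<in> Obj C" using assms by (auto simp: torsion_pair_def)
  then obtain B j\<^sub>1 j\<^sub>2 q\<^sub>1 q\<^sub>2 where b: "is_biproduct C X Y (B, j\<^sub>1, j\<^sub>2, q\<^sub>1, q\<^sub>2)"
    by (rule is_biproduct_biproduct)
  note D = is_biproductD [OF b]
  obtain i p where e: "short_exact C i p" and ip: "Cod C i = B" "Dom C i \<in> \<T>" "Cod C p \<in> \<F>"
    using assms(2) D(20) unfolding torsion_pair_def by blast
  note E = short_exactD [OF e]
  have "q\<^sub>1 \<cdot> i \<in> Hom C (Dom C i) X" "q\<^sub>2 \<cdot> i \<in> Hom C (Dom C i) Y"
    using D E ip by auto
  then have "q\<^sub>1 \<cdot> i = Zero C (Dom C i) X" "q\<^sub>2 \<cdot> i = Zero C (Dom C i) Y"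
    using assms(2-4) ip(2) unfolding torsion_pair_def by blast+
  then have i0: "i = Zero C (Dom C i) B"
    by - (rule biproduct_joint_mono [OF b]; use D E ip in auto)
  have "is_mono C p"
  proof (rule is_monoI)
    fix u assume u: "u \<in> Arr C" "Cod C u = Dom C p" "p \<cdot> u = Zero C (Dom C u) (Cod C p)"
    then obtain w where w: "w \<in> Arr C" "Dom C w = Dom C u" "Cod C w = Dom C i" "i \<cdot> w = u"
      using is_kernel_lift [of C p i u] e unfolding short_exact_def by auto
    have "Zero C (Dom C i) B \<cdot> w = u" using w(4) i0 by simp
    then show "u = Zero C (Dom C u) (Dom C p)" using w D E ip by auto
  qed (use E in auto)
  then have "is_iso C p" using short_exact_epi [OF e] by (rule mono_epi_imp_iso)
  then obtain v where "v \<in> Hom C (Cod C p) B" "v \<cdot> p = Ident C B" "p \<cdot> v = Ident C (Cod C p)"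
    by (rule is_isoE [of _ B "Cod C p"]) (use E ip in auto)
  then have "is_biproduct C X Y (Cod C p, p \<cdot> j\<^sub>1, p \<cdot> j\<^sub>2, q\<^sub>1 \<cdot> v, q\<^sub>2 \<cdot> v)"
    using is_biproduct_iso [OF b, of p "Cod C p" v] E ip by auto
  with ip show ?thesis by blast
qed

text \<open>The torsion-free quotient of a zero object is zero: the epi onto it is a zero arrow,
  which makes the identity of its target zero.\<close>

lemma torsion_free_zero_object:
  fixes C :: "('o, 'm, 'z) preadditive_scheme" (structure)
  assumes "abelian_category C" "torsion_pair C \<T> \<F>"
  shows "\<exists>Z\<in>\<F>. Ident C Z = Zero C Z Z"
proof -
  interpret abelian_category C by fact
  obtain Z where Z: "is_zero_object C Z" using ex_zero_object by blast
  then obtain i p where e: "short_exact C i p" and ip: "Cod C i = Z" "Cod C p \<in> \<F>"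
    using assms(2) unfolding torsion_pair_def is_zero_object_def by blast
  note E = short_exactD [OF e]
  have "p \<in> Hom C Z (Cod C p)" "Zero C Z (Cod C p) \<in> Hom C Z (Cod C p)"
    using E ip Z by (auto simp: is_zero_object_def)
  moreover have "\<exists>!f. f \<in> Hom C Z (Cod C p)"
    using Z Cod_Obj [OF E(2)] unfolding is_zero_object_def by blast
  ultimately have "p = Zero C Z (Cod C p)" by blast
  then have "Ident C (Cod C p) \<cdot> p = Zero C (Cod C p) (Cod C p) \<cdot> p"
    using E ip by simp
  then have "Ident C (Cod C p) = Zero C (Cod C p) (Cod C p)"
    by (rule is_epiD [OF short_exact_epi [OF e], rotated -1]) (use E in auto)
  then show ?thesis using ip by blast
qed

lemma additive_full_subcategory:
  assumes "preadditive_category C" "S \<subseteq> Obj C" "\<exists>Z\<in>S. Ident C Z = Zero C Z Z"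
    and "\<And>X Y. \<lbrakk>X \<in> S; Y \<in> S\<rbrakk> \<Longrightarrow> \<exists>B\<in>S. \<exists>j\<^sub>1 j\<^sub>2 q\<^sub>1 q\<^sub>2. is_biproduct C X Y (B, j\<^sub>1, j\<^sub>2, q\<^sub>1, q\<^sub>2)"
  shows "additive_category (full_subcategory C S)"
proof -
  interpret S: preadditive_category "full_subcategory C S"
    using assms(1,2) by (rule preadditive_full_subcategory)
  show ?thesis
  proof (intro additive_category.intro S.preadditive_category_axioms additive_category_axioms.intro)
    show "\<exists>Z. is_zero_object (full_subcategory C S) Z"
      using assms(3) S.is_zero_objectI by auto
    fix X Y assume *: "X \<in> Obj (full_subcategory C S)" "Y \<in> Obj (full_subcategory C S)"
    then obtain B j\<^sub>1 j\<^sub>2 q\<^sub>1 q\<^sub>2 where "B \<in> S" "is_biproduct C X Y (B, j\<^sub>1, j\<^sub>2, q\<^sub>1, q\<^sub>2)"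
      using assms(4) by fastforce
    then have "is_biproduct (full_subcategory C S) X Y (B, j\<^sub>1, j\<^sub>2, q\<^sub>1, q\<^sub>2)"
      using * assms(2) by (auto simp: is_biproduct_def)
    then show "\<exists>b. is_biproduct (full_subcategory C S) X Y b" by blast
  qed
qed

lemma torsion_pair_additive:
  assumes C: "abelian_category C" and t: "torsion_pair C \<T> \<F>"
  shows "additive_category (full_subcategory C \<F>)" "additive_category (full_subcategory C \<T>)"
proof -
  interpret abelian_category C by fact
  have sub: "\<F> \<subseteq> Obj C" "\<T> \<subseteq> Obj C" using t by (auto simp: torsion_pair_def)
  note op = abelian_category_opposite [OF C] torsion_pair_opposite [OF t]
  show "additive_category (full_subcategory C \<F>)"
    using torsion_free_zero_object [OF C t] torsion_free_biproduct [OF C t] sub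
    by (intro additive_full_subcategory preadditive_category_axioms) auto
  show "additive_category (full_subcategory C \<T>)"
  proof (intro additive_full_subcategory preadditive_category_axioms sub)
    show "\<exists>Z\<in>\<T>. Ident C Z = Zero C Z Z"
      using torsion_free_zero_object [OF op] by simp
    show "\<exists>B\<in>\<T>. \<exists>j\<^sub>1 j\<^sub>2 q\<^sub>1 q\<^sub>2. is_biproduct C X Y (B, j\<^sub>1, j\<^sub>2, q\<^sub>1, q\<^sub>2)"
      if "X \<in> \<T>" "Y \<in> \<T>" for X Y
      using torsion_free_biproduct [OF op that]
      unfolding is_biproduct_opposite [OF preadditive_category_axioms] by blast
  qed
qed

section \<open>Glued categories\<close>

context biadditive_bifunctor
begin

lemma glued_simps [simp]:
  "Dom (glued F T M) (A, f, g, B) = A" "Cod (glued F T M) (A, f, g, B) = B"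
  "Ident (glued F T M) (X, Y, \<mu>) = ((X, Y, \<mu>), Ident F X, Ident T Y, (X, Y, \<mu>))"
  "(A', f', g', B') \<cdot>\<^bsub>glued F T M\<^esub> (A, f, g, B) = (A, f' \<cdot>\<^bsub>F\<^esub> f, g' \<cdot>\<^bsub>T\<^esub> g, B')"
  "(A, f, g, B) \<boxplus>\<^bsub>glued F T M\<^esub> (A', f', g', B') = (A, f \<boxplus>\<^bsub>F\<^esub> f', g \<boxplus>\<^bsub>T\<^esub> g', B)"
  "Zero (glued F T M) (X, Y, \<mu>) (X', Y', \<mu>') =
    ((X, Y, \<mu>), Zero F X X', Zero T Y Y', (X', Y', \<mu>'))"
  by (simp_all add: glued_def Let_def)

lemma Obj_glued [simp]:
  "(X, Y, \<mu>) \<in> Obj (glued F T M) \<longleftrightarrow> X \<in> Obj F \<and> Y \<in> Obj T \<and> \<mu> \<in> carrier (Val M X Y)"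
  by (simp add: glued_def Let_def)

text \<open>The gluing condition, separated from the membership of the end points, which stay
  unsplit; arrows can then be handled as tuples \<open>(A, f, g, B)\<close>.\<close>

definition compatible :: "'o\<^sub>1 \<times> 'o\<^sub>2 \<times> 'e \<Rightarrow> 'm\<^sub>1 \<Rightarrow> 'm\<^sub>2 \<Rightarrow> 'o\<^sub>1 \<times> 'o\<^sub>2 \<times> 'e \<Rightarrow> bool" where
  "compatible = (\<lambda>(X, Y, \<mu>) f g (X', Y', \<mu>').
     f \<in> Hom F X X' \<and> g \<in> Hom T Y Y' \<and> Act M (Ident F X) g \<mu> = Act M f (Ident T Y') \<mu>')"

lemma Arr_glued [simp]:
  "(A, f, g, B) \<in> Arr (glued F T M) \<longleftrightarrow>
    A \<in> Obj (glued F T M) \<and> B \<in> Obj (glued F T M) \<and> compatible A f g B"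
  by (auto simp: glued_def Let_def compatible_def)

lemma Hom_glued:
  "a \<in> Hom (glued F T M) A B \<longleftrightarrow>
    A \<in> Obj (glued F T M) \<and> B \<in> Obj (glued F T M) \<and> (\<exists>f g. compatible A f g B \<and> a = (A, f, g, B))"
  by (cases a) (auto simp del: Obj_glued)

lemma Act_closed:
  "\<lbrakk>f \<in> Hom F X' X; g \<in> Hom T Y Y'; \<mu> \<in> carrier (Val M X Y)\<rbrakk> \<Longrightarrow>
    Act M f g \<mu> \<in> carrier (Val M X' Y')"
  using Act_hom [of f X' X g Y Y'] by (auto simp: hom_def)

lemma Act_Zero:
  assumes "X \<in> Obj F" "X' \<in> Obj F" "Y \<in> Obj T" "Y' \<in> Obj T" "\<mu> \<in> carrier (Val M X Y)"
  shows "g \<in> Hom T Y Y' \<Longrightarrow> Act M (Zero F X' X) g \<mu> = \<one>\<^bsub>Val M X' Y'\<^esub>"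
    and "f \<in> Hom F X' X \<Longrightarrow> Act M f (Zero T Y Y') \<mu> = \<one>\<^bsub>Val M X' Y'\<^esub>"
proof -
  interpret V: comm_group "Val M X' Y'" using assms by (intro Val_comm_group)
  have 0: "Zero F X' X \<in> Hom F X' X" "Zero T Y Y' \<in> Hom T Y Y'" using assms by auto
  show "Act M (Zero F X' X) g \<mu> = \<one>\<^bsub>Val M X' Y'\<^esub>" if g: "g \<in> Hom T Y Y'"
    using Act_Add_left [OF 0(1,1) g assms(5)] Act_closed [OF 0(1) g assms(5)] 0
      V.r_cancel_one' by simp
  show "Act M f (Zero T Y Y') \<mu> = \<one>\<^bsub>Val M X' Y'\<^esub>" if f: "f \<in> Hom F X' X"
    using Act_Add_right [OF f 0(2,2) assms(5)] Act_closed [OF f 0(2) assms(5)] 0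
      V.r_cancel_one' by simp
qed

lemma Act_Neg:
  assumes f: "f \<in> Hom F X' X" and g: "g \<in> Hom T Y Y'" and \<mu>: "\<mu> \<in> carrier (Val M X Y)"
  shows "Act M (Neg F f) g \<mu> = inv\<^bsub>Val M X' Y'\<^esub> Act M f g \<mu>"
    and "Act M f (Neg T g) \<mu> = inv\<^bsub>Val M X' Y'\<^esub> Act M f g \<mu>"
proof -
  have O: "X \<in> Obj F" "X' \<in> Obj F" "Y \<in> Obj T" "Y' \<in> Obj T" using f g by auto
  interpret V: comm_group "Val M X' Y'" using O by (intro Val_comm_group)
  have n: "Neg F f \<in> Hom F X' X" "Neg T g \<in> Hom T Y Y'" using f g by auto
  have "Act M (Neg F f) g \<mu> \<otimes>\<^bsub>Val M X' Y'\<^esub> Act M f g \<mu> = \<one>\<^bsub>Val M X' Y'\<^esub>"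
    using Act_Add_left [OF n(1) f g \<mu>] Act_Zero(1) [OF O \<mu> g] f by simp
  then show "Act M (Neg F f) g \<mu> = inv\<^bsub>Val M X' Y'\<^esub> Act M f g \<mu>"
    using Act_closed f g n \<mu> by (intro V.inv_equality [symmetric]) metis+
  have "Act M f (Neg T g) \<mu> \<otimes>\<^bsub>Val M X' Y'\<^esub> Act M f g \<mu> = \<one>\<^bsub>Val M X' Y'\<^esub>"
    using Act_Add_right [OF f n(2) g \<mu>] Act_Zero(2) [OF O \<mu> f] g by simp
  then show "Act M f (Neg T g) \<mu> = inv\<^bsub>Val M X' Y'\<^esub> Act M f g \<mu>"
    using Act_closed f g n \<mu> by (intro V.inv_equality [symmetric]) metis+
qed

lemma compatible_Ident:
  assumes "(X, Y, \<mu>) \<in> Obj (glued F T M)"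
  shows "compatible (X, Y, \<mu>) (Ident F X) (Ident T Y) (X, Y, \<mu>)"
  using assms by (simp add: compatible_def)

text \<open>Both sides equal \<open>Act M f g' \<mu>'\<close>: the first condition turns
  \<open>g\<close> into \<open>f\<close>, bifunctoriality lets \<open>g'\<close> and
  \<open>f\<close> act in either order, and the second condition turns \<open>g'\<close> into
  \<open>f'\<close>.\<close>

lemma compatible_Comp:
  assumes "A \<in> Obj (glued F T M)" "B \<in> Obj (glued F T M)" "D \<in> Obj (glued F T M)"
    and "compatible A f g B" "compatible B f' g' D"
  shows "compatible A (f' \<cdot>\<^bsub>F\<^esub> f) (g' \<cdot>\<^bsub>T\<^esub> g) D"
proof -
  obtain X Y \<mu> where A: "A = (X, Y, \<mu>)" by (rule prod_cases3)
  obtain X' Y' \<mu>' where B: "B = (X', Y', \<mu>')" by (rule prod_cases3)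
  obtain X'' Y'' \<mu>'' where D: "D = (X'', Y'', \<mu>'')" by (rule prod_cases3)
  have O: "X \<in> Obj F" "Y \<in> Obj T" "\<mu> \<in> carrier (Val M X Y)" "X' \<in> Obj F" "Y' \<in> Obj T"
    "\<mu>' \<in> carrier (Val M X' Y')" "X'' \<in> Obj F" "Y'' \<in> Obj T" "\<mu>'' \<in> carrier (Val M X'' Y'')"
    using assms by (auto simp: A B D)
  have h: "f \<in> Hom F X X'" "g \<in> Hom T Y Y'" "Act M (Ident F X) g \<mu> = Act M f (Ident T Y') \<mu>'"
    "f' \<in> Hom F X' X''" "g' \<in> Hom T Y' Y''" "Act M (Ident F X') g' \<mu>' = Act M f' (Ident T Y'') \<mu>''"
    using assms(4,5) by (auto simp: compatible_def A B D)
  have id: "Ident F X \<in> Hom F X X" "Ident F X' \<in> Hom F X' X'" "Ident T Y' \<in> Hom T Y' Y'"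
    "Ident T Y'' \<in> Hom T Y'' Y''" using O by auto
  have "Act M (Ident F X) (g' \<cdot>\<^bsub>T\<^esub> g) \<mu> = Act M (Ident F X) g' (Act M (Ident F X) g \<mu>)"
    using Act_Comp [OF id(1,1) h(2,5) O(3)] O by simp
  also have "\<dots> = Act M f g' \<mu>'"
    unfolding h(3) using Act_Comp [OF h(1) id(1,3) h(5) O(6)] h O by simp
  also have "\<dots> = Act M f (Ident T Y'') (Act M (Ident F X') g' \<mu>')"
    using Act_Comp [OF id(2) h(1,5) id(4) O(6)] h O by simp
  also have "\<dots> = Act M (f' \<cdot>\<^bsub>F\<^esub> f) (Ident T Y'') \<mu>''"
    unfolding h(6) using Act_Comp [OF h(4,1) id(4,4) O(9)] O by simp
  finally show ?thesis using h by (simp add: compatible_def A D)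
qed

lemma compatible_Add:
  assumes "A \<in> Obj (glued F T M)" "B \<in> Obj (glued F T M)"
    and "compatible A f g B" "compatible A f' g' B"
  shows "compatible A (f \<boxplus>\<^bsub>F\<^esub> f') (g \<boxplus>\<^bsub>T\<^esub> g') B"
proof -
  obtain X Y \<mu> where A: "A = (X, Y, \<mu>)" by (rule prod_cases3)
  obtain X' Y' \<mu>' where B: "B = (X', Y', \<mu>')" by (rule prod_cases3)
  have O: "X \<in> Obj F" "Y \<in> Obj T" "\<mu> \<in> carrier (Val M X Y)" "X' \<in> Obj F" "Y' \<in> Obj T"
    "\<mu>' \<in> carrier (Val M X' Y')"
    using assms by (auto simp: A B)
  have h: "f \<in> Hom F X X'" "g \<in> Hom T Y Y'" "Act M (Ident F X) g \<mu> = Act M f (Ident T Y') \<mu>'"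
    "f' \<in> Hom F X X'" "g' \<in> Hom T Y Y'" "Act M (Ident F X) g' \<mu> = Act M f' (Ident T Y') \<mu>'"
    using assms(3,4) by (auto simp: compatible_def A B)
  have id: "Ident F X \<in> Hom F X X" "Ident T Y' \<in> Hom T Y' Y'" using O by auto
  show ?thesis
    using Act_Add_right [OF id(1) h(2,5) O(3)] Act_Add_left [OF h(1,4) id(2) O(6)] h
    by (simp add: compatible_def A B)
qed

lemma compatible_Zero:
  assumes "(X, Y, \<mu>) \<in> Obj (glued F T M)" "(X', Y', \<mu>') \<in> Obj (glued F T M)"
  shows "compatible (X, Y, \<mu>) (Zero F X X') (Zero T Y Y') (X', Y', \<mu>')"
  using assms Act_Zero(1) [of X' X Y' Y' \<mu>' "Ident T Y'"] Act_Zero(2) [of X X Y Y' \<mu> "Ident F X"]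
  by (simp add: compatible_def)

lemma compatible_Neg:
  assumes "(X, Y, \<mu>) \<in> Obj (glued F T M)" "(X', Y', \<mu>') \<in> Obj (glued F T M)"
    "compatible (X, Y, \<mu>) f g (X', Y', \<mu>')"
  shows "compatible (X, Y, \<mu>) (Neg F f) (Neg T g) (X', Y', \<mu>')"
  using assms Act_Neg(1) [of f X X' "Ident T Y'" Y' Y' \<mu>'] Act_Neg(2) [of "Ident F X" X X g Y Y' \<mu>]
  by (simp add: compatible_def)

lemma compatible_Hom:
  assumes "compatible A f g B"
  shows "f \<in> Arr F" "Dom F f = fst A" "Cod F f = fst B"
    "g \<in> Arr T" "Dom T g = fst (snd A)" "Cod T g = fst (snd B)"
  using assms by (auto simp: compatible_def split: prod.splits)

lemma category_glued: "category (glued F T M)"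
proof (intro category.intro, unfold Hom_glued)
  show "Dom (glued F T M) a \<in> Obj (glued F T M)" "Cod (glued F T M) a \<in> Obj (glued F T M)"
    if "a \<in> Arr (glued F T M)" for a
    using that by (cases a, simp del: Obj_glued)+
next
  fix A assume A: "A \<in> Obj (glued F T M)"
  obtain X Y \<mu> where "A = (X, Y, \<mu>)" by (rule prod_cases3)
  with A show "A \<in> Obj (glued F T M) \<and> A \<in> Obj (glued F T M) \<and>
      (\<exists>f g. compatible A f g A \<and> Ident (glued F T M) A = (A, f, g, A))"
    using compatible_Ident by auto
next
  fix a b A B D
  assume "A \<in> Obj (glued F T M) \<and> B \<in> Obj (glued F T M) \<and> (\<exists>f g. compatible A f g B \<and> a = (A, f, g, B))"
    "B \<in> Obj (glued F T M) \<and> D \<in> Obj (glued F T M) \<and> (\<exists>f g. compatible B f g D \<and> b = (B, f, g, D))"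
  then show "A \<in> Obj (glued F T M) \<and> D \<in> Obj (glued F T M) \<and>
      (\<exists>f g. compatible A f g D \<and> b \<cdot>\<^bsub>glued F T M\<^esub> a = (A, f, g, D))"
    using compatible_Comp [of A B D] by (elim conjE exE) (simp del: Obj_glued)
next
  fix a b c A B D E
  assume "A \<in> Obj (glued F T M) \<and> B \<in> Obj (glued F T M) \<and> (\<exists>f g. compatible A f g B \<and> a = (A, f, g, B))"
    "B \<in> Obj (glued F T M) \<and> D \<in> Obj (glued F T M) \<and> (\<exists>f g. compatible B f g D \<and> b = (B, f, g, D))"
    "D \<in> Obj (glued F T M) \<and> E \<in> Obj (glued F T M) \<and> (\<exists>f g. compatible D f g E \<and> c = (D, f, g, E))"
  then show "(c \<cdot>\<^bsub>glued F T M\<^esub> b) \<cdot>\<^bsub>glued F T M\<^esub> a = c \<cdot>\<^bsub>glued F T M\<^esub> b \<cdot>\<^bsub>glued F T M\<^esub> a"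
    by (elim conjE exE) (simp del: Obj_glued add: compatible_Hom)
next
  fix a A B
  assume a: "A \<in> Obj (glued F T M) \<and> B \<in> Obj (glued F T M) \<and> (\<exists>f g. compatible A f g B \<and> a = (A, f, g, B))"
  obtain X Y \<mu> where A: "A = (X, Y, \<mu>)" by (rule prod_cases3)
  obtain X' Y' \<mu>' where B: "B = (X', Y', \<mu>')" by (rule prod_cases3)
  show "a \<cdot>\<^bsub>glued F T M\<^esub> Ident (glued F T M) A = a" "Ident (glued F T M) B \<cdot>\<^bsub>glued F T M\<^esub> a = a"
    using a unfolding A B by (elim conjE exE, simp add: compatible_Hom)+
qed

lemma comm_group_Hom_glued:
  assumes O: "A \<in> Obj (glued F T M)" "B \<in> Obj (glued F T M)"
  shows "comm_group (Hom_group (glued F T M) A B)"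
proof -
  obtain X Y \<mu> where A: "A = (X, Y, \<mu>)" by (rule prod_cases3)
  obtain X' Y' \<mu>' where B: "B = (X', Y', \<mu>')" by (rule prod_cases3)
  let ?G = "Hom_group (glued F T M) A B"
  have G: "a \<in> carrier ?G \<longleftrightarrow> (\<exists>f g. compatible A f g B \<and> a = (A, f, g, B))"
    "a \<otimes>\<^bsub>?G\<^esub> b = a \<boxplus>\<^bsub>glued F T M\<^esub> b" "\<one>\<^bsub>?G\<^esub> = (A, Zero F X X', Zero T Y Y', B)" for a b
    using O Hom_glued [of a A B] by (simp_all add: Hom_group_def A B)
  note typed = compatible_Hom [of A _ _ B]
  show ?thesis
  proof (rule comm_groupI)
    show "a \<otimes>\<^bsub>?G\<^esub> b \<in> carrier ?G" if "a \<in> carrier ?G" "b \<in> carrier ?G" for a b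
      using that compatible_Add [OF O] unfolding G by auto
    show "\<one>\<^bsub>?G\<^esub> \<in> carrier ?G"
      unfolding G(1,3) using compatible_Zero O unfolding A B by blast
    show "a \<otimes>\<^bsub>?G\<^esub> b \<otimes>\<^bsub>?G\<^esub> c = a \<otimes>\<^bsub>?G\<^esub> (b \<otimes>\<^bsub>?G\<^esub> c)"
      if "a \<in> carrier ?G" "b \<in> carrier ?G" "c \<in> carrier ?G" for a b c
      using that unfolding G by (elim exE conjE) (simp add: typed F.Add_assoc T.Add_assoc)
    show "a \<otimes>\<^bsub>?G\<^esub> b = b \<otimes>\<^bsub>?G\<^esub> a" if "a \<in> carrier ?G" "b \<in> carrier ?G" for a b
      using that unfolding G
      by (elim exE conjE) (simp, intro conjI F.Add_commute T.Add_commute; simp add: typed)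
    show "\<one>\<^bsub>?G\<^esub> \<otimes>\<^bsub>?G\<^esub> a = a" if "a \<in> carrier ?G" for a
      using that unfolding G by (elim exE conjE) (simp add: typed A B)
    show "\<exists>b\<in>carrier ?G. b \<otimes>\<^bsub>?G\<^esub> a = \<one>\<^bsub>?G\<^esub>" if a0: "a \<in> carrier ?G" for a
    proof -
      obtain f g where a: "compatible A f g B" "a = (A, f, g, B)" using a0 unfolding G(1) by blast
      have "compatible A (Neg F f) (Neg T g) B"
        using compatible_Neg O a(1) unfolding A B by blast
      then have "(A, Neg F f, Neg T g, B) \<in> carrier ?G" unfolding G(1) by blast
      moreover have "(A, Neg F f, Neg T g, B) \<otimes>\<^bsub>?G\<^esub> a = \<one>\<^bsub>?G\<^esub>"
        unfolding G a(2) using typed [OF a(1)] by (simp add: A B)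
      ultimately show ?thesis by blast
    qed
  qed
qed

lemma preadditive_glued: "preadditive_category (glued F T M)"
proof (intro preadditive_category.intro preadditive_category_axioms.intro category_glued
    comm_group_Hom_glued, unfold Hom_glued)
  fix a b b' A B D
  assume "A \<in> Obj (glued F T M) \<and> B \<in> Obj (glued F T M) \<and> (\<exists>f g. compatible A f g B \<and> a = (A, f, g, B))"
    "B \<in> Obj (glued F T M) \<and> D \<in> Obj (glued F T M) \<and> (\<exists>f g. compatible B f g D \<and> b = (B, f, g, D))"
    "B \<in> Obj (glued F T M) \<and> D \<in> Obj (glued F T M) \<and> (\<exists>f g. compatible B f g D \<and> b' = (B, f, g, D))"
  then show "(b \<boxplus>\<^bsub>glued F T M\<^esub> b') \<cdot>\<^bsub>glued F T M\<^esub> a =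
      b \<cdot>\<^bsub>glued F T M\<^esub> a \<boxplus>\<^bsub>glued F T M\<^esub> b' \<cdot>\<^bsub>glued F T M\<^esub> a"
    by (elim conjE exE) (simp del: Obj_glued add: compatible_Hom)
next
  fix a a' b A B D
  assume "A \<in> Obj (glued F T M) \<and> B \<in> Obj (glued F T M) \<and> (\<exists>f g. compatible A f g B \<and> a = (A, f, g, B))"
    "A \<in> Obj (glued F T M) \<and> B \<in> Obj (glued F T M) \<and> (\<exists>f g. compatible A f g B \<and> a' = (A, f, g, B))"
    "B \<in> Obj (glued F T M) \<and> D \<in> Obj (glued F T M) \<and> (\<exists>f g. compatible B f g D \<and> b = (B, f, g, D))"
  then show "b \<cdot>\<^bsub>glued F T M\<^esub> (a \<boxplus>\<^bsub>glued F T M\<^esub> a') =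
      b \<cdot>\<^bsub>glued F T M\<^esub> a \<boxplus>\<^bsub>glued F T M\<^esub> b \<cdot>\<^bsub>glued F T M\<^esub> a'"
    by (elim conjE exE) (simp del: Obj_glued add: compatible_Hom)
qed

end

section \<open>Transport of abelian structure along an equivalence\<close>

text \<open>Moves the source of a kernel along an isomorphism, in particular to an object in the
  image of a functor.\<close>

lemma (in preadditive_category) is_kernel_iso:
  assumes "is_kernel C f k" "u \<in> Hom C K' (Dom C k)" "is_iso C u"
  shows "is_kernel C f (k \<cdot> u)"
proof (rule is_kernelI)
  note k = is_kernelD [OF assms(1)]
  obtain v where v: "v \<in> Hom C (Dom C k) K'" "v \<cdot> u = Ident C K'" "u \<cdot> v = Ident C (Dom C k)"
    using is_isoE [OF assms(3,2)] by blast
  note mono = is_kernel_imp_mono [OF assms(1)]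
  show "is_mono C (k \<cdot> u)"
  proof (rule is_monoI)
    fix w assume w: "w \<in> Arr C" "Cod C w = Dom C (k \<cdot> u)" "(k \<cdot> u) \<cdot> w = Zero C (Dom C w) (Cod C (k \<cdot> u))"
    have 0: "u \<cdot> w = Zero C (Dom C w) (Dom C k)"
      by (rule is_monoD [OF mono]) (use w k assms(2) in auto)
    have "w = v \<cdot> (u \<cdot> w)"
      using w k v(1) assms(2) by (subst Comp_rewrite [OF v(2)]) auto
    also have "\<dots> = Zero C (Dom C w) (Dom C (k \<cdot> u))"
      unfolding 0 using w v(1) k assms(2) by auto
    finally show "w = Zero C (Dom C w) (Dom C (k \<cdot> u))" .
  qed (use k assms(2) in auto)
  fix h assume h: "h \<in> Arr C" "Cod C h = Dom C f" "f \<cdot> h = Zero C (Dom C h) (Cod C f)"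
  then obtain w where w: "w \<in> Arr C" "Dom C w = Dom C h" "Cod C w = Dom C k" "k \<cdot> w = h"
    using is_kernel_lift [OF assms(1), of h] by auto
  have "(k \<cdot> u) \<cdot> (v \<cdot> w) = k \<cdot> ((u \<cdot> v) \<cdot> w)"
    using w v(1) k assms(2) by (subst Comp_assoc') auto
  then have "(k \<cdot> u) \<cdot> (v \<cdot> w) = h" using w v(3) by simp
  then show "\<exists>x. x \<in> Hom C (Dom C h) (Dom C (k \<cdot> u)) \<and> (k \<cdot> u) \<cdot> x = h"
    using w v(1) k assms(2) by (intro exI [of _ "v \<cdot> w"]) auto
next
  note k = is_kernelD [OF assms(1)]
  show "f \<cdot> k \<cdot> u = Zero C (Dom C (k \<cdot> u)) (Cod C f)"
    using k assms(2) by (subst Comp_rewrite [OF k(4)]) auto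
qed (use is_kernelD [OF assms(1)] assms(2) in auto)

text \<open>A mono after \<open>f\<close> does not change which arrows are killed. With an
  isomorphism as \<open>m\<close>, the target of \<open>f\<close> is moved into the image of a
  functor.\<close>

lemma (in preadditive_category) is_kernel_mono_Comp:
  assumes "is_kernel C f k" "is_mono C m" "Dom C m = Cod C f"
  shows "is_kernel C (m \<cdot> f) k"
proof (rule is_kernelI [OF is_kernel_imp_mono [OF assms(1)]])
  note k = is_kernelD [OF assms(1)]
  have m: "m \<in> Arr C" using assms(2) by (simp add: is_mono_def)
  show "m \<cdot> f \<in> Arr C" "Cod C k = Dom C (m \<cdot> f)" "(m \<cdot> f) \<cdot> k = Zero C (Dom C k) (Cod C (m \<cdot> f))"
    using k m assms(3) by auto
  fix h assume h: "h \<in> Arr C" "Cod C h = Dom C (m \<cdot> f)" "(m \<cdot> f) \<cdot> h = Zero C (Dom C h) (Cod C (m \<cdot> f))"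
  have "f \<cdot> h = Zero C (Dom C h) (Cod C f)"
    by (rule is_monoD [OF assms(2)]) (use h k m assms(3) in auto)
  then obtain u where "u \<in> Arr C" "Dom C u = Dom C h" "Cod C u = Dom C k" "k \<cdot> u = h"
    using is_kernel_lift [OF assms(1), of h] h k m assms(3) by auto
  then show "\<exists>u. u \<in> Hom C (Dom C h) (Dom C k) \<and> k \<cdot> u = h" by auto
qed

section \<open>Additive functors that are full, faithful and essentially surjective\<close>

text \<open>An equivalence is represented by one functor with these three properties; its
  quasi-inverse is chosen only at the end. Structure is transported backwards, from \<open>D\<close>
  to \<open>C\<close>.\<close>

locale additive_equivalence = additive_functor C D \<Phi>\<^sub>o \<Phi>
  for C :: "('o\<^sub>1, 'm\<^sub>1, 'y) preadditive_scheme"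
    and D :: "('o\<^sub>2, 'm\<^sub>2, 'z) preadditive_scheme"
    and \<Phi>\<^sub>o \<Phi> +
  assumes faithful:
      "\<lbrakk>f \<in> Hom C X Y; f' \<in> Hom C X Y; \<Phi> f = \<Phi> f'\<rbrakk> \<Longrightarrow> f = f'"
    and full:
      "\<lbrakk>X \<in> Obj C; Y \<in> Obj C; h \<in> Hom D (\<Phi>\<^sub>o X) (\<Phi>\<^sub>o Y)\<rbrakk> \<Longrightarrow> \<exists>f\<in>Hom C X Y. \<Phi> f = h"
    and essentially_surjective:
      "Z \<in> Obj D \<Longrightarrow> \<exists>X\<in>Obj C. \<exists>u\<in>Hom D (\<Phi>\<^sub>o X) Z. is_iso D u"
begin

lemma map_simps [simp]:
  assumes "f \<in> Arr C"
  shows "\<Phi> f \<in> Arr D" "Dom D (\<Phi> f) = \<Phi>\<^sub>o (Dom C f)" "Cod D (\<Phi> f) = \<Phi>\<^sub>o (Cod C f)"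
  using map_Hom [of f "Dom C f" "Cod C f"] assms by auto

lemma map_Comp' [simp]:
  "\<lbrakk>f \<in> Arr C; g \<in> Arr C; Dom C g = Cod C f\<rbrakk> \<Longrightarrow> \<Phi> (g \<cdot>\<^bsub>C\<^esub> f) = \<Phi> g \<cdot>\<^bsub>D\<^esub> \<Phi> f"
  using map_Comp by auto

lemma map_Add' [simp]:
  "\<lbrakk>f \<in> Arr C; f' \<in> Arr C; Dom C f = Dom C f'; Cod C f = Cod C f'\<rbrakk> \<Longrightarrow>
    \<Phi> (f \<boxplus>\<^bsub>C\<^esub> f') = \<Phi> f \<boxplus>\<^bsub>D\<^esub> \<Phi> f'"
  using map_Add by auto

declare map_Obj [simp] map_Ident [simp]

lemma map_Zero [simp]:
  assumes "X \<in> Obj C" "Y \<in> Obj C"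
  shows "\<Phi> (Zero C X Y) = Zero D (\<Phi>\<^sub>o X) (\<Phi>\<^sub>o Y)"
  using assms map_Add [of "Zero C X Y" X Y "Zero C X Y"] by (intro D.Add_eq_self_imp_Zero) auto

lemma isoE:
  assumes "Z \<in> Obj D"
  obtains X u v where "X \<in> Obj C" "u \<in> Hom D (\<Phi>\<^sub>o X) Z" "v \<in> Hom D Z (\<Phi>\<^sub>o X)"
    "v \<cdot>\<^bsub>D\<^esub> u = Ident D (\<Phi>\<^sub>o X)" "u \<cdot>\<^bsub>D\<^esub> v = Ident D Z"
proof -
  obtain X u where X: "X \<in> Obj C" "u \<in> Hom D (\<Phi>\<^sub>o X) Z" "is_iso D u"
    using essentially_surjective [OF assms] by blast
  obtain v where v: "v \<in> Hom D Z (\<Phi>\<^sub>o X)" "v \<cdot>\<^bsub>D\<^esub> u = Ident D (\<Phi>\<^sub>o X)"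
    "u \<cdot>\<^bsub>D\<^esub> v = Ident D Z"
    by (rule D.is_isoE [OF X(3,2)])
  show thesis by (rule that [OF X(1,2) v])
qed

lemma fullE:
  assumes "X \<in> Obj C" "Y \<in> Obj C" "h \<in> Hom D (\<Phi>\<^sub>o X) (\<Phi>\<^sub>o Y)"
  obtains f where "f \<in> Hom C X Y" "\<Phi> f = h"
  using full [OF assms] by blast

text \<open>Lets cokernels and epis be treated by the results on kernels and monos. In essential
  surjectivity the isomorphism has to be replaced by its inverse, as arrows are reversed.\<close>

lemma additive_equivalence_opposite:
  "additive_equivalence (opposite C) (opposite D) \<Phi>\<^sub>o \<Phi>"
proof (intro additive_equivalence.intro additive_functor.intro additive_functor_axioms.intro
    additive_equivalence_axioms.intro preadditive_category_opposite C.preadditive_category_axioms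
    D.preadditive_category_axioms, unfold Hom_opposite opposite_simps is_iso_opposite, goal_cases)
  case 7
  then show ?case by (intro full)
next
  case 6
  then show ?case by (rule faithful)
next
  case (8 Z)
  then obtain X u v where X: "X \<in> Obj C" "u \<in> Hom D (\<Phi>\<^sub>o X) Z" "v \<in> Hom D Z (\<Phi>\<^sub>o X)"
    "v \<cdot>\<^bsub>D\<^esub> u = Ident D (\<Phi>\<^sub>o X)" "u \<cdot>\<^bsub>D\<^esub> v = Ident D Z" by (rule isoE)
  have "is_iso D v" by (rule D.is_isoI [OF X(3,2,5,4)])
  with X(1,3) show ?case by blast
qed auto

text \<open>Fullness lifts the factorisation found in \<open>D\<close>; faithfulness lifts the
  equations.\<close>

lemma reflects_kernel:
  assumes "f \<in> Arr C" "k \<in> Arr C" "Cod C k = Dom C f" "is_kernel D (\<Phi> f) (\<Phi> k)"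
  shows "is_kernel C f k"
proof (rule C.is_kernelI)
  note K = is_kernelD [OF assms(4)]
  show "f \<cdot>\<^bsub>C\<^esub> k = Zero C (Dom C k) (Cod C f)"
    by (rule faithful [of _ "Dom C k" "Cod C f"]) (use assms(1-3) K(4) in auto)
  show "is_mono C k"
  proof (rule C.is_monoI)
    fix u assume u: "u \<in> Arr C" "Cod C u = Dom C k" "k \<cdot>\<^bsub>C\<^esub> u = Zero C (Dom C u) (Cod C k)"
    have "\<Phi> k \<cdot>\<^bsub>D\<^esub> \<Phi> u = \<Phi> (k \<cdot>\<^bsub>C\<^esub> u)" using u(1,2) assms(2) by simp
    then have "\<Phi> k \<cdot>\<^bsub>D\<^esub> \<Phi> u = Zero D (\<Phi>\<^sub>o (Dom C u)) (\<Phi>\<^sub>o (Cod C k))"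
      using u assms(2) by simp
    then have "\<Phi> u = Zero D (\<Phi>\<^sub>o (Dom C u)) (\<Phi>\<^sub>o (Dom C k))"
      by (intro is_monoD [OF D.is_kernel_imp_mono [OF assms(4)], of "\<Phi> u"]) (use u(1,2) assms(2) in auto)
    then show "u = Zero C (Dom C u) (Dom C k)"
      by (intro faithful [of u "Dom C u" "Dom C k"]) (use u(1,2) assms(2) in auto)
  qed (fact assms(2))
  fix h assume h: "h \<in> Arr C" "Cod C h = Dom C f" "f \<cdot>\<^bsub>C\<^esub> h = Zero C (Dom C h) (Cod C f)"
  have "\<Phi> f \<cdot>\<^bsub>D\<^esub> \<Phi> h = \<Phi> (f \<cdot>\<^bsub>C\<^esub> h)" using h(1,2) assms(1) by simp
  then have "\<Phi> f \<cdot>\<^bsub>D\<^esub> \<Phi> h = Zero D (\<Phi>\<^sub>o (Dom C h)) (\<Phi>\<^sub>o (Cod C f))"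
    using h assms(1) by simp
  then obtain w where w: "w \<in> Hom D (\<Phi>\<^sub>o (Dom C h)) (\<Phi>\<^sub>o (Dom C k))" "\<Phi> k \<cdot>\<^bsub>D\<^esub> w = \<Phi> h"
    using is_kernel_lift [OF assms(4), of "\<Phi> h"] h(1,2) assms(1,2) by auto
  obtain u where u: "u \<in> Hom C (Dom C h) (Dom C k)" "\<Phi> u = w"
    by (rule fullE [OF _ _ w(1)]) (use h(1) assms(2) in auto)
  have "k \<cdot>\<^bsub>C\<^esub> u = h"
    by (rule faithful [of _ "Dom C h" "Cod C k"]) (use u w h(1,2) assms(2,3) in auto)
  with u show "\<exists>u. u \<in> Hom C (Dom C h) (Dom C k) \<and> k \<cdot>\<^bsub>C\<^esub> u = h" by blast
qed (use assms in auto)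

text \<open>A test arrow \<open>w\<close> may start outside the image of the functor. Precomposed
  with an isomorphism from some \<open>\<Phi>\<^sub>o X\<close> it lifts to \<open>C\<close>, where
  \<open>f\<close> can be cancelled.\<close>

lemma preserves_mono:
  assumes "is_mono C f"
  shows "is_mono D (\<Phi> f)"
proof (rule D.is_monoI)
  have f: "f \<in> Arr C" using assms by (simp add: is_mono_def)
  then show "\<Phi> f \<in> Arr D" by simp
  fix w assume w: "w \<in> Arr D" "Cod D w = Dom D (\<Phi> f)" "\<Phi> f \<cdot>\<^bsub>D\<^esub> w = Zero D (Dom D w) (Cod D (\<Phi> f))"
  obtain X u v where X: "X \<in> Obj C" "u \<in> Hom D (\<Phi>\<^sub>o X) (Dom D w)" "v \<in> Hom D (Dom D w) (\<Phi>\<^sub>o X)"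
    "v \<cdot>\<^bsub>D\<^esub> u = Ident D (\<Phi>\<^sub>o X)" "u \<cdot>\<^bsub>D\<^esub> v = Ident D (Dom D w)"
    by (rule isoE [OF D.Dom_Obj [OF w(1)]])
  have "w \<cdot>\<^bsub>D\<^esub> u \<in> Hom D (\<Phi>\<^sub>o X) (\<Phi>\<^sub>o (Dom C f))" using w f X(2) by auto
  then obtain a where a: "a \<in> Hom C X (Dom C f)" "\<Phi> a = w \<cdot>\<^bsub>D\<^esub> u"
    by (rule fullE [OF X(1) C.Dom_Obj [OF f]])
  have "\<Phi> f \<cdot>\<^bsub>D\<^esub> (w \<cdot>\<^bsub>D\<^esub> u) = Zero D (\<Phi>\<^sub>o X) (\<Phi>\<^sub>o (Cod C f))"
    using w(1,2) f X(2) by (subst D.Comp_rewrite [OF w(3)]) auto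
  then have "f \<cdot>\<^bsub>C\<^esub> a = Zero C X (Cod C f)"
    by (intro faithful [of _ X "Cod C f"]) (use a f X(1) in auto)
  then have "a = Zero C X (Dom C f)"
    by (intro is_monoD [OF assms, of a]) (use a f X(1) in auto)
  then have wu: "w \<cdot>\<^bsub>D\<^esub> u = Zero D (\<Phi>\<^sub>o X) (\<Phi>\<^sub>o (Dom C f))" using a f X(1) by auto
  have "w = w \<cdot>\<^bsub>D\<^esub> (u \<cdot>\<^bsub>D\<^esub> v)" using X(5) w(1) by simp
  also have "\<dots> = (w \<cdot>\<^bsub>D\<^esub> u) \<cdot>\<^bsub>D\<^esub> v" using X(2,3) w(1) by simp
  also have "\<dots> = Zero D (Dom D w) (Dom D (\<Phi> f))" unfolding wu using X(1,3) f by auto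
  finally show "w = Zero D (Dom D w) (Dom D (\<Phi> f))" .
qed

end

section \<open>Abelian structure on the source of an equivalence with an abelian category\<close>

locale abelian_equivalence = additive_equivalence C D \<Phi>\<^sub>o \<Phi> + D: abelian_category D
  for C :: "('o\<^sub>1, 'm\<^sub>1, 'y) preadditive_scheme"
    and D :: "('o\<^sub>2, 'm\<^sub>2, 'z) preadditive_scheme"
    and \<Phi>\<^sub>o \<Phi>
begin

lemma abelian_equivalence_opposite:
  "abelian_equivalence (opposite C) (opposite D) \<Phi>\<^sub>o \<Phi>"
  by (intro abelian_equivalence.intro additive_equivalence_opposite abelian_category_opposite
    D.abelian_category_axioms)

text \<open>A kernel of \<open>\<Phi> f\<close> is moved along an isomorphism until its source lies
  in the image; fullness then lifts it and \<open>reflects_kernel\<close> applies.\<close>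

lemma ex_kernel_source:
  assumes "f \<in> Arr C"
  shows "\<exists>k. is_kernel C f k"
proof -
  obtain k where k: "is_kernel D (\<Phi> f) k" using D.ex_kernel assms by force
  note K = is_kernelD [OF k]
  obtain A u v where A: "A \<in> Obj C" "u \<in> Hom D (\<Phi>\<^sub>o A) (Dom D k)" "v \<in> Hom D (Dom D k) (\<Phi>\<^sub>o A)"
    "v \<cdot>\<^bsub>D\<^esub> u = Ident D (\<Phi>\<^sub>o A)" "u \<cdot>\<^bsub>D\<^esub> v = Ident D (Dom D k)"
    by (rule isoE [OF D.Dom_Obj [OF K(2)]])
  have ku: "is_kernel D (\<Phi> f) (k \<cdot>\<^bsub>D\<^esub> u)"
    using D.is_kernel_iso [OF k A(2)] D.is_isoI [OF A(2,3,4,5)] by blast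
  have "k \<cdot>\<^bsub>D\<^esub> u \<in> Hom D (\<Phi>\<^sub>o A) (\<Phi>\<^sub>o (Dom C f))" using K A(2) assms by auto
  then obtain a where "a \<in> Hom C A (Dom C f)" "\<Phi> a = k \<cdot>\<^bsub>D\<^esub> u"
    by (rule fullE [OF A(1) C.Dom_Obj [OF assms]])
  then have "is_kernel C f a" using reflects_kernel [of f a] ku assms by auto
  then show ?thesis ..
qed

text \<open>The arrow of which \<open>\<Phi> f\<close> is a kernel may end outside the image.
  Following it by an isomorphism keeps the kernel and makes it liftable.\<close>

lemma mono_is_kernel_source:
  assumes "is_mono C f"
  shows "\<exists>g. is_kernel C g f"
proof -
  have f: "f \<in> Arr C" using assms by (simp add: is_mono_def)
  obtain g where g: "is_kernel D g (\<Phi> f)" using D.mono_is_kernel preserves_mono [OF assms] by blast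
  note K = is_kernelD [OF g]
  obtain A u v where A: "A \<in> Obj C" "u \<in> Hom D (\<Phi>\<^sub>o A) (Cod D g)" "v \<in> Hom D (Cod D g) (\<Phi>\<^sub>o A)"
    "v \<cdot>\<^bsub>D\<^esub> u = Ident D (\<Phi>\<^sub>o A)" "u \<cdot>\<^bsub>D\<^esub> v = Ident D (Cod D g)"
    by (rule isoE [OF D.Cod_Obj [OF K(1)]])
  have "is_mono D v" by (rule D.is_monoI_retraction [of _ u]) (use A in auto)
  then have vg: "is_kernel D (v \<cdot>\<^bsub>D\<^esub> g) (\<Phi> f)"
    using D.is_kernel_mono_Comp [OF g] A(3) by auto
  have "v \<cdot>\<^bsub>D\<^esub> g \<in> Hom D (\<Phi>\<^sub>o (Cod C f)) (\<Phi>\<^sub>o A)" using K A(3) f by auto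
  then obtain a where "a \<in> Hom C (Cod C f) A" "\<Phi> a = v \<cdot>\<^bsub>D\<^esub> g"
    by (rule fullE [OF C.Cod_Obj [OF f] A(1)])
  then have "is_kernel C a f" using reflects_kernel [of a f] vg f by auto
  then show ?thesis ..
qed

lemma ex_zero_object_source: "\<exists>Z. is_zero_object C Z"
proof -
  obtain Z where Z: "is_zero_object D Z" using D.ex_zero_object by blast
  then have ZO: "Z \<in> Obj D" by (simp add: is_zero_object_def)
  obtain A u v where A: "A \<in> Obj C" "u \<in> Hom D (\<Phi>\<^sub>o A) Z" "v \<in> Hom D Z (\<Phi>\<^sub>o A)"
    "v \<cdot>\<^bsub>D\<^esub> u = Ident D (\<Phi>\<^sub>o A)" "u \<cdot>\<^bsub>D\<^esub> v = Ident D Z"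
    by (rule isoE [OF ZO])
  have "\<exists>!f. f \<in> Hom D (\<Phi>\<^sub>o A) Z" using Z map_Obj [OF A(1)] unfolding is_zero_object_def by blast
  moreover have "Zero D (\<Phi>\<^sub>o A) Z \<in> Hom D (\<Phi>\<^sub>o A) Z" using A(1) ZO by simp
  ultimately have "u = Zero D (\<Phi>\<^sub>o A) Z" using A(2) by blast
  then have "Ident D (\<Phi>\<^sub>o A) = Zero D (\<Phi>\<^sub>o A) (\<Phi>\<^sub>o A)" using A by auto
  then have "Ident C A = Zero C A A"
    by (intro faithful [of "Ident C A" A A]) (use A(1) in auto)
  then show ?thesis using C.is_zero_objectI A(1) by blast
qed

text \<open>The biproduct in \<open>D\<close> is conjugated into the image, its four arrows are
  lifted, and the identities hold in \<open>C\<close> because the functor is faithful and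
  additive.\<close>

lemma ex_biproduct_source:
  assumes "X \<in> Obj C" "Y \<in> Obj C"
  shows "\<exists>b. is_biproduct C X Y b"
proof -
  obtain B j\<^sub>1 j\<^sub>2 q\<^sub>1 q\<^sub>2 where "is_biproduct D (\<Phi>\<^sub>o X) (\<Phi>\<^sub>o Y) (B, j\<^sub>1, j\<^sub>2, q\<^sub>1, q\<^sub>2)"
    by (rule D.is_biproduct_biproduct [OF map_Obj [OF assms(1)] map_Obj [OF assms(2)]])
  note b = this and D = D.is_biproductD [OF this]
  obtain A u v where A: "A \<in> Obj C" "u \<in> Hom D (\<Phi>\<^sub>o A) B" "v \<in> Hom D B (\<Phi>\<^sub>o A)"
    "v \<cdot>\<^bsub>D\<^esub> u = Ident D (\<Phi>\<^sub>o A)" "u \<cdot>\<^bsub>D\<^esub> v = Ident D B"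
    by (rule isoE [OF D(20)])
  note b' = D.is_biproduct_iso [OF b A(3,2,5,4)]
  note D' = D.is_biproductD [OF b']
  obtain i\<^sub>1 where i1: "i\<^sub>1 \<in> Hom C X A" "\<Phi> i\<^sub>1 = v \<cdot>\<^bsub>D\<^esub> j\<^sub>1"
    by (rule fullE [OF assms(1) A(1), of "v \<cdot>\<^bsub>D\<^esub> j\<^sub>1"]) (use D' in auto)
  obtain i\<^sub>2 where i2: "i\<^sub>2 \<in> Hom C Y A" "\<Phi> i\<^sub>2 = v \<cdot>\<^bsub>D\<^esub> j\<^sub>2"
    by (rule fullE [OF assms(2) A(1), of "v \<cdot>\<^bsub>D\<^esub> j\<^sub>2"]) (use D' in auto)
  obtain p\<^sub>1 where p1: "p\<^sub>1 \<in> Hom C A X" "\<Phi> p\<^sub>1 = q\<^sub>1 \<cdot>\<^bsub>D\<^esub> u"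
    by (rule fullE [OF A(1) assms(1), of "q\<^sub>1 \<cdot>\<^bsub>D\<^esub> u"]) (use D' in auto)
  obtain p\<^sub>2 where p2: "p\<^sub>2 \<in> Hom C A Y" "\<Phi> p\<^sub>2 = q\<^sub>2 \<cdot>\<^bsub>D\<^esub> u"
    by (rule fullE [OF A(1) assms(2), of "q\<^sub>2 \<cdot>\<^bsub>D\<^esub> u"]) (use D' in auto)
  note D'' = D'(13-17) [folded i1(2) i2(2) p1(2) p2(2)]
  have "p\<^sub>1 \<cdot>\<^bsub>C\<^esub> i\<^sub>1 = Ident C X"
    by (rule faithful [of _ X X]) (use i1(1) p1(1) assms D''(1) in auto)
  moreover have "p\<^sub>2 \<cdot>\<^bsub>C\<^esub> i\<^sub>2 = Ident C Y"
    by (rule faithful [of _ Y Y]) (use i2(1) p2(1) assms D''(2) in auto)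
  moreover have "p\<^sub>2 \<cdot>\<^bsub>C\<^esub> i\<^sub>1 = Zero C X Y"
    by (rule faithful [of _ X Y]) (use i1(1) p2(1) assms D''(3) in auto)
  moreover have "p\<^sub>1 \<cdot>\<^bsub>C\<^esub> i\<^sub>2 = Zero C Y X"
    by (rule faithful [of _ Y X]) (use i2(1) p1(1) assms D''(4) in auto)
  moreover have "i\<^sub>1 \<cdot>\<^bsub>C\<^esub> p\<^sub>1 \<boxplus>\<^bsub>C\<^esub> i\<^sub>2 \<cdot>\<^bsub>C\<^esub> p\<^sub>2 = Ident C A"
    by (rule faithful [of _ A A]) (use i1(1) i2(1) p1(1) p2(1) A(1) D''(5) in auto)
  ultimately have "is_biproduct C X Y (A, i\<^sub>1, i\<^sub>2, p\<^sub>1, p\<^sub>2)"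
    using i1(1) i2(1) p1(1) p2(1) A(1) by (simp add: is_biproduct_def)
  then show ?thesis ..
qed

end

context abelian_equivalence
begin

interpretation op: abelian_equivalence "opposite C" "opposite D" \<Phi>\<^sub>o \<Phi>
  by (rule abelian_equivalence_opposite)

lemma abelian_category_source: "abelian_category C"
proof (intro abelian_category.intro abelian_category_axioms.intro additive_category.intro
    additive_category_axioms.intro C.preadditive_category_axioms ex_zero_object_source
    ex_biproduct_source ex_kernel_source mono_is_kernel_source)
  show "\<exists>c. is_cokernel C f c" if "f \<in> Arr C" for f
    using op.ex_kernel_source [of f] that by simp
  show "\<exists>g. is_cokernel C g f" if "is_epi C f" for f
    using op.mono_is_kernel_source [of f] that by simp
qed

end

context abelian_equivalence
begin

text \<open>The quasi-inverse comes from choosing, for each object of \<open>D\<close>, an object of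
  \<open>C\<close> together with an isomorphism and its inverse.\<close>

lemma equivalent_abelian_categories_source: "equivalent_abelian_categories D C"
proof -
  have "\<forall>Z\<in>Obj D. \<exists>X u v. X \<in> Obj C \<and> u \<in> Hom D (\<Phi>\<^sub>o X) Z \<and> v \<in> Hom D Z (\<Phi>\<^sub>o X) \<and>
      v \<cdot>\<^bsub>D\<^esub> u = Ident D (\<Phi>\<^sub>o X) \<and> u \<cdot>\<^bsub>D\<^esub> v = Ident D Z"
  proof
    fix Z assume "Z \<in> Obj D"
    then show "\<exists>X u v. X \<in> Obj C \<and> u \<in> Hom D (\<Phi>\<^sub>o X) Z \<and> v \<in> Hom D Z (\<Phi>\<^sub>o X) \<and>
        v \<cdot>\<^bsub>D\<^esub> u = Ident D (\<Phi>\<^sub>o X) \<and> u \<cdot>\<^bsub>D\<^esub> v = Ident D Z"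
      by (rule isoE) (intro exI conjI)
  qed
  then obtain R u v where Ruv: "\<forall>Z\<in>Obj D. R Z \<in> Obj C \<and> u Z \<in> Hom D (\<Phi>\<^sub>o (R Z)) Z \<and>
      v Z \<in> Hom D Z (\<Phi>\<^sub>o (R Z)) \<and> v Z \<cdot>\<^bsub>D\<^esub> u Z = Ident D (\<Phi>\<^sub>o (R Z)) \<and>
      u Z \<cdot>\<^bsub>D\<^esub> v Z = Ident D Z"
    unfolding bchoice_iff by blast
  have R [simp]: "R Z \<in> Obj C" "u Z \<in> Arr D" "Dom D (u Z) = \<Phi>\<^sub>o (R Z)" "Cod D (u Z) = Z"
    "v Z \<in> Arr D" "Dom D (v Z) = Z" "Cod D (v Z) = \<Phi>\<^sub>o (R Z)"
    "v Z \<cdot>\<^bsub>D\<^esub> u Z = Ident D (\<Phi>\<^sub>o (R Z))" "u Z \<cdot>\<^bsub>D\<^esub> v Z = Ident D Z" if "Z \<in> Obj D" for Z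
    using bspec [OF Ruv that] by simp_all
  have uv: "u Z \<cdot>\<^bsub>D\<^esub> (v Z \<cdot>\<^bsub>D\<^esub> h) = h" if "Z \<in> Obj D" "h \<in> Arr D" "Cod D h = Z" for Z h
    using that D.Comp_rewrite [OF R(9), of Z h] by simp
  \<comment> \<open>The preimage of \<open>h\<close> conjugated by the chosen isomorphisms.
    Faithfulness makes it unique, so the functor laws can be checked after applying
    \<open>\<Phi>\<close>.\<close>
  define \<Psi> where "\<Psi> h = (SOME f. f \<in> Hom C (R (Dom D h)) (R (Cod D h)) \<and>
      \<Phi> f = v (Cod D h) \<cdot>\<^bsub>D\<^esub> h \<cdot>\<^bsub>D\<^esub> u (Dom D h))" for h
  have \<Psi>: "\<Psi> h \<in> Hom C (R (Dom D h)) (R (Cod D h)) \<and>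
      \<Phi> (\<Psi> h) = v (Cod D h) \<cdot>\<^bsub>D\<^esub> h \<cdot>\<^bsub>D\<^esub> u (Dom D h)" if h: "h \<in> Arr D" for h
  proof -
    have "v (Cod D h) \<cdot>\<^bsub>D\<^esub> h \<cdot>\<^bsub>D\<^esub> u (Dom D h) \<in> Hom D (\<Phi>\<^sub>o (R (Dom D h))) (\<Phi>\<^sub>o (R (Cod D h)))"
      using h by simp
    then have "\<exists>f\<in>Hom C (R (Dom D h)) (R (Cod D h)). \<Phi> f = v (Cod D h) \<cdot>\<^bsub>D\<^esub> h \<cdot>\<^bsub>D\<^esub> u (Dom D h)"
      by (rule full [rotated 2]) (use h in simp_all)
    then have ex: "\<exists>f. f \<in> Hom C (R (Dom D h)) (R (Cod D h)) \<and>
        \<Phi> f = v (Cod D h) \<cdot>\<^bsub>D\<^esub> h \<cdot>\<^bsub>D\<^esub> u (Dom D h)"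
      unfolding Bex_def .
    show ?thesis unfolding \<Psi>_def by (rule someI_ex [OF ex])
  qed
  then have \<Psi>_simps [simp]: "\<Psi> h \<in> Arr C" "Dom C (\<Psi> h) = R (Dom D h)" "Cod C (\<Psi> h) = R (Cod D h)"
    and \<Phi>\<Psi>: "\<Phi> (\<Psi> h) = v (Cod D h) \<cdot>\<^bsub>D\<^esub> h \<cdot>\<^bsub>D\<^esub> u (Dom D h)" if "h \<in> Arr D" for h
    using that by auto
  have functor_\<Psi>: "additive_functor D C R \<Psi>"
  proof (intro additive_functor.intro additive_functor_axioms.intro C.preadditive_category_axioms
      D.preadditive_category_axioms)
    show "\<Psi> (Ident D X) = Ident C (R X)" if "X \<in> Obj D" for X
      by (rule faithful [of _ "R X" "R X"]) (use that in \<open>auto simp: \<Phi>\<Psi>\<close>)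
    show "\<Psi> (g \<cdot>\<^bsub>D\<^esub> f) = \<Psi> g \<cdot>\<^bsub>C\<^esub> \<Psi> f" if "f \<in> Hom D X Y" "g \<in> Hom D Y Z" for f g X Y Z
      by (rule faithful [of _ "R X" "R Z"]) (use that in \<open>auto simp: \<Phi>\<Psi> uv\<close>)
    show "\<Psi> (f \<boxplus>\<^bsub>D\<^esub> f') = \<Psi> f \<boxplus>\<^bsub>C\<^esub> \<Psi> f'" if "f \<in> Hom D X Y" "f' \<in> Hom D X Y" for f f' X Y
      by (rule faithful [of _ "R X" "R Y"]) (use that in \<open>auto simp: \<Phi>\<Psi>\<close>)
  qed auto
  have nat_u: "natural_iso_to_identity D (\<Phi>\<^sub>o \<circ> R) (\<Phi> \<circ> \<Psi>) u"
    unfolding natural_iso_to_identity_def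
  proof (intro conjI ballI)
    fix X assume X: "X \<in> Obj D"
    show "u X \<in> Hom D ((\<Phi>\<^sub>o \<circ> R) X) X" using X by simp
    show "is_iso D (u X)"
      by (rule D.is_isoI [of _ "\<Phi>\<^sub>o (R X)" X "v X"]) (use X in auto)
  next
    fix f assume "f \<in> Arr D"
    then show "f \<cdot>\<^bsub>D\<^esub> u (Dom D f) = u (Cod D f) \<cdot>\<^bsub>D\<^esub> (\<Phi> \<circ> \<Psi>) f"
      by (simp add: \<Phi>\<Psi> uv)
  qed
  \<comment> \<open>The natural isomorphism on the side of \<open>C\<close> is lifted from the
    chosen isomorphism at \<open>\<Phi>\<^sub>o X\<close>.\<close>
  have "\<forall>X\<in>Obj C. \<exists>e. e \<in> Hom C (R (\<Phi>\<^sub>o X)) X \<and> \<Phi> e = u (\<Phi>\<^sub>o X)"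
  proof
    fix X assume X: "X \<in> Obj C"
    then have "u (\<Phi>\<^sub>o X) \<in> Hom D (\<Phi>\<^sub>o (R (\<Phi>\<^sub>o X))) (\<Phi>\<^sub>o X)" by simp
    then obtain e where "e \<in> Hom C (R (\<Phi>\<^sub>o X)) X" "\<Phi> e = u (\<Phi>\<^sub>o X)"
      by (rule fullE [OF R(1) [OF map_Obj [OF X]] X])
    then show "\<exists>e. e \<in> Hom C (R (\<Phi>\<^sub>o X)) X \<and> \<Phi> e = u (\<Phi>\<^sub>o X)" by blast
  qed
  then obtain e where e0: "\<forall>X\<in>Obj C. e X \<in> Hom C (R (\<Phi>\<^sub>o X)) X \<and> \<Phi> (e X) = u (\<Phi>\<^sub>o X)"
    unfolding bchoice_iff by blast
  have e [simp]: "e X \<in> Arr C" "Dom C (e X) = R (\<Phi>\<^sub>o X)" "Cod C (e X) = X" "\<Phi> (e X) = u (\<Phi>\<^sub>o X)"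
    if "X \<in> Obj C" for X using bspec [OF e0 that] by simp_all
  have nat_e: "natural_iso_to_identity C (R \<circ> \<Phi>\<^sub>o) (\<Psi> \<circ> \<Phi>) e"
    unfolding natural_iso_to_identity_def
  proof (intro conjI ballI)
    fix X assume X: "X \<in> Obj C"
    show "e X \<in> Hom C ((R \<circ> \<Phi>\<^sub>o) X) X" using X by simp
    obtain w where w: "w \<in> Hom C X (R (\<Phi>\<^sub>o X))" "\<Phi> w = v (\<Phi>\<^sub>o X)"
      by (rule fullE [of X "R (\<Phi>\<^sub>o X)" "v (\<Phi>\<^sub>o X)"]) (use X in auto)
    show "is_iso C (e X)"
    proof (rule C.is_isoI [of _ "R (\<Phi>\<^sub>o X)" X w])
      show "w \<cdot>\<^bsub>C\<^esub> e X = Ident C (R (\<Phi>\<^sub>o X))"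
        by (rule faithful [of _ "R (\<Phi>\<^sub>o X)" "R (\<Phi>\<^sub>o X)"]) (use w X in auto)
      show "e X \<cdot>\<^bsub>C\<^esub> w = Ident C X"
        by (rule faithful [of _ X X]) (use w X in auto)
    qed (use w X in auto)
  next
    fix f assume f: "f \<in> Arr C"
    show "f \<cdot>\<^bsub>C\<^esub> e (Dom C f) = e (Cod C f) \<cdot>\<^bsub>C\<^esub> (\<Psi> \<circ> \<Phi>) f"
      by (rule faithful [of _ "R (\<Phi>\<^sub>o (Dom C f))" "Cod C f"]) (use f in \<open>auto simp: \<Phi>\<Psi> uv\<close>)
  qed
  show ?thesis
    unfolding equivalent_abelian_categories_def
    by (rule conjI [OF D.abelian_category_axioms conjI [OF abelian_category_source]],
        rule exI [of _ R], rule exI [of _ \<Psi>], rule exI [of _ \<Phi>\<^sub>o], rule exI [of _ \<Phi>],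
        rule exI [of _ u], rule exI [of _ e])
      (intro conjI functor_\<Psi> additive_functor_axioms nat_u nat_e)
qed

end

section \<open>The equivalence\<close>

context abelian_category
begin

text \<open>The difference of two middle arrows kills the subobject and is killed by the projection,
  so it has the form \<open>fst e' \<cdot> t \<cdot> snd e\<close> with \<open>t\<close> from
  \<open>X\<close> to \<open>Y'\<close>; such \<open>t\<close> is zero.\<close>

lemma ext_mor_middle_unique:
  assumes e: "e \<in> extensions C X Y" and e': "e' \<in> extensions C X' Y'"
    and zero: "Hom C X Y' = {Zero C X Y'}"
    and h: "h \<in> Hom C (Cod C (fst e)) (Cod C (fst e'))" "h \<cdot> fst e = fst e' \<cdot> g" "snd e' \<cdot> h = f \<cdot> snd e"
    and h': "h' \<in> Hom C (Cod C (fst e)) (Cod C (fst e'))" "h' \<cdot> fst e = fst e' \<cdot> g" "snd e' \<cdot> h' = f \<cdot> snd e"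
  shows "h = h'"
proof -
  have se: "short_exact C (fst e) (snd e)" "short_exact C (fst e') (snd e')"
    and XY: "Dom C (fst e) = Y" "Dom C (fst e') = Y'" "Cod C (snd e) = X" "Cod C (snd e') = X'"
    using e e' by (auto simp: extensions_iff)
  note D = short_exactD [OF se(1)] short_exactD [OF se(2)]
  note O = extensions_Obj [OF e] extensions_Obj [OF e']
  define d where "d = h \<boxplus> Neg C h'"
  have d: "d \<in> Hom C (Cod C (fst e)) (Cod C (fst e'))" using h(1) h'(1) by (simp add: d_def)
  have "d \<cdot> fst e = h \<cdot> fst e \<boxplus> Neg C (h' \<cdot> fst e)" using h(1) h'(1) D by (simp add: d_def)
  also have "\<dots> = Zero C Y (Cod C (fst e'))"
  proof -
    have "h \<cdot> fst e \<in> Hom C Y (Cod C (fst e'))" using h(1) D XY by simp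
    then show ?thesis unfolding h'(2) h(2) by simp
  qed
  finally have "d \<cdot> fst e = Zero C Y (Cod C (fst e'))" .
  then obtain w where w: "w \<in> Arr C" "Dom C w = X" "Cod C w = Cod C (fst e')" "w \<cdot> snd e = d"
    using is_cokernel_lift [of C "fst e" "snd e" d] se(1) d D XY unfolding short_exact_def by auto
  have "snd e' \<cdot> d = snd e' \<cdot> h \<boxplus> Neg C (snd e' \<cdot> h')" using h(1) h'(1) D by (simp add: d_def)
  also have "\<dots> = Zero C (Cod C (fst e)) X'"
  proof -
    have "snd e' \<cdot> h \<in> Hom C (Cod C (fst e)) X'" using h(1) D XY by simp
    then show ?thesis unfolding h'(3) h(3) by simp
  qed
  finally have "(snd e' \<cdot> w) \<cdot> snd e = Zero C (Cod C (fst e)) X'" using w D XY by simp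
  then have "snd e' \<cdot> w = Zero C X X'"
    by - (rule is_epiD [OF short_exact_epi [OF se(1)]]; use w D XY O in auto)
  then obtain t where t: "t \<in> Arr C" "Dom C t = X" "Cod C t = Y'" "fst e' \<cdot> t = w"
    using is_kernel_lift [of C "snd e'" "fst e'" w] se(2) w D XY O unfolding short_exact_def by auto
  have "t \<in> Hom C X Y'" using t by simp
  then have "t = Zero C X Y'" unfolding zero by blast
  then have "w = Zero C X (Cod C (fst e'))" using t(4) D XY O by auto
  then have "d = Zero C (Cod C (fst e)) (Cod C (fst e'))" using w(4) D XY O by auto
  then show ?thesis using eq_iff_diff_Zero [OF h(1) h'(1)] unfolding d_def by blast
qed

text \<open>The composite from the subobject \<open>Y\<close> to the quotient \<open>X'\<close> is
  zero, so \<open>h\<close> restricts to the kernels and descends to the cokernels.\<close>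

lemma ext_mor_of_middle:
  assumes e: "e \<in> extensions C X Y" and e': "e' \<in> extensions C X' Y'"
    and zero: "Hom C Y X' = {Zero C Y X'}"
    and h: "h \<in> Hom C (Cod C (fst e)) (Cod C (fst e'))"
  obtains g f where "g \<in> Hom C Y Y'" "f \<in> Hom C X X'"
    "h \<cdot> fst e = fst e' \<cdot> g" "snd e' \<cdot> h = f \<cdot> snd e" "ext_mor C e e' g f"
proof -
  have se: "short_exact C (fst e) (snd e)" "short_exact C (fst e') (snd e')"
    and XY: "Dom C (fst e) = Y" "Dom C (fst e') = Y'" "Cod C (snd e) = X" "Cod C (snd e') = X'"
    using e e' by (auto simp: extensions_iff)
  note D = short_exactD [OF se(1)] short_exactD [OF se(2)]
  have "snd e' \<cdot> h \<cdot> fst e \<in> Hom C Y X'" using h D XY by simp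
  then have 0: "snd e' \<cdot> h \<cdot> fst e = Zero C Y X'" unfolding zero by blast
  obtain g where g: "g \<in> Arr C" "Dom C g = Y" "Cod C g = Y'" "fst e' \<cdot> g = h \<cdot> fst e"
    using is_kernel_lift [of C "snd e'" "fst e'" "h \<cdot> fst e"] se(2) h 0 D XY
    unfolding short_exact_def by auto
  obtain f where f: "f \<in> Arr C" "Dom C f = X" "Cod C f = X'" "f \<cdot> snd e = snd e' \<cdot> h"
    using is_cokernel_lift [of C "fst e" "snd e" "snd e' \<cdot> h"] se(1) h 0 D XY
    unfolding short_exact_def by auto
  have "ext_mor C e e' g f"
    unfolding ext_mor_def using se g f h XY by auto
  then show thesis using that [of g f] g f by simp
qed

end

section \<open>The functor sending a triple to the middle object of its extension\<close>

text \<open>Homs vanish between the two classes in both directions. The torsion sequences themselves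
  need not split; their classes are what the gluing remembers.\<close>

locale split_torsion_pair = abelian_category C
  for C :: "('o, 'm, 'z) preadditive_scheme" (structure) +
  fixes \<T> \<F> :: "'o set"
  assumes torsion: "torsion_pair C \<T> \<F>"
    and Hom_F_T: "\<lbrakk>X \<in> \<F>; Y \<in> \<T>\<rbrakk> \<Longrightarrow> Hom C X Y = {Zero C X Y}"
begin

lemma torsion_pair_subset: "\<T> \<subseteq> Obj C" "\<F> \<subseteq> Obj C"
  and Hom_T_F: "\<lbrakk>Y \<in> \<T>; X \<in> \<F>\<rbrakk> \<Longrightarrow> Hom C Y X = {Zero C Y X}"
  using torsion by (auto simp: torsion_pair_def simp del: in_Hom)

sublocale M: biadditive_bifunctor "full_subcategory C \<F>" "full_subcategory C \<T>" "Ext_bifunctor C"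
  by (intro Ext_bifunctor_full_subcategory torsion_pair_subset torsion_pair_additive [OF abelian_category_axioms torsion])

abbreviation G where "G \<equiv> glued (full_subcategory C \<F>) (full_subcategory C \<T>) (Ext_bifunctor C)"

text \<open>A chosen extension in the class of the triple; the choice is meaningful only on objects
  of \<open>G\<close>.\<close>

definition rep :: "'o \<times> 'o \<times> ('m \<times> 'm) set \<Rightarrow> 'm \<times> 'm" where
  "rep = (\<lambda>(X, Y, \<mu>). SOME e. e \<in> extensions C X Y \<and> \<mu> = ext_class C e)"

definition mid :: "'o \<times> 'o \<times> ('m \<times> 'm) set \<Rightarrow> 'o" where
  "mid A = Cod C (fst (rep A))"

text \<open>The description is well defined on arrows of \<open>G\<close>: existence is the gluing
  condition, and uniqueness comes from the vanishing of homs from \<open>\<F>\<close> to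
  \<open>\<T>\<close>.\<close>

definition mid_arr ::
  "('o \<times> 'o \<times> ('m \<times> 'm) set) \<times> 'm \<times> 'm \<times> ('o \<times> 'o \<times> ('m \<times> 'm) set) \<Rightarrow> 'm" where
  "mid_arr = (\<lambda>(A, f, g, B). THE h. h \<in> Hom C (mid A) (mid B) \<and>
     h \<cdot> fst (rep A) = fst (rep B) \<cdot> g \<and> snd (rep B) \<cdot> h = f \<cdot> snd (rep A))"

lemma rep:
  assumes "(X, Y, \<mu>) \<in> Obj G"
  shows "rep (X, Y, \<mu>) \<in> extensions C X Y" "ext_class C (rep (X, Y, \<mu>)) = \<mu>" "X \<in> \<F>" "Y \<in> \<T>"
proof -
  show "X \<in> \<F>" "Y \<in> \<T>" using assms by auto
  have "\<mu> \<in> carrier (Ext_group C X Y)" using assms by simp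
  then have "\<exists>e. e \<in> extensions C X Y \<and> \<mu> = ext_class C e"
    by (rule Ext_carrierE) blast
  from someI_ex [OF this] show "rep (X, Y, \<mu>) \<in> extensions C X Y" "ext_class C (rep (X, Y, \<mu>)) = \<mu>"
    by (auto simp: rep_def)
qed

lemma compatible_iff:
  assumes "(X, Y, \<mu>) \<in> Obj G" "(X', Y', \<mu>') \<in> Obj G"
  shows "M.compatible (X, Y, \<mu>) f g (X', Y', \<mu>') \<longleftrightarrow>
    f \<in> Hom C X X' \<and> g \<in> Hom C Y Y' \<and> ext_mor C (rep (X, Y, \<mu>)) (rep (X', Y', \<mu>')) g f"
  using rep [OF assms(1)] rep [OF assms(2)]
    ext_mor_iff [OF rep(1) [OF assms(1)] rep(1) [OF assms(2)], of g f]
  by (auto simp: M.compatible_def Hom_full_subcategory simp del: in_Hom)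

text \<open>An equivalence rather than an implication, since it is used both to extract the two
  squares and to recognise an arrow as the value of \<open>mid_arr\<close>.\<close>

lemma mid_arr_iff:
  assumes a: "((X, Y, \<mu>), f, g, (X', Y', \<mu>')) \<in> Arr G"
  shows "h = mid_arr ((X, Y, \<mu>), f, g, (X', Y', \<mu>')) \<longleftrightarrow>
    h \<in> Hom C (mid (X, Y, \<mu>)) (mid (X', Y', \<mu>')) \<and>
     h \<cdot> fst (rep (X, Y, \<mu>)) = fst (rep (X', Y', \<mu>')) \<cdot> g \<and>
     snd (rep (X', Y', \<mu>')) \<cdot> h = f \<cdot> snd (rep (X, Y, \<mu>))" (is "_ \<longleftrightarrow> ?P h")
proof -
  have A: "(X, Y, \<mu>) \<in> Obj G" "(X', Y', \<mu>') \<in> Obj G" "M.compatible (X, Y, \<mu>) f g (X', Y', \<mu>')"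
    using a by (simp_all only: M.Arr_glued)
  note e = rep [OF A(1)] and e' = rep [OF A(2)]
  have "\<exists>h. ?P h"
    using A(3) unfolding compatible_iff [OF A(1,2)] ext_mor_def mid_def by blast
  moreover have "h = h'" if "?P h" "?P h'" for h h'
    using that ext_mor_middle_unique [OF e(1) e'(1) Hom_F_T [OF e(3) e'(4)], of h g f h']
    unfolding mid_def by blast
  ultimately have ex1: "\<exists>!h. ?P h" by blast
  have "mid_arr ((X, Y, \<mu>), f, g, (X', Y', \<mu>')) = (THE h. ?P h)" by (simp add: mid_arr_def)
  with theI' [OF ex1] ex1 show ?thesis by auto
qed

lemmas mid_arrD = mid_arr_iff [THEN iffD1, OF _ refl]
  and mid_arrI = mid_arr_iff [THEN iffD2, symmetric]

text \<open>Identities, composites and sums of middle arrows satisfy the two squares that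
  characterise the required value, so each functor law is an instance of uniqueness.\<close>

lemma functor_mid: "additive_functor G C mid mid_arr"
proof -
  interpret G: preadditive_category G by (rule M.preadditive_glued)
  have repD: "fst (rep A) \<in> Arr C" "snd (rep A) \<in> Arr C" "Dom C (snd (rep A)) = mid A"
    "Cod C (fst (rep A)) = mid A" "Dom C (fst (rep A)) = fst (snd A)" "Cod C (snd (rep A)) = fst A"
    "mid A \<in> Obj C" "fst A \<in> Obj C" "fst (snd A) \<in> Obj C"
    if "A \<in> Obj G" for A
  proof -
    obtain X Y \<mu> where A: "A = (X, Y, \<mu>)" by (rule prod_cases3)
    note r = rep(1) [OF that [unfolded A]]
    then have se: "short_exact C (fst (rep A)) (snd (rep A))" by (simp add: A extensions_iff)
    note D = short_exactD [OF se]
    show "fst (rep A) \<in> Arr C" "snd (rep A) \<in> Arr C" "Dom C (snd (rep A)) = mid A"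
      "Cod C (fst (rep A)) = mid A" "Dom C (fst (rep A)) = fst (snd A)" "Cod C (snd (rep A)) = fst A"
      "mid A \<in> Obj C" "fst A \<in> Obj C" "fst (snd A) \<in> Obj C"
      using D r extensions_Obj [OF r] by (simp_all add: mid_def extensions_iff A)
  qed
  have arr: "\<exists>f g. a = (A, f, g, B) \<and> (A, f, g, B) \<in> Arr G \<and> A \<in> Obj G \<and> B \<in> Obj G \<and>
      f \<in> Hom C (fst A) (fst B) \<and> g \<in> Hom C (fst (snd A)) (fst (snd B)) \<and>
      mid_arr a \<in> Hom C (mid A) (mid B) \<and> mid_arr a \<cdot> fst (rep A) = fst (rep B) \<cdot> g \<and>
      snd (rep B) \<cdot> mid_arr a = f \<cdot> snd (rep A)"
    if a: "a \<in> Hom G A B" for a A B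
  proof -
    obtain X Y \<mu> where A: "A = (X, Y, \<mu>)" by (rule prod_cases3)
    obtain X' Y' \<mu>' where B: "B = (X', Y', \<mu>')" by (rule prod_cases3)
    obtain f g where *: "A \<in> Obj G" "B \<in> Obj G" "M.compatible A f g B" "a = (A, f, g, B)"
      using a unfolding M.Hom_glued by blast
    then have arr: "(A, f, g, B) \<in> Arr G" by (simp only: M.Arr_glued)
    have "f \<in> Hom C (fst A) (fst B)" "g \<in> Hom C (fst (snd A)) (fst (snd B))"
      using *(3) compatible_iff [OF *(1,2) [unfolded A B]] by (simp_all add: A B)
    with * arr mid_arrD [OF arr [unfolded A B]] show ?thesis unfolding A B by blast
  qed
  have eq: "mid_arr (A, f, g, B) = h"
    if "(A, f, g, B) \<in> Arr G" "h \<in> Hom C (mid A) (mid B)" "h \<cdot> fst (rep A) = fst (rep B) \<cdot> g"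
      "snd (rep B) \<cdot> h = f \<cdot> snd (rep A)" for A B f g h
  proof -
    obtain X Y \<mu> where A: "A = (X, Y, \<mu>)" by (rule prod_cases3)
    obtain X' Y' \<mu>' where B: "B = (X', Y', \<mu>')" by (rule prod_cases3)
    show ?thesis
      using that mid_arrI unfolding A B by blast
  qed
  show ?thesis
  proof (intro additive_functor.intro additive_functor_axioms.intro M.preadditive_glued
      preadditive_category_axioms)
    show "mid A \<in> Obj C" if "A \<in> Obj G" for A using repD that by blast
    show "mid_arr a \<in> Hom C (mid A) (mid B)" if "a \<in> Hom G A B" for a A B
      using arr [OF that] by blast
    show "mid_arr (Ident G A) = Ident C (mid A)" if "A \<in> Obj G" for A
    proof -
      obtain X Y \<mu> where A: "A = (X, Y, \<mu>)" by (rule prod_cases3)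
      have I: "Ident G A = (A, Ident C X, Ident C Y, A)" by (simp add: A)
      show ?thesis
        unfolding I
        by (rule eq) (use repD [OF that] G.Ident_simps(1) [OF that] I in \<open>simp_all add: A del: M.Arr_glued M.Obj_glued\<close>)
    qed
    show "mid_arr (b \<cdot>\<^bsub>G\<^esub> a) = mid_arr b \<cdot> mid_arr a" if a: "a \<in> Hom G A B" and b: "b \<in> Hom G B D" for a b A B D
    proof -
      obtain f g where a': "a = (A, f, g, B)" "A \<in> Obj G" "B \<in> Obj G" "f \<in> Hom C (fst A) (fst B)"
        "g \<in> Hom C (fst (snd A)) (fst (snd B))" "mid_arr a \<in> Hom C (mid A) (mid B)"
        "mid_arr a \<cdot> fst (rep A) = fst (rep B) \<cdot> g" "snd (rep B) \<cdot> mid_arr a = f \<cdot> snd (rep A)"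
        using arr [OF a] by blast
      obtain f' g' where b': "b = (B, f', g', D)" "D \<in> Obj G" "f' \<in> Hom C (fst B) (fst D)"
        "g' \<in> Hom C (fst (snd B)) (fst (snd D))" "mid_arr b \<in> Hom C (mid B) (mid D)"
        "mid_arr b \<cdot> fst (rep B) = fst (rep D) \<cdot> g'" "snd (rep D) \<cdot> mid_arr b = f' \<cdot> snd (rep B)"
        using arr [OF b] by blast
      have ba: "b \<cdot>\<^bsub>G\<^esub> a = (A, f' \<cdot> f, g' \<cdot> g, D)" by (simp add: a'(1) b'(1))
      note R = repD [OF a'(2)] repD [OF a'(3)] repD [OF b'(2)]
      show ?thesis
        unfolding ba
      proof (rule eq)
        show "(A, f' \<cdot> f, g' \<cdot> g, D) \<in> Arr G"
          using G.Comp_Hom [OF a b] unfolding ba by (simp del: M.Arr_glued)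
        show "(mid_arr b \<cdot> mid_arr a) \<cdot> fst (rep A) = fst (rep D) \<cdot> g' \<cdot> g"
        proof -
          have "(mid_arr b \<cdot> mid_arr a) \<cdot> fst (rep A) = mid_arr b \<cdot> (fst (rep B) \<cdot> g)"
            using a'(6) b'(5) R by (simp add: a'(7))
          also have "\<dots> = (fst (rep D) \<cdot> g') \<cdot> g"
            by (rule Comp_rewrite [OF b'(6)]) (use a'(5) b'(5) R in auto)
          finally show ?thesis using a'(5) b'(4) R by simp
        qed
        show "snd (rep D) \<cdot> mid_arr b \<cdot> mid_arr a = (f' \<cdot> f) \<cdot> snd (rep A)"
        proof -
          have "snd (rep D) \<cdot> mid_arr b \<cdot> mid_arr a = (f' \<cdot> snd (rep B)) \<cdot> mid_arr a"
            by (rule Comp_rewrite [OF b'(7)]) (use a'(6) b'(5) R in auto)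
          also have "\<dots> = f' \<cdot> (f \<cdot> snd (rep A))"
            unfolding a'(8) [symmetric] using a'(6) b'(3) R by simp
          finally show ?thesis using a'(4) b'(3) R by simp
        qed
      qed (use a'(6) b'(5) in auto)
    qed
    show "mid_arr (a \<boxplus>\<^bsub>G\<^esub> b) = mid_arr a \<boxplus> mid_arr b" if a: "a \<in> Hom G A B" and b: "b \<in> Hom G A B" for a b A B
    proof -
      obtain f g where a': "a = (A, f, g, B)" "A \<in> Obj G" "B \<in> Obj G" "f \<in> Hom C (fst A) (fst B)"
        "g \<in> Hom C (fst (snd A)) (fst (snd B))" "mid_arr a \<in> Hom C (mid A) (mid B)"
        "mid_arr a \<cdot> fst (rep A) = fst (rep B) \<cdot> g" "snd (rep B) \<cdot> mid_arr a = f \<cdot> snd (rep A)"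
        using arr [OF a] by blast
      obtain f' g' where b': "b = (A, f', g', B)" "f' \<in> Hom C (fst A) (fst B)"
        "g' \<in> Hom C (fst (snd A)) (fst (snd B))" "mid_arr b \<in> Hom C (mid A) (mid B)"
        "mid_arr b \<cdot> fst (rep A) = fst (rep B) \<cdot> g'" "snd (rep B) \<cdot> mid_arr b = f' \<cdot> snd (rep A)"
        using arr [OF b] by blast
      have ab: "a \<boxplus>\<^bsub>G\<^esub> b = (A, f \<boxplus> f', g \<boxplus> g', B)" by (simp add: a'(1) b'(1))
      note R = repD [OF a'(2)] repD [OF a'(3)]
      have "a \<boxplus>\<^bsub>G\<^esub> b \<in> Arr G" using a b by (intro G.Add_simps) auto
      then show ?thesis
        unfolding ab by (rule eq) (use a'(4-8) b'(2-6) R in auto)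
    qed
  qed
qed

text \<open>Faithfulness cancels the mono \<open>fst (rep B)\<close> and the epi
  \<open>snd (rep A)\<close>. Fullness uses that homs from \<open>\<T>\<close> to
  \<open>\<F>\<close> vanish, and essential surjectivity uses the torsion sequences.\<close>

lemma equivalence_mid: "abelian_equivalence G C mid mid_arr"
proof (intro abelian_equivalence.intro additive_equivalence.intro functor_mid
    abelian_category_axioms additive_equivalence_axioms.intro)
  fix a b A B
  assume a: "a \<in> Hom G A B" and b: "b \<in> Hom G A B" and ab: "mid_arr a = mid_arr b"
  obtain X Y \<mu> where A: "A = (X, Y, \<mu>)" by (rule prod_cases3)
  obtain X' Y' \<mu>' where B: "B = (X', Y', \<mu>')" by (rule prod_cases3)
  obtain f g where a': "A \<in> Obj G" "B \<in> Obj G" "M.compatible A f g B" "a = (A, f, g, B)"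
    using a unfolding M.Hom_glued by blast
  obtain f' g' where b': "M.compatible A f' g' B" "b = (A, f', g', B)"
    using b unfolding M.Hom_glued by blast
  have arr: "(A, f, g, B) \<in> Arr G" "(A, f', g', B) \<in> Arr G"
    using a' b' by (simp_all only: M.Arr_glued)
  note e = rep(1) [OF a'(1) [unfolded A], folded A] and e' = rep(1) [OF a'(2) [unfolded B], folded B]
  have se: "short_exact C (fst (rep A)) (snd (rep A))" "short_exact C (fst (rep B)) (snd (rep B))"
    and XY: "Dom C (fst (rep A)) = Y" "Dom C (fst (rep B)) = Y'"
      "Cod C (snd (rep A)) = X" "Cod C (snd (rep B)) = X'"
    using e e' by (auto simp: extensions_iff)
  have fg: "f \<in> Hom C X X'" "g \<in> Hom C Y Y'" "f' \<in> Hom C X X'" "g' \<in> Hom C Y Y'"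
    using a'(3) b'(1) compatible_iff [OF a'(1,2) [unfolded A B]] unfolding A B by blast+
  note m = mid_arrD [OF arr(1) [unfolded A B], folded A B] mid_arrD [OF arr(2) [unfolded A B], folded A B]
  have g: "fst (rep B) \<cdot> g = fst (rep B) \<cdot> g'" and f: "f \<cdot> snd (rep A) = f' \<cdot> snd (rep A)"
    using m ab a'(4) b'(2) by auto
  have "g = g'"
    by (rule is_monoD [OF short_exact_mono [OF se(2)] _ _ _ _ _ g]) (use fg XY in auto)
  moreover have "f = f'"
    by (rule is_epiD [OF short_exact_epi [OF se(1)] _ _ _ _ _ f]) (use fg XY in auto)
  ultimately show "a = b" using a' b' by simp
next
  fix A B h assume O: "A \<in> Obj G" "B \<in> Obj G" and h: "h \<in> Hom C (mid A) (mid B)"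
  obtain X Y \<mu> where A: "A = (X, Y, \<mu>)" by (rule prod_cases3)
  obtain X' Y' \<mu>' where B: "B = (X', Y', \<mu>')" by (rule prod_cases3)
  note e = rep [OF O(1) [unfolded A], folded A] and e' = rep [OF O(2) [unfolded B], folded B]
  obtain g f where gf: "g \<in> Hom C Y Y'" "f \<in> Hom C X X'" "h \<cdot> fst (rep A) = fst (rep B) \<cdot> g"
    "snd (rep B) \<cdot> h = f \<cdot> snd (rep A)" "ext_mor C (rep A) (rep B) g f"
    by (rule ext_mor_of_middle [OF e(1) e'(1) Hom_T_F [OF e(4) e'(3)] h [unfolded mid_def]])
  have "M.compatible A f g B"
    using compatible_iff [OF O [unfolded A B]] gf unfolding A B by blast
  with O have arr: "(A, f, g, B) \<in> Arr G" by (simp only: M.Arr_glued)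
  have "mid_arr (A, f, g, B) = h"
    using mid_arrI [OF arr [unfolded A B]] h gf(3,4) unfolding A B by blast
  with arr show "\<exists>a\<in>Hom G A B. mid_arr a = h"
    by (intro bexI [of _ "(A, f, g, B)"]) (simp_all del: M.Arr_glued)
next
  fix E assume "E \<in> Obj C"
  then obtain i p where e: "short_exact C i p" and ip: "Cod C i = E" "Dom C i \<in> \<T>" "Cod C p \<in> \<F>"
    using torsion unfolding torsion_pair_def by blast
  \<comment> \<open>The triple of the torsion sequence of \<open>E\<close>. The chosen
    representative may differ from \<open>(i, p)\<close>, but it lies in the same class, so the
    middle objects are isomorphic.\<close>
  define A where "A = (Cod C p, Dom C i, ext_class C (i, p))"
  have ext: "(i, p) \<in> extensions C (Cod C p) (Dom C i)" using e by (simp add: extensions_iff)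
  have A: "A \<in> Obj G"
    using ip ext by (auto simp: A_def Ext_group_carrier)
  note r = rep [OF A [unfolded A_def], folded A_def]
  have "(rep A, (i, p)) \<in> ext_equiv C (Cod C p) (Dom C i)"
    using ext_class_eq_iff [OF r(1) ext] r ext by (simp add: ext_equiv_iff)
  then have "\<exists>u\<in>Hom C (mid A) E. is_iso C u"
    using ip(1) by (auto simp: ext_equiv_def mid_def split: prod.splits)
  with A show "\<exists>A\<in>Obj G. \<exists>u\<in>Hom C (mid A) E. is_iso C u" by blast
qed

end

text \<open>The first conjunct certifies that Ext is a legitimate gluing datum; it includes the
  additivity of both full subcategories, which is not among the hypotheses.\<close>

theorem proposition1p3:
  fixes C :: "('o, 'm, 'z) preadditive_scheme"
    and \<T> \<F> :: "'o set"
  assumes "abelian_category C"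
    and "torsion_pair C \<T> \<F>"
    and "\<And>F T. F \<in> \<F> \<Longrightarrow> T \<in> \<T> \<Longrightarrow> Hom C F T = {Zero C F T}"
  shows "biadditive_bifunctor (full_subcategory C \<F>) (full_subcategory C \<T>) (Ext_bifunctor C) \<and>
         equivalent_abelian_categories C
           (glued (full_subcategory C \<F>) (full_subcategory C \<T>) (Ext_bifunctor C))"
proof -
  interpret split_torsion_pair C \<T> \<F>
    using assms by (intro split_torsion_pair.intro split_torsion_pair_axioms.intro)
  show ?thesis
    \<comment> \<open>The functor runs from the glued category to \<open>C\<close>; the transport
      lemma states the resulting equivalence with \<open>C\<close> on the left.\<close>
    using M.biadditive_bifunctor_axioms
      abelian_equivalence.equivalent_abelian_categories_source [OF equivalence_mid] by blast
qed

end
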